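(* Let $k$ be a field of characteristic zero, let $R$ be an affine UFD over $k$ and let $B=R[x_0,x_1,x_2]\cong R^{[3]}$ be the polynomial ring in three variables over $R$. Let $(D,U)\in{\rm LND}_R(B)^2$ be a nontrivial fundamental pair for $B$. Then $(D,U)$ is equivalent over $R$ to either $$(x_0\partial_{x_1},\; x_1\partial_{x_0})\quad\text{or}\quad (x_0\partial_{x_1}+x_1\partial_{x_2},\; 2x_1\partial_{x_0}+2x_2\partial_{x_1}).$$
   Context: An affine UFD over $k$ is a unique factorization domain containing $k$ and finitely generated as a $k$-algebra. ${\rm LND}_R(B)$ is the set of locally nilpotent derivations $D$ of $B$ (for each $b\in B$ there is $n\ge 0$ with $D^nb=0$) such that $D(R)=\{0\}$. A pair $(D,U)\in{\rm LND}(B)^2$ is a fundamental pair for $B$ if (1) $[D,[D,U]]=-2D$ and $[U,[D,U]]=2U$; and (2) $B=\sum_{d\in\mathbb{Z}}B_d$ where $B_d=\ker([D,U]-dI)$. It is trivial if $D=U=0$ and nontrivial otherwise. Two fundamental pairs are equivalent if they lie in the same orbit under $(D,U)\mapsto(U,D)$, $(D,U)\mapsto(rD,r^{-1}U)$ for $r\in B^*$, and conjugation $(D,U)\mapsto(\alpha D\alpha^{-1},\alpha U\alpha^{-1})$ by automorphisms $\alpha$ of $B$; equivalent over $R$ means that the automorphisms $\alpha$ are taken to be $R$-algebra automorphisms of $B$. *)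

theory Defs
  imports Complex_Main
    "HOL-Computational_Algebra.Polynomial"
    "HOL-Computational_Algebra.Factorial_Ring"
begin

section \<open>Finitely generated algebras over a field\<close>

definition ring_morphism :: "('a::comm_ring_1 \<Rightarrow> 'b::comm_ring_1) \<Rightarrow> bool" where
  "ring_morphism f \<longleftrightarrow>
     f 1 = 1 \<and> (\<forall>a b. f (a + b) = f a + f b) \<and> (\<forall>a b. f (a * b) = f a * f b)"

text \<open>
  A ring containing a field \<open>k\<close> is given by its structure map \<open>\<iota>\<close>, a ring morphism from \<open>k\<close>.
  Such a map into a nonzero ring is automatically injective.
\<close>

definition subalgebra :: "('k::field \<Rightarrow> 'r::comm_ring_1) \<Rightarrow> 'r set \<Rightarrow> bool" where
  "subalgebra \<iota> A \<longleftrightarrow>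
     range \<iota> \<subseteq> A \<and> (\<forall>a\<in>A. \<forall>b\<in>A. a + b \<in> A) \<and> (\<forall>a\<in>A. \<forall>b\<in>A. a * b \<in> A)"

definition affine_algebra :: "('k::field \<Rightarrow> 'r::comm_ring_1) \<Rightarrow> bool" where
  "affine_algebra \<iota> \<longleftrightarrow>
     ring_morphism \<iota> \<and> (\<exists>S. finite S \<and> subalgebra \<iota> hull S = UNIV)"


section \<open>Locally nilpotent derivations and fundamental pairs\<close>

definition derivation :: "('b::comm_ring_1 \<Rightarrow> 'b) \<Rightarrow> bool" where
  "derivation D \<longleftrightarrow>
     (\<forall>a b. D (a + b) = D a + D b) \<and> (\<forall>a b. D (a * b) = a * D b + D a * b)"

definition LND :: "('b::comm_ring_1 \<Rightarrow> 'b) set" where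
  "LND = {D. derivation D \<and> (\<forall>b. \<exists>n. (D ^^ n) b = 0)}"

definition LND_over :: "'b::comm_ring_1 set \<Rightarrow> ('b \<Rightarrow> 'b) set" where
  "LND_over R = {D \<in> LND. \<forall>r\<in>R. D r = 0}"

definition commutator :: "('b::comm_ring_1 \<Rightarrow> 'b) \<Rightarrow> ('b \<Rightarrow> 'b) \<Rightarrow> 'b \<Rightarrow> 'b" where
  "commutator D U = (\<lambda>b. D (U b) - U (D b))"

definition eigenspace :: "('b::comm_ring_1 \<Rightarrow> 'b) \<Rightarrow> int \<Rightarrow> 'b set" where
  "eigenspace E d = {b. E b = of_int d * b}"

definition fundamental_pair :: "('b::comm_ring_1 \<Rightarrow> 'b) \<times> ('b \<Rightarrow> 'b) \<Rightarrow> bool" where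
  "fundamental_pair = (\<lambda>(D, U).
     D \<in> LND \<and> U \<in> LND \<and>
     commutator D (commutator D U) = (\<lambda>b. - 2 * D b) \<and>
     commutator U (commutator D U) = (\<lambda>b. 2 * U b) \<and>
     (\<forall>b. \<exists>S c. finite S \<and> (\<forall>d\<in>S. c d \<in> eigenspace (commutator D U) d) \<and> b = (\<Sum>d\<in>S. c d)))"

definition trivial_pair :: "('b::comm_ring_1 \<Rightarrow> 'b) \<times> ('b \<Rightarrow> 'b) \<Rightarrow> bool" where
  "trivial_pair P \<longleftrightarrow> P = ((\<lambda>b. 0), (\<lambda>b. 0))"

definition algebra_automorphism :: "'b::comm_ring_1 set \<Rightarrow> ('b \<Rightarrow> 'b) \<Rightarrow> bool" where
  "algebra_automorphism R \<alpha> \<longleftrightarrow> ring_morphism \<alpha> \<and> bij \<alpha> \<and> (\<forall>r\<in>R. \<alpha> r = r)"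

inductive pair_step_over ::
  "'b::comm_ring_1 set \<Rightarrow> ('b \<Rightarrow> 'b) \<times> ('b \<Rightarrow> 'b) \<Rightarrow> ('b \<Rightarrow> 'b) \<times> ('b \<Rightarrow> 'b) \<Rightarrow> bool"
  for R where
  swap: "pair_step_over R (D, U) (U, D)"
| scale: "r * s = 1 \<Longrightarrow> pair_step_over R (D, U) ((\<lambda>b. r * D b), (\<lambda>b. s * U b))"
| conjugate: "algebra_automorphism R \<alpha> \<Longrightarrow>
    pair_step_over R (D, U) (\<alpha> \<circ> D \<circ> inv \<alpha>, \<alpha> \<circ> U \<circ> inv \<alpha>)"

text \<open>
  Every step is undone by a step of the same kind, so the orbits are exactly the classes of the
  reflexive transitive closure.
\<close>

definition equivalent_over ::
  "'b::comm_ring_1 set \<Rightarrow> ('b \<Rightarrow> 'b) \<times> ('b \<Rightarrow> 'b) \<Rightarrow> ('b \<Rightarrow> 'b) \<times> ('b \<Rightarrow> 'b) \<Rightarrow> bool" where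
  "equivalent_over R = (pair_step_over R)\<^sup>*\<^sup>*"


section \<open>The polynomial ring in three variables\<close>

text \<open>
  \<open>R[x\<^sub>0,x\<^sub>1,x\<^sub>2]\<close> is the iterated polynomial ring \<open>R[x\<^sub>0][x\<^sub>1][x\<^sub>2]\<close>, with \<open>x\<^sub>0\<close> the innermost variable.
\<close>

type_synonym 'r poly3 = "'r poly poly poly"

definition const3 :: "'r::comm_ring_1 \<Rightarrow> 'r poly3" where
  "const3 r = [:[:[:r:]:]:]"

definition x0 :: "'r::comm_ring_1 poly3" where "x0 = [:[:[:0, 1:]:]:]"
definition x1 :: "'r::comm_ring_1 poly3" where "x1 = [:[:0, 1:]:]"
definition x2 :: "'r::comm_ring_1 poly3" where "x2 = [:0, 1:]"

definition d0 :: "'r::idom poly3 \<Rightarrow> 'r poly3" where "d0 = map_poly (map_poly pderiv)"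
definition d1 :: "'r::idom poly3 \<Rightarrow> 'r poly3" where "d1 = map_poly pderiv"

definition d2 :: "'r::idom poly3 \<Rightarrow> 'r poly3" where "d2 = pderiv"

end

theory Submission
  imports Defs
begin

text \<open>
  Put \<open>E = [D, U]\<close>, \<open>A = ker D\<close> and \<open>A\<^sub>0 = ker D \<inter> ker U\<close>. The projection \<open>B \<rightarrow> A\<^sub>0\<close> along \<open>D B + U B\<close>
  (Reynolds operator) kills the divergence of every vector field tangent to the orbits. Hence the
  determinant of \<open>D, U, E\<close> vanishes, for otherwise all vector fields would be tangent to the orbits
  after multiplication with it, including one of divergence 1. A coprime linear relation
  \<open>p D + q U + r E = 0\<close> is unique up to units, so bracketing it with \<open>D\<close> and \<open>U\<close> shows that \<open>q\<close> is a
  highest weight vector of weight 2, and that every prime highest weight vector of positive weight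
  divides \<open>q\<close> and all the others. So \<open>A = A\<^sub>0[g]\<close> with \<open>g\<close> of weight 1 or 2, and \<open>B = A\<^sub>0[g, U g, U\<^sup>2 g]\<close>.
  Moreover \<open>A\<^sub>0 = R[f]\<close>, because \<open>A\<^sub>0\<close> is factorially closed and of transcendence degree 1.

  In weight 1 this already gives \<open>B = R[g, U g, f]\<close>. In weight 2, with \<open>v = U g\<close> and \<open>w = U v\<close>, the
  only relation is \<open>v\<^sup>2 - 2 g w = P(f)\<close>. Expanding the Jacobian determinant of the coordinates shows
  that \<open>P\<close> and its derivative are coprime. Averaging the divergence of a vector field of divergence 1
  gives \<open>2 P = P' \<beta> + 2 P \<beta>'\<close> for some \<open>\<beta>\<close>, so \<open>P\<close> is constant or linear with a unit as leading
  coefficient. A constant \<open>P\<close> is impossible because the invariant area form of the orbits would be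
  exact by the Poincare lemma. So \<open>f\<close> can be eliminated, and \<open>B = R[g, v, w]\<close>.
\<close>

section \<open>Factorial domains\<close>

text \<open>The base \<open>R\<close> is a UFD, not a field, and no fraction field is formed:
  elimination is Cramer's rule and pseudo-division, and relations are made coprime by cancelling
  primes of \<open>B\<close>. Associates are harmless because units of \<open>B\<close> are
  constants, hence invariant. Integers produced by commuting \<open>D\<close> and \<open>U\<close>
  are inverted in \<open>B\<close>, so complete reducibility turns into explicit inductions on the
  nilpotency index of \<open>D\<close>. Transcendence degree enters by counting: four elements of
  \<open>B\<close> are always dependent over \<open>R\<close>, while \<open>g\<close> and
  \<open>U g\<close> are independent over the invariants. The generator \<open>f\<close> is a prime
  invariant vanishing at the origin; it divides every invariant vanishing there. In weight 2 the
  equation \<open>v^2 - 2 g w = P(f)\<close> carries the field \<open>2 P \<partial>_f + P' (g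
  \<partial>_g + v \<partial>_v + w \<partial>_w)\<close>. It commutes with \<open>D\<close> and
  \<open>U\<close>, has divergence \<open>3 P'\<close> and completes the orbit directions. Splitting
  \<open>2 P X\<close> along it, for \<open>X\<close> of divergence 1, produces the differential
  equation, with \<open>\<beta>\<close> the average of \<open>X f\<close>.\<close>

inductive prime_product :: "nat \<Rightarrow> 'a::comm_semiring_1 \<Rightarrow> bool" where
  unit: "u dvd 1 \<Longrightarrow> prime_product 0 u"
| prime: "prime_elem p \<Longrightarrow> prime_product n x \<Longrightarrow> prime_product (Suc n) (p * x)"

text \<open>A predicate on types, free of normal forms and gcds, so that it can be passed from
  \<open>R\<close> to the iterated polynomial ring by \<open>ufd_poly\<close>.\<close>

definition ufd :: "'a::idom itself \<Rightarrow> bool" where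
  "ufd _ \<longleftrightarrow> (\<forall>x::'a. x \<noteq> 0 \<longrightarrow> (\<exists>n. prime_product n x))"

lemma prime_product_mult_unit:
  assumes "prime_product n x" "u dvd 1"
  shows "prime_product n (u * x)"
  using assms
proof (induction rule: prime_product.induct)
  case (unit v)
  then have "u * v dvd 1 * 1" by (intro mult_dvd_mono)
  then show ?case by (simp add: prime_product.unit)
next
  case (prime p n x)
  then have "prime_product (Suc n) (p * (u * x))" by (simp add: prime_product.prime)
  then show ?case by (simp add: ac_simps)
qed

lemma prime_product_cancel_unit:
  assumes "prime_product n (u * x)" "u dvd 1"
  shows "prime_product n x"
proof -
  obtain v where v: "1 = u * v" using assms(2) by (auto elim: dvdE)
  have "prime_product n (v * (u * x))"
    by (rule prime_product_mult_unit[OF assms(1)]) (simp add: v)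
  also have "v * (u * x) = (u * v) * x" by (simp only: ac_simps)
  finally show ?thesis by (simp flip: v)
qed

lemma prime_product_mult:
  assumes "prime_product m x" "prime_product n y"
  shows "prime_product (m + n) (x * y)"
  using assms
proof (induction rule: prime_product.induct)
  case (unit u)
  then show ?case by (simp add: prime_product_mult_unit)
next
  case (prime p m x)
  then have "prime_product (Suc (m + n)) (p * (x * y))" by (simp add: prime_product.prime)
  then show ?case by (simp add: ac_simps)
qed

text \<open>If the first listed prime \<open>q\<close> divides \<open>p\<close>, the two are
  associated; otherwise it divides \<open>x\<close> and can be removed there. That the count drops
  by exactly one drives the inner induction of \<open>ufd_poly\<close>.\<close>

lemma prime_product_cancel_prime:
  fixes x :: "'a::idom"
  assumes "prime_product n (p * x)" "prime_elem p"
  shows "\<exists>m. n = Suc m \<and> prime_product m x"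
  using assms
proof (induction n "p * x" arbitrary: x rule: prime_product.induct)
  case unit
  then show ?case unfolding prime_elem_def by (metis dvd_mult_left)
next
  case (prime q n y x)
  have "q dvd p * x" using prime.hyps(4) by (metis dvd_triv_left)
  then consider "q dvd p" | "\<not> q dvd p" "q dvd x"
    using prime.hyps(1) prime_elem_dvd_multD by blast
  then show ?case
  proof cases
    case 1
    then obtain u where u: "p = q * u" by (auto elim: dvdE)
    have "p \<noteq> 0" using prime.prems by (simp add: prime_elem_def)
    have "\<not> p dvd u"
    proof
      assume "p dvd u"
      then obtain w where "u = p * w" by (auto elim: dvdE)
      then have "p * 1 = p * (q * w)" using u by (metis mult.assoc mult.commute mult.right_neutral)
      then have "1 = q * w" using \<open>p \<noteq> 0\<close> by (metis mult_cancel_left)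
      then show False using prime.hyps(1) unfolding prime_elem_def by (metis dvd_triv_left)
    qed
    then have "p dvd q" using prime.prems u unfolding prime_elem_def by (metis dvd_refl)
    then obtain w where "q = p * w" by (auto elim: dvdE)
    then have "p * 1 = p * (w * u)" using u by (metis mult.assoc mult.right_neutral)
    then have "1 = w * u" using \<open>p \<noteq> 0\<close> by (metis mult_cancel_left)
    then have "u dvd 1" by (metis dvd_triv_right)
    moreover have "y = u * x"
      using prime.hyps(1,4) u by (simp add: mult.assoc prime_elem_def)
    ultimately show ?thesis using prime.hyps(2) prime_product_cancel_unit by blast
  next
    case 2
    then obtain z where z: "x = q * z" by (auto elim: dvdE)
    have "y = p * z"
      using prime.hyps(1,4) z by (simp add: mult.left_commute prime_elem_def)
    then obtain m where "n = Suc m" "prime_product m z" using prime.hyps(3) prime.prems by blast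
    then show ?thesis using z prime.hyps(1) prime_product.prime by blast
  qed
qed

lemma prime_product_nonzero: "prime_product n (x::'a::idom) \<Longrightarrow> x \<noteq> 0"
  by (induction rule: prime_product.induct) auto

lemma ufd_dvdD:
  fixes x :: "'a::idom"
  assumes "ufd TYPE('a)" "x \<noteq> 0" "\<not> x dvd 1"
  obtains p where "prime_elem p" "p dvd x"
proof -
  obtain n where "prime_product n x" using assms unfolding ufd_def by blast
  then show ?thesis using assms(3) that by cases auto
qed

lemma ufd_induct [consumes 2, case_names unit prime]:
  fixes x :: "'a::idom"
  assumes "ufd TYPE('a)" "x \<noteq> 0"
    and "\<And>u. u dvd 1 \<Longrightarrow> P u"
    and "\<And>p x. prime_elem p \<Longrightarrow> x \<noteq> 0 \<Longrightarrow> P x \<Longrightarrow> P (p * x)"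
  shows "P x"
proof -
  obtain n where "prime_product n x" using assms(1,2) unfolding ufd_def by blast
  then show ?thesis
  proof (induction rule: prime_product.induct)
    case (unit u)
    then show ?case by (rule assms(3))
  next
    case (prime p n x)
    then show ?case using assms(4) prime_product_nonzero by metis
  qed
qed

text \<open>One form of Gauss's lemma. Prime factors of the constant \<open>d\<close> stay prime as
  constant polynomials; none divides the primitive \<open>p\<close>, so each passes to the cofactor
  and cancels.\<close>

lemma primitive_dvd_smultD:
  fixes p :: "'a::idom poly"
  assumes "ufd TYPE('a)" "d \<noteq> 0"
    and primitive: "\<And>c. prime_elem c \<Longrightarrow> \<not> [:c:] dvd p"
    and "p dvd [:d:] * a"
  shows "p dvd a"
  using assms(1,2,4)
proof (induction d arbitrary: a rule: ufd_induct)
  case (unit u)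
  then have "[:u:] dvd 1" by (simp add: is_unit_const_poly_iff)
  then obtain v where "1 = [:u:] * v" by (auto elim: dvdE)
  then have "a = ([:u:] * a) * v" by (metis mult.assoc mult.commute mult.right_neutral)
  then show ?case using unit by (metis dvd_mult2)
next
  case (prime c d)
  then obtain b where b: "[:c * d:] * a = p * b" by (auto elim: dvdE)
  have lift: "prime_elem [:c:]" using prime by (simp add: lift_prime_elem_poly)
  have split: "[:c * d:] * a = [:c:] * ([:d:] * a)" by (simp add: mult.commute)
  have "[:c:] dvd p * b" unfolding b[symmetric] split by (rule dvd_triv_left)
  then have "[:c:] dvd b" using lift primitive prime by (simp add: prime_elem_dvd_mult_iff)
  then obtain b' where "b = [:c:] * b'" by (auto elim: dvdE)
  then have "[:c:] * ([:d:] * a) = [:c:] * (p * b')" using b split by (simp add: ac_simps)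
  then have "[:d:] * a = p * b'" using lift unfolding prime_elem_def by (metis mult_cancel_left)
  then show ?case using prime.IH by (metis dvd_triv_left)
qed

text \<open>Another form of Gauss's lemma: every prime of the denominator \<open>d\<close> divides
  \<open>h\<close> or \<open>q\<close> and can be cancelled there.\<close>

lemma smult_eq_mult_split:
  fixes p :: "'a::idom poly"
  assumes "ufd TYPE('a)" "d \<noteq> 0" "[:d:] * p = h * q"
  shows "\<exists>d1 d2 h' q'. h = [:d1:] * h' \<and> q = [:d2:] * q' \<and> p = h' * q'"
  using assms
proof (induction d arbitrary: h q rule: ufd_induct)
  case (unit u)
  then obtain v where v: "1 = u * v" by (auto elim: dvdE)
  have "[:v:] * ([:u:] * p) = [:v:] * (h * q)" using unit by simp
  then have "p = h * ([:v:] * q)"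
    using v by (simp add: mult.commute[of v])
  moreover have "q = [:u:] * ([:v:] * q)" using v by (simp add: mult.commute[of v])
  moreover have "h = [:1:] * h" by simp
  ultimately show ?case by blast
next
  case (prime c d)
  have lift: "prime_elem [:c:]" using prime by (simp add: lift_prime_elem_poly)
  have split: "[:c:] * ([:d:] * p) = h * q" using prime.prems by (simp add: mult.commute[of d])
  then have "[:c:] dvd h * q" by (metis dvd_triv_left)
  then consider "[:c:] dvd h" | "[:c:] dvd q" using lift prime_elem_dvd_multD by blast
  then show ?case
  proof cases
    case 1
    then obtain h2 where h2: "h = [:c:] * h2" by (auto elim: dvdE)
    then have "[:c:] * ([:d:] * p) = [:c:] * (h2 * q)" using split by (simp only: mult.assoc)
    then have "[:d:] * p = h2 * q" using lift unfolding prime_elem_def by (metis mult_cancel_left)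
    then obtain d1 d2 h' q' where "h2 = [:d1:] * h'" "q = [:d2:] * q'" "p = h' * q'"
      using prime.IH by blast
    moreover from this have "h = [:c * d1:] * h'" using h2 by (simp add: mult.commute)
    ultimately show ?thesis by blast
  next
    case 2
    then obtain q2 where q2: "q = [:c:] * q2" by (auto elim: dvdE)
    then have "[:c:] * ([:d:] * p) = [:c:] * (h * q2)" using split by (simp only: mult.left_commute)
    then have "[:d:] * p = h * q2" using lift unfolding prime_elem_def by (metis mult_cancel_left)
    then obtain d1 d2 h' q' where "h = [:d1:] * h'" "q2 = [:d2:] * q'" "p = h' * q'"
      using prime.IH by blast
    moreover from this have "q = [:c * d2:] * q'" using q2 by (simp add: mult.commute)
    ultimately show ?thesis by blast
  qed
qed

text \<open>Replaces the Euclidean algorithm over the fraction field. By pseudo-division an element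
  \<open>h\<close> of least degree in the ideal of \<open>p\<close> and \<open>a\<close> divides all
  its members up to constants. If \<open>h\<close> is constant, \<open>p\<close> divides
  \<open>h * b\<close>; otherwise \<open>h\<close> is a multiple of \<open>p\<close>, and
  \<open>p\<close> divides a constant multiple of \<open>a\<close>. Primitivity removes the
  constants.\<close>

lemma primitive_irreducible_imp_prime:
  fixes p :: "'a::idom poly"
  assumes ufd: "ufd TYPE('a)"
    and deg: "degree p > 0"
    and primitive: "\<And>c. prime_elem c \<Longrightarrow> \<not> [:c:] dvd p"
    and irred: "\<And>a b. p = a * b \<Longrightarrow> degree a = 0 \<or> degree b = 0"
  shows "prime_elem p"
proof (rule prime_elemI)
  show "p \<noteq> 0" using deg by auto
  show "\<not> p dvd 1" using deg by (auto simp: is_unit_poly_iff)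
next
  fix a b assume ab: "p dvd a * b"
  define I where "I = {s * p + t * a |s t. True}"
  have "p \<in> I" unfolding I_def by (rule CollectI, rule exI[of _ 1], rule exI[of _ 0]) simp
  then have "\<exists>h. h \<in> I \<and> h \<noteq> 0" using deg by (intro exI[of _ p]) auto
  then obtain h where h: "h \<in> I" "h \<noteq> 0" and min: "\<And>y. y \<in> I \<Longrightarrow> y \<noteq> 0 \<Longrightarrow> degree h \<le> degree y"
    using ex_has_least_nat[of "\<lambda>h. h \<in> I \<and> h \<noteq> 0" _ degree] by metis
  have divides: "\<exists>d q. d \<noteq> 0 \<and> [:d:] * y = h * q" if y: "y \<in> I" for y
  proof -
    obtain q r where qr: "pseudo_divmod y h = (q, r)" by force
    define d where "d = coeff h (degree h) ^ (Suc (degree y) - degree h)"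
    have eq: "smult d y = h * q + r" and r: "r = 0 \<or> degree r < degree h"
      using pseudo_divmod[OF h(2) qr] unfolding d_def by auto
    obtain s t s' t' where "y = s * p + t * a" "h = s' * p + t' * a" using y h unfolding I_def by auto
    then have "r = ([:d:] * s - q * s') * p + ([:d:] * t - q * t') * a" using eq
      by (simp add: algebra_simps smult_add_right)
    then have "r \<in> I" unfolding I_def by blast
    then have "r = 0" using r min by fastforce
    moreover have "d \<noteq> 0" using h unfolding d_def by simp
    ultimately show ?thesis using eq by auto
  qed
  show "p dvd a \<or> p dvd b"
  proof (cases "degree h = 0")
    case True
    then obtain c where c: "h = [:c:]" by (auto elim: degree_eq_zeroE)
    obtain s t where "h = s * p + t * a" using h unfolding I_def by auto
    then have "[:c:] * b = s * b * p + t * (a * b)" using c by (simp add: algebra_simps)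
    then have "p dvd [:c:] * b" using ab by simp
    then show ?thesis using primitive_dvd_smultD[OF ufd _ primitive] c h by auto
  next
    case False
    obtain d q where d: "d \<noteq> 0" "[:d:] * p = h * q" using divides \<open>p \<in> I\<close> by blast
    then obtain d1 d2 h' q' where split: "h = [:d1:] * h'" "q = [:d2:] * q'" "p = h' * q'"
      using smult_eq_mult_split[OF ufd] by blast
    have "degree h' \<noteq> 0" using split False by (auto split: if_splits)
    then obtain e where e: "q' = [:e:]" using irred split by (metis degree_eq_zeroE)
    have "e \<noteq> 0" using split e deg by auto
    have "e dvd 1"
    proof (rule ccontr)
      assume "\<not> e dvd 1"
      then obtain c where "prime_elem c" "c dvd e" using ufd_dvdD[OF ufd \<open>e \<noteq> 0\<close>] by blast
      then have "[:c:] dvd [:e:]" by (simp add: const_poly_dvd_const_poly_iff)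
      then show False using primitive[OF \<open>prime_elem c\<close>] split(3) e by (metis dvd_mult)
    qed
    then obtain v where v: "1 = [:e:] * v"
      by (metis is_unit_const_poly_iff dvdE)
    then have "h' = p * v" using split e by (metis mult.assoc mult.right_neutral)
    then have "p dvd h'" by simp
    then have "p dvd h" unfolding split(1) by (rule dvd_mult)
    have "a \<in> I" unfolding I_def by (rule CollectI, rule exI[of _ 0], rule exI[of _ 1]) simp
    then obtain d' q' where "d' \<noteq> 0" "[:d':] * a = h * q'" using divides by blast
    then show ?thesis using primitive_dvd_smultD[OF ufd _ primitive] \<open>p dvd h\<close> by (metis dvd_mult2)
  qed
qed

lemma prime_product_const_poly: "prime_product n (c::'a::idom) \<Longrightarrow> prime_product n [:c:]"
proof (induction rule: prime_product.induct)
  case (unit u)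
  then show ?case by (simp add: is_unit_const_poly_iff prime_product.unit)
next
  case (prime p n x)
  then have "prime_product (Suc n) ([:p:] * [:x:])"
    by (intro prime_product.prime) (simp_all add: lift_prime_elem_poly)
  then show ?case by (simp add: mult.commute)
qed

text \<open>Induct on the degree, and inside it on the number of prime factors of the leading
  coefficient: a constant prime factor lowers the second, a proper factorization the first, and what
  admits neither is prime.\<close>

lemma ufd_poly:
  assumes ufd: "ufd TYPE('a::idom)"
  shows "ufd TYPE('a poly)"
proof -
  have "\<exists>n. prime_product n p" if "p \<noteq> 0" for p :: "'a poly"
    using that
  proof (induction "degree p" arbitrary: p rule: less_induct)
    case less
    show ?case
    proof (cases "degree p = 0")
      case True
      then obtain c where "p = [:c:]" by (auto elim: degree_eq_zeroE)
      then show ?thesis using less.prems ufd prime_product_const_poly unfolding ufd_def by fastforce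
    next
      case False
      have "\<exists>n. prime_product n q"
        if "prime_product m (lead_coeff q)" "degree q = degree p" for m and q :: "'a poly"
        using that
      proof (induction m arbitrary: q rule: less_induct)
        case inner: (less m)
        show ?case
        proof (cases "\<exists>c. prime_elem c \<and> [:c:] dvd q")
          case True
          then obtain c r where c: "prime_elem c" "q = [:c:] * r" by (auto elim: dvdE)
          have "c \<noteq> 0" using c(1) by (simp add: prime_elem_def)
          then have "lead_coeff q = c * lead_coeff r" "degree q = degree r"
            using c(2) by (auto simp: degree_smult_eq)
          then obtain l where "m = Suc l" "prime_product l (lead_coeff r)"
            using prime_product_cancel_prime c inner.prems by metis
          then obtain n where "prime_product n r"
            using inner \<open>degree q = degree r\<close> by (metis lessI)
          then have "prime_product (Suc n) q"
            unfolding c(2) by (intro prime_product.prime lift_prime_elem_poly c(1))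
          then show ?thesis by blast
        next
          case prim: False
          show ?thesis
          proof (cases "\<forall>a b. q = a * b \<longrightarrow> degree a = 0 \<or> degree b = 0")
            case True
            then have "prime_elem q"
              using primitive_irreducible_imp_prime[OF ufd] prim False inner.prems(2) by auto
            then have "prime_product (Suc 0) (q * 1)"
              by (intro prime_product.prime prime_product.unit) auto
            then show ?thesis by auto
          next
            case False
            then obtain a b where ab: "q = a * b" "degree a \<noteq> 0" "degree b \<noteq> 0" by blast
            then have nz: "a \<noteq> 0" "b \<noteq> 0" by auto
            then have "degree q = degree a + degree b" using ab by (simp add: degree_mult_eq)
            then have "degree a < degree p" "degree b < degree p" using ab inner.prems by auto
            then obtain m n where "prime_product m a" "prime_product n b" using less.hyps nz by blast
            then show ?thesis using prime_product_mult ab by blast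
          qed
        qed
      qed
      moreover obtain m where "prime_product m (lead_coeff p)"
        using ufd less.prems unfolding ufd_def by (metis leading_coeff_0_iff)
      ultimately show ?thesis by blast
    qed
  qed
  then show ?thesis unfolding ufd_def by blast
qed

lemma ufd_factorial_semiring: "ufd TYPE('a::{factorial_semiring, idom})"
proof -
  have "\<exists>n. prime_product n x" if "x \<noteq> 0" for x :: 'a
  proof -
    from prime_factorization_exists[OF that] obtain A
      where A: "\<And>x. x \<in># A \<Longrightarrow> prime_elem x" "normalize (prod_mset A) = normalize x" by metis
    have "prime_product (size A) (prod_mset A)" using A(1)
      by (induction A) (auto intro: prime_product.intros)
    moreover obtain u where "u dvd 1" "x = u * prod_mset A"
      using A(2) associatedE1 by (metis mult.commute)
    ultimately show ?thesis using prime_product_mult_unit by blast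
  qed
  then show ?thesis unfolding ufd_def by blast
qed

text \<open>A prime factor of \<open>r\<close> fails to divide \<open>p\<close> or \<open>q\<close>,
  so it divides \<open>s\<close> and cancels. Hence all relations are multiples of a coprime one,
  see \<open>weight_2_relation\<close>.\<close>

lemma ufd_cancel_coprime:
  fixes r :: "'a::idom"
  assumes "ufd TYPE('a)" "r \<noteq> 0"
    and "\<And>c. prime_elem c \<Longrightarrow> c dvd r \<Longrightarrow> c dvd p \<Longrightarrow> \<not> c dvd q"
    and "r dvd s * p" "r dvd s * q"
  shows "r dvd s"
  using assms
proof (induction r arbitrary: s rule: ufd_induct)
  case (unit u)
  then show ?case by (metis dvd_trans one_dvd)
next
  case (prime c r)
  have "c dvd s * p" "c dvd s * q" using prime.prems by (auto dest: dvd_mult_left)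
  moreover have "\<not> c dvd p \<or> \<not> c dvd q" using prime.prems prime.hyps by (metis dvd_triv_left)
  ultimately have "c dvd s" using prime.hyps by (metis prime_elem_dvd_multD)
  then obtain s' where s': "s = c * s'" by (auto elim: dvdE)
  have "r dvd s' * p" "r dvd s' * q"
    using prime.prems(2,3) prime.hyps(1) s' by (auto simp: mult.assoc prime_elem_def)
  then have "r dvd s'" using prime.IH prime.prems(1) by (metis dvd_mult)
  then show ?case using s' by auto
qed

section \<open>Locally nilpotent derivations\<close>

text \<open>The ring contains the rationals, stated through invertible positive integers so that it
  passes to polynomial rings without a structure map.\<close>

definition rational_algebra :: "'a::idom itself \<Rightarrow> bool" where
  "rational_algebra _ \<longleftrightarrow> (\<forall>n>0. (of_nat n :: 'a) dvd 1)"

lemma rational_algebra_of_int_inverse: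
  assumes "rational_algebra TYPE('a::idom)" "k \<noteq> 0"
  obtains u :: "'a::idom" where "of_int k * u = 1"
proof -
  have "nat \<bar>k\<bar> > 0" using assms(2) by simp
  then have "(of_nat (nat \<bar>k\<bar>) :: 'a) dvd 1" using assms(1) unfolding rational_algebra_def by blast
  then obtain v :: 'a where v: "1 = of_nat (nat \<bar>k\<bar>) * v" by (auto elim: dvdE)
  have "of_int k = (of_int (sgn k) :: 'a) * of_nat (nat \<bar>k\<bar>)"
    by (cases "k \<ge> 0") (auto simp: sgn_if)
  moreover have "(of_int (sgn k) :: 'a) * of_int (sgn k) = 1"
    using assms(2) by (auto simp: sgn_if)
  ultimately have "of_int k * (of_int (sgn k) * v) = 1" using v
    by (metis (no_types, lifting) mult.assoc mult.commute mult_1)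
  then show ?thesis using that by blast
qed

lemma rational_algebra_of_int_eq_0:
  assumes "rational_algebra TYPE('a::idom)"
  shows "of_int k = (0::'a::idom) \<longleftrightarrow> k = 0"
  using rational_algebra_of_int_inverse[OF assms, of k] by (metis mult_zero_left of_int_0 zero_neq_one)

lemma rational_algebra_of_nat_eq_0:
  assumes "rational_algebra TYPE('a::idom)"
  shows "of_nat k = (0::'a::idom) \<longleftrightarrow> k = 0"
  using rational_algebra_of_int_eq_0[OF assms, of "int k"] by simp

lemma rational_algebra_poly:
  assumes "rational_algebra TYPE('a::idom)"
  shows "rational_algebra TYPE('a::idom poly)"
  using assms unfolding rational_algebra_def
  by (metis is_unit_const_poly_iff of_nat_poly)

section \<open>Calculus of a single derivation\<close>

context
  fixes D :: "'b::idom \<Rightarrow> 'b"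
  assumes D: "derivation D"
begin

lemma derivation_add: "D (a + b) = D a + D b"
  using D unfolding derivation_def by blast

lemma derivation_mult: "D (a * b) = a * D b + D a * b"
  using D unfolding derivation_def by blast

lemma derivation_0 [simp]: "D 0 = 0"
  by (metis add.right_neutral add_left_imp_eq derivation_add)

lemma derivation_1 [simp]: "D 1 = 0"
  by (metis add.right_neutral add_left_imp_eq derivation_mult mult_1 mult_1_right)

lemma derivation_minus: "D (- a) = - D a"
  by (metis add.right_inverse derivation_0 derivation_add minus_unique)

lemma derivation_diff: "D (a - b) = D a - D b"
  by (metis derivation_add derivation_minus diff_conv_add_uminus)

lemma derivation_sum: "D (sum f S) = (\<Sum>i\<in>S. D (f i))"
  by (induction S rule: infinite_finite_induct) (auto simp: derivation_add)

lemma derivation_of_nat [simp]: "D (of_nat n) = 0"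
  by (induction n) (auto simp: derivation_add)

lemma derivation_of_int [simp]: "D (of_int n) = 0"
  by (cases n rule: int_cases2) (auto simp: derivation_minus)

lemma derivation_numeral [simp]: "D (numeral n) = 0"
  using derivation_of_nat[of "numeral n"] by simp

lemma derivation_const_mult: "D c = 0 \<Longrightarrow> D (c * a) = c * D a"
  by (simp add: derivation_mult)

lemma derivation_int_inverse:
  assumes "rational_algebra TYPE('b)" "k \<noteq> 0" "of_int k * u = 1"
  shows "D u = 0"
  using derivation_const_mult[of "of_int k" u] assms rational_algebra_of_int_eq_0[OF assms(1), of k] by simp

lemma derivation_power: "D (a ^ Suc n) = of_nat (Suc n) * a ^ n * D a"
  by (induction n) (auto simp: derivation_mult algebra_simps)

lemma derivation_funpow_add: "(D ^^ n) (a + b) = (D ^^ n) a + (D ^^ n) b"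
  by (induction n) (auto simp: derivation_add)

lemma derivation_funpow_0 [simp]: "(D ^^ n) 0 = 0"
  by (induction n) auto

lemma derivation_funpow_const_mult: "D c = 0 \<Longrightarrow> (D ^^ n) (c * a) = c * (D ^^ n) a"
  by (induction n) (auto simp: derivation_const_mult)

lemma derivation_funpow_diff: "(D ^^ n) (a - b) = (D ^^ n) a - (D ^^ n) b"
  by (induction n) (auto simp: derivation_diff)

text \<open>In the Leibniz expansion only the term with \<open>i\<close> derivatives on
  \<open>a\<close> and \<open>j\<close> on \<open>b\<close> survives.\<close>

lemma derivation_funpow_mult_top:
  assumes "(D ^^ Suc i) a = 0" "(D ^^ Suc j) b = 0"
  shows "(D ^^ (i + j)) (a * b) = of_nat ((i + j) choose i) * (D ^^ i) a * (D ^^ j) b"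
  using assms
proof (induction "i + j" arbitrary: i j a b)
  case 0
  then show ?case by simp
next
  case (Suc n)
  have left: "(D ^^ n) (a * D b) = of_nat (n choose i) * (D ^^ i) a * (D ^^ j) b" if nz: "j \<noteq> 0"
  proof -
    obtain l where l: "j = Suc l" using nz by (cases j) auto
    have "(D ^^ Suc l) (D b) = 0" using Suc.prems(2) l by (simp add: funpow_swap1)
    then have "(D ^^ (i + l)) (a * D b) = of_nat ((i + l) choose i) * (D ^^ i) a * (D ^^ l) (D b)"
      using Suc.hyps Suc.prems l by auto
    then show ?thesis using l Suc.hyps(2) by (simp add: funpow_swap1)
  qed
  have right: "(D ^^ n) (D a * b) = of_nat (n choose (i - 1)) * (D ^^ i) a * (D ^^ j) b" if nz: "i \<noteq> 0"
  proof -
    obtain l where l: "i = Suc l" using nz by (cases i) auto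
    have "(D ^^ Suc l) (D a) = 0" using Suc.prems(1) l by (simp add: funpow_swap1)
    then have "(D ^^ (l + j)) (D a * b) = of_nat ((l + j) choose l) * (D ^^ l) (D a) * (D ^^ j) b"
      using Suc.hyps Suc.prems l by auto
    then show ?thesis using l Suc.hyps(2) by (simp add: funpow_swap1)
  qed
  have "(D ^^ Suc n) (a * b) = (D ^^ n) (D (a * b))"
    by (simp add: funpow_swap1)
  then have step: "(D ^^ Suc n) (a * b) = (D ^^ n) (a * D b) + (D ^^ n) (D a * b)"
    by (simp add: derivation_mult derivation_funpow_add)
  show ?case
  proof (cases "i = 0 \<or> j = 0")
    case True
    then consider "i = 0" "j \<noteq> 0" | "j = 0" "i \<noteq> 0" using Suc.hyps(2) by fastforce
    then show ?thesis
    proof cases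
      case 1
      then have "D a = 0" using Suc.prems by simp
      then show ?thesis using left 1 step Suc.hyps(2) by simp
    next
      case 2
      then have "D b = 0" using Suc.prems by simp
      moreover have "i = Suc n" using 2 Suc.hyps(2) by simp
      ultimately show ?thesis using right 2 step by simp
    qed
  next
    case False
    then obtain l where l: "i = Suc l" by (cases i) auto
    have "(Suc n choose i) = (n choose i) + (n choose l)" using l by simp
    then show ?thesis unfolding Suc.hyps(2)[symmetric] using step left right l False
      by (simp add: algebra_simps)
  qed
qed

end

section \<open>Local nilpotency and the degree it defines\<close>

lemma LND_derivation: "D \<in> LND \<Longrightarrow> derivation D"
  unfolding LND_def by blast

lemma LND_nilpotent:
  assumes "D \<in> LND"
  obtains n where "(D ^^ n) b = 0"
  using assms unfolding LND_def by blast

lemma LND_top: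
  assumes "D \<in> LND" "b \<noteq> 0"
  obtains i where "(D ^^ i) b \<noteq> 0" "(D ^^ Suc i) b = 0"
proof -
  have "\<exists>n. (D ^^ n) b = 0" using LND_nilpotent[OF assms(1)] by metis
  then have least: "(D ^^ (LEAST n. (D ^^ n) b = 0)) b = 0" by (rule LeastI_ex)
  then obtain i where i: "(LEAST n. (D ^^ n) b = 0) = Suc i"
    using assms(2) by (cases "LEAST n. (D ^^ n) b = 0") auto
  have "(D ^^ i) b \<noteq> 0" using not_less_Least[of i "\<lambda>n. (D ^^ n) b = 0"] i by simp
  then show ?thesis using that least i by simp
qed

context
  fixes D :: "'b::idom \<Rightarrow> 'b"
  assumes rat: "rational_algebra TYPE('b)" and D: "D \<in> LND"
begin

lemma LND_mult_top_nonzero: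
  assumes "(D ^^ i) a \<noteq> 0" "(D ^^ Suc i) a = 0" "(D ^^ j) b \<noteq> 0" "(D ^^ Suc j) b = 0"
  shows "(D ^^ (i + j)) (a * b) \<noteq> 0"
  using assms derivation_funpow_mult_top[OF LND_derivation[OF D], of i a j b]
    rational_algebra_of_nat_eq_0[OF rat, of "(i + j) choose i"] by (simp add: binomial_eq_0_iff)

text \<open>The nilpotency degree is additive on products, like a polynomial degree, so factors of
  an element of degree 0 have degree 0.\<close>

lemma LND_kernel_factorially_closed:
  assumes "D (a * b) = 0" "a * b \<noteq> 0"
  shows "D a = 0"
proof -
  have "a \<noteq> 0" "b \<noteq> 0" using assms by auto
  obtain i where i: "(D ^^ i) a \<noteq> 0" "(D ^^ Suc i) a = 0" using LND_top[OF D \<open>a \<noteq> 0\<close>] by blast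
  obtain j where j: "(D ^^ j) b \<noteq> 0" "(D ^^ Suc j) b = 0" using LND_top[OF D \<open>b \<noteq> 0\<close>] by blast
  have "(D ^^ (i + j)) (a * b) \<noteq> 0" using LND_mult_top_nonzero i j by blast
  moreover have "(D ^^ Suc m) (a * b) = 0" for m
    using assms LND_derivation[OF D] by (simp add: funpow_swap1)
  ultimately have "i + j = 0" by (cases "i + j") auto
  then show ?thesis using i by simp
qed

text \<open>Applying \<open>D\<close> lowers the nilpotency degree, whereas multiplying
  \<open>y\<close> by a nonzero \<open>c\<close> cannot.\<close>

lemma LND_dvd_imp_0:
  assumes "y dvd D y"
  shows "D y = 0"
proof (rule ccontr)
  assume nz: "D y \<noteq> 0"
  obtain c where c: "D y = y * c" using assms by (auto elim: dvdE)
  then have "c \<noteq> 0" "y \<noteq> 0" using nz by auto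
  obtain i where i: "(D ^^ i) y \<noteq> 0" "(D ^^ Suc i) y = 0" using LND_top[OF D \<open>y \<noteq> 0\<close>] by blast
  obtain j where j: "(D ^^ j) c \<noteq> 0" "(D ^^ Suc j) c = 0" using LND_top[OF D \<open>c \<noteq> 0\<close>] by blast
  have "(D ^^ (i + j)) (D y) \<noteq> 0" unfolding c using LND_mult_top_nonzero i j by blast
  moreover have "(D ^^ (i + j)) (D y) = (D ^^ j) ((D ^^ Suc i) y)"
    by (simp add: add.commute[of i] funpow_add funpow_swap1)
  ultimately show False using i LND_derivation[OF D] by simp
qed

end

section \<open>Fundamental pairs as representations\<close>

text \<open>\<open>E\<close> is a parameter bound by an equation, so that exchanging
  \<open>D\<close> and \<open>U\<close> gives another instance, with \<open>- E\<close>.\<close>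

locale sl2_pair =
  fixes D U E :: "'b::idom \<Rightarrow> 'b"
  assumes rat: "rational_algebra TYPE('b)"
    and D_LND: "D \<in> LND" and U_LND: "U \<in> LND"
    and E_eq: "E b = D (U b) - U (D b)"
    and D_E: "D (E b) - E (D b) = - 2 * D b"
    and U_E: "U (E b) - E (U b) = 2 * U b"
    and decomp: "\<exists>S c. finite S \<and> (\<forall>d\<in>S. c d \<in> eigenspace E d) \<and> b = (\<Sum>d\<in>S. c d)"
begin

text \<open>Transfers facts on highest weights and \<open>D\<close> to lowest weights and
  \<open>U\<close>.\<close>

lemma swapped: "sl2_pair U D (\<lambda>b. - E b)"
proof
  have minus: "U (- b) = - U b" "D (- b) = - D b" for b
    using derivation_minus LND_derivation U_LND D_LND by blast+
  fix b
  show "- E b = U (D b) - D (U b)" by (simp add: E_eq)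
  show "U (- E b) - - E (U b) = - 2 * U b" using U_E[of b] by (simp add: minus algebra_simps)
  show "D (- E b) - - E (D b) = 2 * D b" using D_E[of b] by (simp add: minus algebra_simps)
  obtain S c where S: "finite S" "\<forall>d\<in>S. c d \<in> eigenspace E d" "b = sum c S" using decomp by blast
  have "b = (\<Sum>d\<in>uminus ` S. c (- d))"
    by (subst sum.reindex) (auto simp: S(3))
  then show "\<exists>S c. finite S \<and> (\<forall>d\<in>S. c d \<in> eigenspace (\<lambda>b. - E b) d) \<and> b = (\<Sum>d\<in>S. c d)"
    using S by (intro exI[of _ "uminus ` S"] exI[of _ "\<lambda>d. c (- d)"]) (auto simp: eigenspace_def)
qed (fact rat U_LND D_LND)+

lemma D_der: "derivation D" and U_der: "derivation U"
  using D_LND U_LND LND_derivation by auto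

lemma E_der: "derivation E"
  unfolding derivation_def E_eq
  by (simp add: derivation_add[OF D_der] derivation_add[OF U_der] derivation_mult[OF D_der]
      derivation_mult[OF U_der] algebra_simps)

lemmas D_simps = derivation_add[OF D_der] derivation_diff[OF D_der] derivation_minus[OF D_der]
  derivation_0[OF D_der] derivation_1[OF D_der] derivation_of_int[OF D_der]
  derivation_of_nat[OF D_der] derivation_numeral[OF D_der]
lemmas U_simps = derivation_add[OF U_der] derivation_diff[OF U_der] derivation_minus[OF U_der]
  derivation_0[OF U_der] derivation_1[OF U_der] derivation_of_int[OF U_der]
  derivation_of_nat[OF U_der] derivation_numeral[OF U_der]
lemmas E_simps = derivation_add[OF E_der] derivation_diff[OF E_der] derivation_minus[OF E_der]
  derivation_0[OF E_der] derivation_1[OF E_der] derivation_of_int[OF E_der]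
  derivation_of_nat[OF E_der] derivation_numeral[OF E_der]
lemmas D_mult = derivation_mult[OF D_der]
lemmas U_mult = derivation_mult[OF U_der]
lemmas E_mult = derivation_mult[OF E_der]

lemma D_of_int: "D (of_int k * x) = of_int k * D x"
  and U_of_int: "U (of_int k * x) = of_int k * U x"
  by (simp_all add: derivation_const_mult[OF D_der] derivation_const_mult[OF U_der]
      derivation_of_int[OF D_der] derivation_of_int[OF U_der])

lemma of_int_eq_0: "of_int k = (0::'b) \<longleftrightarrow> k = 0"
  using rational_algebra_of_int_eq_0[OF rat] .

lemma int_inverse:
  assumes "k \<noteq> 0"
  obtains u where "of_int k * u = 1" "D u = 0" "U u = 0" "E u = 0"
proof -
  obtain u :: 'b where u: "of_int k * u = 1"
    using rational_algebra_of_int_inverse[OF rat assms] by blast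
  show ?thesis
    using that[OF u] derivation_int_inverse[OF D_der rat assms u]
      derivation_int_inverse[OF U_der rat assms u] derivation_int_inverse[OF E_der rat assms u] by blast
qed

section \<open>The weight decomposition\<close>

abbreviation wt :: "int \<Rightarrow> 'b set" where "wt \<equiv> eigenspace E"

lemma wt_iff: "b \<in> wt d \<longleftrightarrow> E b = of_int d * b"
  by (simp add: eigenspace_def)

lemma wt_0 [simp]: "0 \<in> wt d"
  by (simp add: wt_iff E_simps)

lemma wt_add: "a \<in> wt d \<Longrightarrow> b \<in> wt d \<Longrightarrow> a + b \<in> wt d"
  by (simp add: wt_iff E_simps algebra_simps)

lemma wt_diff: "a \<in> wt d \<Longrightarrow> b \<in> wt d \<Longrightarrow> a - b \<in> wt d"
  by (simp add: wt_iff E_simps algebra_simps)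

lemma wt_mult: "a \<in> wt d \<Longrightarrow> b \<in> wt e \<Longrightarrow> a * b \<in> wt (d + e)"
  by (simp add: wt_iff E_mult algebra_simps)

lemma wt_zero_mult: "a \<in> wt 0 \<Longrightarrow> b \<in> wt e \<Longrightarrow> a * b \<in> wt e"
  using wt_mult[of a 0 b e] by simp

lemma wt_const_mult: "E c = 0 \<Longrightarrow> b \<in> wt d \<Longrightarrow> c * b \<in> wt d"
  by (simp add: wt_iff E_mult algebra_simps)

lemma wt_D: "b \<in> wt d \<Longrightarrow> D b \<in> wt (d + 2)"
  using D_E[of b] by (simp add: wt_iff D_mult D_simps algebra_simps)

lemma wt_U: "b \<in> wt d \<Longrightarrow> U b \<in> wt (d - 2)"
  using U_E[of b] by (simp add: wt_iff U_mult U_simps algebra_simps)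

lemma wt_zero_if_invariant: "D a = 0 \<Longrightarrow> U a = 0 \<Longrightarrow> a \<in> wt 0"
  by (simp add: wt_iff E_eq D_simps U_simps)

text \<open>Applying \<open>E - e\<close> kills the component of weight \<open>e\<close> and
  multiplies the others by the nonzero integers \<open>d - e\<close>, so one summand fewer
  remains.\<close>

lemma wt_independent:
  assumes "finite S" "\<And>d. d \<in> S \<Longrightarrow> c d \<in> wt d" "sum c S = 0" "d \<in> S"
  shows "c d = 0"
  using assms
proof (induction S arbitrary: c d rule: finite_induct)
  case (insert e S)
  have "(\<Sum>d\<in>S. of_int (d - e) * c d) = (\<Sum>d\<in>S. E (c d)) - of_int e * (\<Sum>d\<in>S. c d)"
    using insert.prems(1) by (simp add: wt_iff algebra_simps sum_subtractf sum_distrib_left)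
  also have "\<dots> = E (sum c S) - of_int e * sum c S" by (simp add: derivation_sum[OF E_der])
  also have "sum c S = - c e" using insert.hyps insert.prems(2) by (simp add: eq_neg_iff_add_eq_0 add.commute)
  also have "E (- c e) - of_int e * - c e = 0" using insert.prems(1)[of e] by (simp add: wt_iff E_simps)
  finally have sum0: "(\<Sum>d\<in>S. of_int (d - e) * c d) = 0" .
  have "of_int (d - e) * c d \<in> wt d" if "d \<in> S" for d
    using insert.prems(1)[of d] that by (simp add: wt_iff E_mult E_simps)
  then have "of_int (d - e) * c d = 0" if "d \<in> S" for d using insert.IH[OF _ sum0 that] by blast
  then have zero: "c d = 0" if "d \<in> S" for d
    using that insert.hyps(2) of_int_eq_0[of "d - e"] by (metis eq_iff_diff_eq_0 mult_eq_0_iff)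
  then have "c e = 0" using insert.hyps insert.prems(2) by simp
  then show ?case using zero insert.prems(3) by blast
qed simp

text \<open>The family of components is chosen as a whole for each \<open>b\<close> and then
  evaluated, so that its members fit together.\<close>

definition wt_comp :: "int \<Rightarrow> 'b \<Rightarrow> 'b" where
  "wt_comp d b = (SOME c. (\<forall>d. c d \<in> wt d) \<and> finite {d. c d \<noteq> 0} \<and> b = sum c {d. c d \<noteq> 0}) d"

lemma
  shows wt_comp_in: "wt_comp d b \<in> wt d"
    and finite_wt_comp: "finite {d. wt_comp d b \<noteq> 0}"
    and sum_wt_comp: "b = (\<Sum>d | wt_comp d b \<noteq> 0. wt_comp d b)"
proof -
  obtain S c where S: "finite S" "\<forall>d\<in>S. c d \<in> wt d" "b = sum c S" using decomp by blast
  define c' where "c' d = (if d \<in> S then c d else 0)" for d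
  have "{d. c' d \<noteq> 0} \<subseteq> S" by (auto simp: c'_def)
  moreover have "sum c S = sum c' S" by (simp add: c'_def)
  moreover have "sum c' S = sum c' {d. c' d \<noteq> 0}"
    using S(1) by (intro sum.mono_neutral_right) (auto simp: c'_def split: if_splits)
  moreover have "\<forall>d. c' d \<in> wt d" using S by (simp add: c'_def)
  ultimately have "(\<forall>d. c' d \<in> wt d) \<and> finite {d. c' d \<noteq> 0} \<and> b = sum c' {d. c' d \<noteq> 0}"
    using S finite_subset by metis
  then have *: "(\<forall>d. wt_comp d b \<in> wt d) \<and> finite {d. wt_comp d b \<noteq> 0}
      \<and> b = sum (\<lambda>d. wt_comp d b) {d. wt_comp d b \<noteq> 0}"
    unfolding wt_comp_def
    by (rule someI[of "\<lambda>c. (\<forall>d. c d \<in> wt d) \<and> finite {d. c d \<noteq> 0} \<and> b = sum c {d. c d \<noteq> 0}"])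
  show "wt_comp d b \<in> wt d" "finite {d. wt_comp d b \<noteq> 0}"
    "b = (\<Sum>d | wt_comp d b \<noteq> 0. wt_comp d b)" using * by auto
qed

lemma wt_comp_support_nonempty:
  assumes "b \<noteq> 0"
  shows "{d. wt_comp d b \<noteq> 0} \<noteq> {}"
proof
  assume empty: "{d. wt_comp d b \<noteq> 0} = {}"
  have "b = 0" using sum_wt_comp[of b] unfolding empty by simp
  then show False using assms by simp
qed

lemma wt_comp_sum:
  assumes "finite S" "\<And>d. d \<in> S \<Longrightarrow> c d \<in> wt d"
  shows "wt_comp e (sum c S) = (if e \<in> S then c e else 0)"
proof -
  let ?b = "sum c S"
  define T where "T = insert e (S \<union> {d. wt_comp d ?b \<noteq> 0})"
  define f where "f d = wt_comp d ?b - (if d \<in> S then c d else 0)" for d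
  have T: "finite T" using assms(1) finite_wt_comp unfolding T_def by auto
  have "?b = (\<Sum>d\<in>T. wt_comp d ?b)"
    using T by (subst sum_wt_comp, intro sum.mono_neutral_left) (auto simp: T_def)
  moreover have "?b = (\<Sum>d\<in>T. if d \<in> S then c d else 0)"
    using T by (subst sum.If_cases) (auto simp: T_def Int_absorb1 intro!: sum.cong)
  ultimately have "sum f T = 0" unfolding f_def by (simp add: sum_subtractf)
  moreover have "f d \<in> wt d" for d unfolding f_def
    using wt_comp_in assms by (auto intro: wt_diff)
  ultimately have "f e = 0" using wt_independent[OF T, of f e] by (auto simp: T_def)
  then show ?thesis unfolding f_def by simp
qed

lemma wt_comp_hom: "b \<in> wt d \<Longrightarrow> wt_comp e b = (if e = d then b else 0)"
  using wt_comp_sum[of "{d}" "\<lambda>_. b" e] by auto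

lemma wt_comp_eqI:
  assumes "finite S" "\<And>d. d \<in> S \<Longrightarrow> c d \<in> wt d" "\<And>d. d \<notin> S \<Longrightarrow> c d = 0" "b = sum c S"
  shows "wt_comp e b = c e"
  using wt_comp_sum[of S c e] assms by auto

lemma sum_wt_comp_superset:
  assumes "finite S" "{d. wt_comp d b \<noteq> 0} \<subseteq> S"
  shows "b = (\<Sum>d\<in>S. wt_comp d b)"
  using assms by (subst sum_wt_comp, intro sum.mono_neutral_left) auto

lemma wt_comp_add: "wt_comp e (a + b) = wt_comp e a + wt_comp e b"
proof (rule wt_comp_eqI[where S = "{d. wt_comp d a \<noteq> 0} \<union> {d. wt_comp d b \<noteq> 0}"
      and c = "\<lambda>d. wt_comp d a + wt_comp d b"])
  let ?S = "{d. wt_comp d a \<noteq> 0} \<union> {d. wt_comp d b \<noteq> 0}"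
  show fin: "finite ?S" using finite_wt_comp by simp
  show "a + b = (\<Sum>d\<in>?S. wt_comp d a + wt_comp d b)"
    using sum_wt_comp_superset[OF fin, of a] sum_wt_comp_superset[OF fin, of b] by (simp add: sum.distrib)
qed (auto intro: wt_add wt_comp_in)

lemma wt_comp_0 [simp]: "wt_comp e 0 = 0"
  using wt_comp_hom[of 0 e e] by simp

lemma wt_comp_linear_shift:
  assumes f: "\<And>a b. f (a + b) = f a + f b" "f 0 = 0"
    and shift: "\<And>d b. b \<in> wt d \<Longrightarrow> f b \<in> wt (d + k)"
  shows "wt_comp e (f b) = f (wt_comp (e - k) b)"
proof (rule wt_comp_eqI[where S = "(\<lambda>d. d + k) ` {d. wt_comp d b \<noteq> 0}"
      and c = "\<lambda>d. f (wt_comp (d - k) b)"])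
  show "finite ((\<lambda>d. d + k) ` {d. wt_comp d b \<noteq> 0})" using finite_wt_comp by simp
  show "f (wt_comp (d - k) b) \<in> wt d" for d using shift[OF wt_comp_in, of "d - k" b] by simp
  show "f (wt_comp (d - k) b) = 0" if "d \<notin> (\<lambda>d. d + k) ` {d. wt_comp d b \<noteq> 0}" for d
  proof -
    have "wt_comp (d - k) b = 0"
    proof (rule ccontr)
      assume "wt_comp (d - k) b \<noteq> 0"
      then have "d - k + k \<in> (\<lambda>d. d + k) ` {d. wt_comp d b \<noteq> 0}" by blast
      then show False using that by simp
    qed
    then show ?thesis by (simp add: f)
  qed
  have f_sum: "f (sum g S) = (\<Sum>i\<in>S. f (g i))" for g and S :: "int set"
    by (induction S rule: infinite_finite_induct) (auto simp: f)
  have "f b = f (\<Sum>d | wt_comp d b \<noteq> 0. wt_comp d b)" using sum_wt_comp[of b] by simp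
  also have "\<dots> = (\<Sum>d | wt_comp d b \<noteq> 0. f (wt_comp d b))" by (rule f_sum)
  also have "\<dots> = (\<Sum>d\<in>(\<lambda>d. d + k) ` {d. wt_comp d b \<noteq> 0}. f (wt_comp (d - k) b))"
    by (subst sum.reindex) (auto simp: inj_on_def)
  finally show "f b = (\<Sum>d\<in>(\<lambda>d. d + k) ` {d. wt_comp d b \<noteq> 0}. f (wt_comp (d - k) b))" .
qed

lemma wt_comp_D: "wt_comp e (D b) = D (wt_comp (e - 2) b)"
  by (rule wt_comp_linear_shift) (auto simp: D_simps wt_D)

lemma wt_comp_U: "wt_comp e (U b) = U (wt_comp (e + 2) b)"
  using wt_comp_linear_shift[of U "-2" e b] wt_U by (auto simp: U_simps)

lemma wt_comp_mult_hom: "a \<in> wt d \<Longrightarrow> wt_comp e (a * b) = a * wt_comp (e - d) b"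
  using wt_mult by (intro wt_comp_linear_shift) (auto simp: algebra_simps)

text \<open>The top components of \<open>x\<close> and \<open>y\<close> multiply to the top
  component of \<open>x * y\<close>, nonzero in a domain, and likewise at the bottom. Both must sit
  in the single weight \<open>d\<close>, so top and bottom weight of \<open>x\<close> agree.\<close>

lemma homogeneous_if_product:
  assumes "x * y \<in> wt d" "x * y \<noteq> 0"
  shows "\<exists>e. x \<in> wt e"
proof -
  define Sx where "Sx = {d. wt_comp d x \<noteq> 0}"
  define Sy where "Sy = {d. wt_comp d y \<noteq> 0}"
  have fin: "finite Sx" "finite Sy" unfolding Sx_def Sy_def by (rule finite_wt_comp)+
  have "x \<noteq> 0" "y \<noteq> 0" using assms by auto
  then have ne: "Sx \<noteq> {}" "Sy \<noteq> {}"
    unfolding Sx_def Sy_def by (simp_all only: wt_comp_support_nonempty not_False_eq_True)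
  have comp_mult: "wt_comp n (x * y) = (\<Sum>i\<in>Sx. wt_comp i x * wt_comp (n - i) y)" for n
  proof -
    have "x * y = (\<Sum>i\<in>Sx. wt_comp i x * y)"
      unfolding Sx_def using sum_wt_comp[of x] by (simp flip: sum_distrib_right)
    also have "wt_comp n \<dots> = (\<Sum>i\<in>Sx. wt_comp n (wt_comp i x * y))"
      by (induction Sx rule: infinite_finite_induct) (auto simp: wt_comp_add)
    also have "\<dots> = (\<Sum>i\<in>Sx. wt_comp i x * wt_comp (n - i) y)"
      using wt_comp_mult_hom[OF wt_comp_in] by (intro sum.cong) auto
    finally show ?thesis .
  qed
  have top: "wt_comp (Max Sx + Max Sy) (x * y) = wt_comp (Max Sx) x * wt_comp (Max Sy) y"
  proof -
    have "wt_comp i x * wt_comp (Max Sx + Max Sy - i) y = 0" if "i \<in> Sx - {Max Sx}" for i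
    proof -
      have "i \<in> Sx" "i \<noteq> Max Sx" using that by auto
      then have "i < Max Sx" using Max_ge[OF fin(1), of i] by simp
      then have "Max Sx + Max Sy - i \<notin> Sy" using Max_ge[OF fin(2), of "Max Sx + Max Sy - i"] by linarith
      then show ?thesis by (simp add: Sy_def)
    qed
    then have "(\<Sum>i\<in>Sx - {Max Sx}. wt_comp i x * wt_comp (Max Sx + Max Sy - i) y) = 0"
      by (intro sum.neutral) blast
    then show ?thesis unfolding comp_mult by (subst sum.remove[OF fin(1) Max_in[OF fin(1) ne(1)]]) simp
  qed
  have bot: "wt_comp (Min Sx + Min Sy) (x * y) = wt_comp (Min Sx) x * wt_comp (Min Sy) y"
  proof -
    have "wt_comp i x * wt_comp (Min Sx + Min Sy - i) y = 0" if "i \<in> Sx - {Min Sx}" for i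
    proof -
      have "i \<in> Sx" "i \<noteq> Min Sx" using that by auto
      then have "i > Min Sx" using Min_le[OF fin(1), of i] by simp
      then have "Min Sx + Min Sy - i \<notin> Sy" using Min_le[OF fin(2), of "Min Sx + Min Sy - i"] by linarith
      then show ?thesis by (simp add: Sy_def)
    qed
    then have "(\<Sum>i\<in>Sx - {Min Sx}. wt_comp i x * wt_comp (Min Sx + Min Sy - i) y) = 0"
      by (intro sum.neutral) blast
    then show ?thesis unfolding comp_mult by (subst sum.remove[OF fin(1) Min_in[OF fin(1) ne(1)]]) simp
  qed
  have "Max Sx \<in> Sx" "Min Sx \<in> Sx" "Max Sy \<in> Sy" "Min Sy \<in> Sy" using fin ne by auto
  then have "wt_comp (Max Sx + Max Sy) (x * y) \<noteq> 0" "wt_comp (Min Sx + Min Sy) (x * y) \<noteq> 0"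
    unfolding top bot by (auto simp: Sx_def Sy_def)
  then have "Max Sx + Max Sy = Min Sx + Min Sy"
    using wt_comp_hom[OF assms(1)] by metis
  moreover have "Min Sx \<le> Max Sx" "Min Sy \<le> Max Sy" using fin ne by simp_all
  ultimately have "Min Sx = Max Sx" by linarith
  define M where "M = Max Sx"
  have "Sx = {M}"
  proof (intro equalityI subsetI)
    fix i assume "i \<in> Sx"
    then show "i \<in> {M}" using Max_ge[OF fin(1)] Min_le[OF fin(1)] \<open>Min Sx = Max Sx\<close>
      unfolding M_def by fastforce
  qed (simp add: M_def \<open>Max Sx \<in> Sx\<close>)
  then have "x = wt_comp M x"
    using sum_wt_comp[of x] unfolding Sx_def by simp
  then show ?thesis using wt_comp_in by metis
qed


section \<open>Ladder formulas and highest weight vectors\<close>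

lemma D_U: "D (U y) = U (D y) + E y"
  by (simp add: E_eq)

lemma wt_U_funpow: "b \<in> wt d \<Longrightarrow> (U ^^ n) b \<in> wt (d - 2 * int n)"
proof (induction n)
  case (Suc n)
  then have "U ((U ^^ n) b) \<in> wt (d - 2 * int n - 2)" using wt_U by blast
  then show ?case by (simp add: algebra_simps)
qed simp

lemma wt_D_funpow: "b \<in> wt d \<Longrightarrow> (D ^^ n) b \<in> wt (d + 2 * int n)"
proof (induction n)
  case (Suc n)
  then have "D ((D ^^ n) b) \<in> wt (d + 2 * int n + 2)" using wt_D by blast
  then show ?case by (simp add: algebra_simps)
qed simp

text \<open>Assuming \<open>U (D y) = 0\<close> instead of \<open>D y = 0\<close> also covers
  \<open>y\<close> whose image under \<open>D\<close> is invariant, as it occurs in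
  \<open>invariant_coboundary_eq_0\<close>.\<close>

lemma D_U_funpow:
  assumes "y \<in> wt d" "U (D y) = 0"
  shows "D ((U ^^ Suc k) y) = of_int ((int k + 1) * (d - int k)) * (U ^^ k) y"
proof (induction k)
  case 0
  then show ?case using assms by (simp add: D_U wt_iff)
next
  case (Suc k)
  have wt: "(U ^^ Suc k) y \<in> wt (d - 2 * int (Suc k))" using assms(1) by (rule wt_U_funpow)
  have "D ((U ^^ Suc (Suc k)) y) = U (D ((U ^^ Suc k) y)) + E ((U ^^ Suc k) y)" by (simp add: D_U)
  also have "\<dots> = U (of_int ((int k + 1) * (d - int k)) * (U ^^ k) y)
      + of_int (d - 2 * int (Suc k)) * (U ^^ Suc k) y"
    using Suc.IH wt by (simp add: wt_iff)
  also have "\<dots> = of_int ((int k + 1) * (d - int k) + (d - 2 * int (Suc k))) * (U ^^ Suc k) y"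
    unfolding U_of_int by (simp only: of_int_add distrib_right funpow.simps comp_apply)
  also have "(int k + 1) * (d - int k) + (d - 2 * int (Suc k)) = (int (Suc k) + 1) * (d - int (Suc k))"
    by (simp add: algebra_simps)
  finally show ?case .
qed

text \<open>Some power of \<open>U\<close> kills \<open>y\<close>. For \<open>d < 0\<close> the
  integers \<open>(k + 1) (d - k)\<close> in \<open>D_U_funpow\<close> are all nonzero, so one can
  descend from that power to \<open>y\<close> itself.\<close>

lemma negative_weight_eq_0:
  assumes "y \<in> wt d" "d < 0" "U (D y) = 0"
  shows "y = 0"
proof -
  obtain n where "(U ^^ n) y = 0" using LND_nilpotent[OF U_LND] by blast
  then show ?thesis
  proof (induction n)
    case (Suc k)
    have "of_int ((int k + 1) * (d - int k)) * (U ^^ k) y = 0"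
      using D_U_funpow[OF assms(1,3), of k] Suc.prems by (simp add: D_simps)
    moreover have "(int k + 1) * (d - int k) \<noteq> 0" using assms(2) by auto
    ultimately have "(U ^^ k) y = 0" using of_int_eq_0[of "(int k + 1) * (d - int k)"]
      by (metis mult_eq_0_iff)
    then show ?case by (rule Suc.IH)
  qed simp
qed

lemma highest_weight_nonneg:
  assumes "a \<in> wt d" "D a = 0" "a \<noteq> 0"
  shows "d \<ge> 0"
  using negative_weight_eq_0[OF assms(1)] assms by (force simp: U_simps)

text \<open>At \<open>k = m\<close> the integer of \<open>D_U_funpow\<close> vanishes, so the next
  vector is again killed by \<open>D\<close>; its weight \<open>- m - 2\<close> is negative.\<close>

lemma U_funpow_top:
  assumes "a \<in> wt (int m)" "D a = 0"
  shows "(U ^^ Suc m) a = 0"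
proof -
  have "(U ^^ Suc m) a \<in> wt (int m - 2 * int (Suc m))" using assms(1) by (rule wt_U_funpow)
  moreover have "D ((U ^^ Suc m) a) = 0" using D_U_funpow[OF assms(1), of m] assms(2) by (simp add: U_simps)
  ultimately show ?thesis using negative_weight_eq_0 by (simp add: U_simps)
qed

definition invariants :: "'b set" where "invariants = {a. D a = 0 \<and> U a = 0}"

lemma invariants_wt_0: "a \<in> invariants \<Longrightarrow> a \<in> wt 0"
  by (simp add: invariants_def wt_zero_if_invariant)

lemma highest_weight_0_invariant:
  assumes "a \<in> wt 0" "D a = 0"
  shows "a \<in> invariants"
  using U_funpow_top[of a 0] assms by (simp add: invariants_def)

lemma D_funpow_U:
  assumes "y \<in> wt e"
  shows "(D ^^ Suc n) (U y) = U ((D ^^ Suc n) y) + of_int ((int n + 1) * (e + int n)) * (D ^^ n) y"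
proof (induction n)
  case 0
  then show ?case using assms by (simp add: D_U wt_iff)
next
  case (Suc n)
  have wt: "(D ^^ Suc n) y \<in> wt (e + 2 * int (Suc n))" using assms by (rule wt_D_funpow)
  have "(D ^^ Suc (Suc n)) (U y)
      = D (U ((D ^^ Suc n) y)) + D (of_int ((int n + 1) * (e + int n)) * (D ^^ n) y)"
    using Suc.IH by (simp add: D_simps)
  also have "D (of_int ((int n + 1) * (e + int n)) * (D ^^ n) y)
      = of_int ((int n + 1) * (e + int n)) * (D ^^ Suc n) y"
    by (simp only: D_of_int funpow.simps comp_apply)
  also have "D (U ((D ^^ Suc n) y)) = U ((D ^^ Suc (Suc n)) y) + of_int (e + 2 * int (Suc n)) * (D ^^ Suc n) y"
    using wt by (simp add: D_U wt_iff)
  also have "U ((D ^^ Suc (Suc n)) y) + of_int (e + 2 * int (Suc n)) * (D ^^ Suc n) y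
      + of_int ((int n + 1) * (e + int n)) * (D ^^ Suc n) y
      = U ((D ^^ Suc (Suc n)) y)
        + of_int ((e + 2 * int (Suc n)) + (int n + 1) * (e + int n)) * (D ^^ Suc n) y"
    by (simp only: of_int_add distrib_right add.assoc)
  also have "(e + 2 * int (Suc n)) + (int n + 1) * (e + int n) = (int (Suc n) + 1) * (e + int (Suc n))"
    by (simp add: algebra_simps)
  finally show ?case .
qed

lemma D_funpow_U_D:
  assumes "b \<in> wt d" "(D ^^ Suc (Suc n)) b = 0"
  shows "(D ^^ Suc n) (U (D b)) = of_int ((int n + 1) * (d + int n + 2)) * (D ^^ Suc n) b"
proof -
  have "(D ^^ Suc n) (D b) = 0" using assms(2) by (simp add: funpow_swap1)
  moreover have "(D ^^ n) (D b) = (D ^^ Suc n) b" by (simp add: funpow_swap1)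
  ultimately show ?thesis using D_funpow_U[OF wt_D[OF assms(1)], of n]
    by (simp add: U_simps algebra_simps)
qed

text \<open>Modulo elements of smaller nilpotency index, \<open>U D\<close> acts as the integer
  \<open>(n + 1) (d + n + 2)\<close>, by \<open>D_funpow_U_D\<close>. Subtracting
  \<open>U (D b)\<close> divided by it lowers the index of \<open>b\<close>.\<close>

lemma lower_nilpotency_index:
  assumes "b \<in> wt d" "(D ^^ Suc (Suc n)) b = 0" "d + int n + 2 \<noteq> 0"
  obtains u where "of_int ((int n + 1) * (d + int n + 2)) * u = 1" "D u = 0" "U u = 0" "E u = 0"
    "u * U (D b) \<in> wt d" "(D ^^ Suc n) (b - u * U (D b)) = 0"
proof -
  let ?k = "(int n + 1) * (d + int n + 2)"
  have "?k \<noteq> 0" using assms(3) by simp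
  then obtain u where u: "of_int ?k * u = 1" "D u = 0" "U u = 0" "E u = 0" by (rule int_inverse)
  have "(D ^^ Suc n) (u * U (D b)) = u * (D ^^ Suc n) (U (D b))"
    using u(2) by (rule derivation_funpow_const_mult[OF D_der])
  also have "\<dots> = (of_int ?k * u) * (D ^^ Suc n) b"
    unfolding D_funpow_U_D[OF assms(1,2)] by (simp only: ac_simps)
  finally have "(D ^^ Suc n) (b - u * U (D b)) = 0"
    unfolding u(1) by (simp only: derivation_funpow_diff[OF D_der] mult_1 diff_self)
  moreover have "u * U (D b) \<in> wt d" using wt_const_mult[OF u(4) wt_U[OF wt_D[OF assms(1)]]] by simp
  ultimately show ?thesis using that u by blast
qed

text \<open>Repeated lowering of the nilpotency index ends in \<open>ker D\<close> with weight 0,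
  where everything is invariant; all that is subtracted lies in the image of
  \<open>U D\<close>.\<close>

lemma weight_0_decomp:
  assumes "y \<in> wt 0" "(D ^^ n) y = 0"
  shows "\<exists>z\<in>wt 0. y - U (D z) \<in> invariants"
  using assms
proof (induction n arbitrary: y)
  case 0
  then show ?case by (intro bexI[of _ 0]) (auto simp: D_simps U_simps invariants_def)
next
  case (Suc n)
  show ?case
  proof (cases n)
    case 0
    then show ?thesis using Suc.prems highest_weight_0_invariant
      by (intro bexI[of _ 0]) (auto simp: D_simps U_simps)
  next
    case (Suc m)
    obtain u where u: "D u = 0" "U u = 0" "E u = 0" "u * U (D y) \<in> wt 0"
      "(D ^^ Suc m) (y - u * U (D y)) = 0"
      using lower_nilpotency_index[OF Suc.prems(1)] Suc.prems(2) \<open>n = Suc m\<close> by force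
    have UD: "U (D (u * y)) = u * U (D y)" using u
      by (simp add: derivation_const_mult[OF D_der] derivation_const_mult[OF U_der])
    have wt_uy: "u * y \<in> wt 0" using u(3) Suc.prems(1) by (rule wt_const_mult)
    have "y - U (D (u * y)) \<in> wt 0" unfolding UD using Suc.prems(1) u(4) by (rule wt_diff)
    moreover have "(D ^^ n) (y - U (D (u * y))) = 0" unfolding UD \<open>n = Suc m\<close> by (rule u(5))
    ultimately obtain z where z: "z \<in> wt 0" "y - U (D (u * y)) - U (D z) \<in> invariants"
      using Suc.IH by blast
    then have "y - U (D (u * y + z)) \<in> invariants" by (simp add: D_simps U_simps algebra_simps)
    then show ?thesis using wt_add[OF wt_uy z(1)] by blast
  qed
qed

section \<open>The Reynolds operator\<close>

definition coboundaries :: "'b set" where "coboundaries = {D x + U y |x y. True}"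

lemma coboundaries_D [simp]: "D x \<in> coboundaries"
  unfolding coboundaries_def by (rule CollectI, rule exI[of _ x], rule exI[of _ 0]) (simp add: U_simps)

lemma coboundaries_U [simp]: "U x \<in> coboundaries"
  unfolding coboundaries_def by (rule CollectI, rule exI[of _ 0], rule exI[of _ x]) (simp add: D_simps)

lemma coboundaries_add: "x \<in> coboundaries \<Longrightarrow> y \<in> coboundaries \<Longrightarrow> x + y \<in> coboundaries"
proof -
  assume "x \<in> coboundaries" "y \<in> coboundaries"
  then obtain a b c d where "x = D a + U b" "y = D c + U d" unfolding coboundaries_def by blast
  then have "x + y = D (a + c) + U (b + d)" by (simp add: D_simps U_simps)
  then show "x + y \<in> coboundaries" unfolding coboundaries_def by blast
qed

lemma coboundaries_mult: "a \<in> invariants \<Longrightarrow> x \<in> coboundaries \<Longrightarrow> a * x \<in> coboundaries"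
proof -
  assume "a \<in> invariants" "x \<in> coboundaries"
  then obtain c d where "x = D c + U d" "D a = 0" "U a = 0"
    unfolding coboundaries_def invariants_def by blast
  then have "a * x = D (a * c) + U (a * d)" by (simp add: D_mult U_mult algebra_simps)
  then show "a * x \<in> coboundaries" unfolding coboundaries_def by blast
qed

lemma coboundaries_minus: "x \<in> coboundaries \<Longrightarrow> - x \<in> coboundaries"
  using coboundaries_mult[of "-1" x] by (simp add: invariants_def D_simps U_simps)

lemma coboundaries_diff: "x \<in> coboundaries \<Longrightarrow> y \<in> coboundaries \<Longrightarrow> x - y \<in> coboundaries"
  using coboundaries_add[OF _ coboundaries_minus] by fastforce

lemma coboundaries_0 [simp]: "0 \<in> coboundaries"
  using coboundaries_D[of 0] by (simp add: D_simps)

lemma coboundaries_sum: "(\<And>i. i \<in> S \<Longrightarrow> f i \<in> coboundaries) \<Longrightarrow> sum f S \<in> coboundaries"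
  by (induction S rule: infinite_finite_induct) (auto intro: coboundaries_add)

lemma coboundaries_E: "E x \<in> coboundaries"
  unfolding E_eq by (intro coboundaries_diff coboundaries_D coboundaries_U)

lemma coboundaries_wt:
  assumes "b \<in> wt d" "d \<noteq> 0"
  shows "b \<in> coboundaries"
proof -
  obtain u where u: "of_int d * u = 1" "D u = 0" "U u = 0" "E u = 0" using int_inverse[OF assms(2)] .
  have "E (u * b) = (of_int d * u) * b" using assms(1) u by (simp add: E_mult wt_iff ac_simps)
  then have "b = E (u * b)" using u(1) by simp
  then show ?thesis using coboundaries_E by metis
qed

lemma exists_invariant_part: "\<exists>a\<in>invariants. b - a \<in> coboundaries"
proof -
  obtain n where "(D ^^ n) (wt_comp 0 b) = 0" using LND_nilpotent[OF D_LND] by blast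
  then obtain z where z: "wt_comp 0 b - U (D z) \<in> invariants"
    using weight_0_decomp[OF wt_comp_in] by blast
  define S where "S = insert 0 {d. wt_comp d b \<noteq> 0}"
  have fin: "finite S" using finite_wt_comp by (simp add: S_def)
  have "b = (\<Sum>d\<in>S. wt_comp d b)" using fin by (intro sum_wt_comp_superset) (auto simp: S_def)
  also have "\<dots> = wt_comp 0 b + (\<Sum>d\<in>S - {0}. wt_comp d b)"
    using fin by (subst sum.remove[of S 0]) (auto simp: S_def)
  finally have eq: "b - (wt_comp 0 b - U (D z)) = U (D z) + (\<Sum>d\<in>S - {0}. wt_comp d b)"
    by (simp add: algebra_simps)
  have "(\<Sum>d\<in>S - {0}. wt_comp d b) \<in> coboundaries"
    by (intro coboundaries_sum coboundaries_wt[OF wt_comp_in]) auto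
  then have "b - (wt_comp 0 b - U (D z)) \<in> coboundaries"
    unfolding eq by (intro coboundaries_add coboundaries_U)
  then show ?thesis using z by blast
qed

text \<open>Only the components of weight -2 in \<open>x\<close> and 2 in \<open>y\<close>
  contribute. By \<open>weight_0_decomp\<close> and vanishing in negative weight, also for the
  swapped pair, they are \<open>U z\<close> and \<open>D w\<close> with \<open>z\<close>,
  \<open>w\<close> of weight 0, where \<open>D\<close> and \<open>U\<close> commute. So
  \<open>a = D (U (z + w))\<close>, and \<open>U (z + w)\<close> has weight -2 and invariant image,
  hence is 0.\<close>

lemma invariant_coboundary_eq_0:
  assumes "a \<in> invariants" "a \<in> coboundaries"
  shows "a = 0"
proof -
  interpret swap: sl2_pair U D "\<lambda>b. - E b" by (rule swapped)
  have swap_wt: "swap.wt (- d) = wt d" for d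
    by (auto simp: eigenspace_def)
  have commute: "D (U z) = U (D z)" if "z \<in> wt 0" for z using that by (simp add: D_U wt_iff)
  obtain x y where xy: "a = D x + U y" using assms(2) unfolding coboundaries_def by blast
  define x' where "x' = wt_comp (-2) x"
  define y' where "y' = wt_comp 2 y"
  have wt_x: "x' \<in> wt (-2)" and wt_y: "y' \<in> wt 2" unfolding x'_def y'_def by (rule wt_comp_in)+
  have "a = wt_comp 0 a" using wt_comp_hom[OF invariants_wt_0[OF assms(1)], of 0] by simp
  then have a: "a = D x' + U y'"
    unfolding xy x'_def y'_def wt_comp_add wt_comp_D wt_comp_U by simp
  have Dx: "D x' \<in> wt 0" using wt_D[OF wt_x] by simp
  have Uy: "U y' \<in> wt 0" using wt_U[OF wt_y] by simp
  obtain n where "(D ^^ n) (D x') = 0" using LND_nilpotent[OF D_LND] by blast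
  then obtain z where z: "z \<in> wt 0" "D x' - U (D z) \<in> invariants" using weight_0_decomp[OF Dx] by blast
  then have z1: "D (x' - U z) \<in> invariants" using commute by (simp add: D_simps)
  have "x' - U z \<in> wt (-2)" using wt_x wt_U[OF z(1)] by (intro wt_diff) auto
  then have "x' - U z = 0" using negative_weight_eq_0[of "x' - U z" "-2"] z1 by (simp add: invariants_def)
  then have x: "D x' = D (U z)" by simp
  obtain n where "(D ^^ n) (U y') = 0" using LND_nilpotent[OF D_LND] by blast
  then obtain w where w: "w \<in> wt 0" "U y' - U (D w) \<in> invariants" using weight_0_decomp[OF Uy] by blast
  then have w1: "U (y' - D w) \<in> invariants" by (simp add: U_simps)
  have "y' - D w \<in> wt 2" using wt_y wt_D[OF w(1)] by (intro wt_diff) auto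
  then have "y' - D w \<in> swap.wt (-2)" using swap_wt[of 2] by simp
  then have "y' - D w = 0" using swap.negative_weight_eq_0[of "y' - D w" "-2"] w1
    by (simp add: invariants_def)
  then have y: "U y' = D (U w)" using commute[OF w(1)] by simp
  have zw: "z + w \<in> wt 0" using z(1) w(1) by (rule wt_add)
  have a': "a = D (U (z + w))" using a x y by (simp add: D_simps U_simps)
  have "U (z + w) \<in> wt (-2)" using wt_U[OF zw] by simp
  then have "U (z + w) = 0" using negative_weight_eq_0[of "U (z + w)" "-2"] a' assms(1)
    by (simp add: invariants_def)
  then show ?thesis using a' by (simp add: D_simps)
qed

definition reynolds :: "'b \<Rightarrow> 'b" where
  "reynolds b = (THE a. a \<in> invariants \<and> b - a \<in> coboundaries)"

lemma invariants_add: "a \<in> invariants \<Longrightarrow> b \<in> invariants \<Longrightarrow> a + b \<in> invariants"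
  and invariants_diff: "a \<in> invariants \<Longrightarrow> b \<in> invariants \<Longrightarrow> a - b \<in> invariants"
  and invariants_minus: "a \<in> invariants \<Longrightarrow> - a \<in> invariants"
  and invariants_mult: "a \<in> invariants \<Longrightarrow> b \<in> invariants \<Longrightarrow> a * b \<in> invariants"
  and invariants_of_int: "of_int k \<in> invariants"
  by (auto simp: invariants_def D_simps U_simps D_mult U_mult)

lemma reynolds_eqI:
  assumes "a \<in> invariants" "b - a \<in> coboundaries"
  shows "reynolds b = a"
  unfolding reynolds_def
proof (rule the_equality)
  fix a' assume a': "a' \<in> invariants \<and> b - a' \<in> coboundaries"
  then have "(b - a') - (b - a) \<in> coboundaries" using assms coboundaries_diff by blast
  moreover have "(b - a') - (b - a) = a - a'" by simp
  ultimately have "a - a' = 0" using invariant_coboundary_eq_0 invariants_diff assms(1) a' by metis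
  then show "a' = a" by simp
qed (use assms in auto)

lemma reynolds_in: "reynolds b \<in> invariants"
  and reynolds_diff: "b - reynolds b \<in> coboundaries"
  using exists_invariant_part[of b] reynolds_eqI[of _ b] by auto

lemma reynolds_invariant: "a \<in> invariants \<Longrightarrow> reynolds a = a"
  by (rule reynolds_eqI) auto

lemma reynolds_coboundary: "b \<in> coboundaries \<Longrightarrow> reynolds b = 0"
  by (rule reynolds_eqI) (auto simp: invariants_def D_simps U_simps)

lemma reynolds_add: "reynolds (a + b) = reynolds a + reynolds b"
proof (rule reynolds_eqI)
  have "(a - reynolds a) + (b - reynolds b) \<in> coboundaries"
    by (intro coboundaries_add reynolds_diff)
  then show "a + b - (reynolds a + reynolds b) \<in> coboundaries" by (simp add: algebra_simps)
qed (intro invariants_add reynolds_in)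

lemma reynolds_mult:
  assumes "a \<in> invariants"
  shows "reynolds (a * b) = a * reynolds b"
proof (rule reynolds_eqI)
  have "a * (b - reynolds b) \<in> coboundaries"
    by (intro coboundaries_mult reynolds_diff assms)
  then show "a * b - a * reynolds b \<in> coboundaries" by (simp add: algebra_simps)
qed (intro invariants_mult reynolds_in assms)

lemma reynolds_minus: "reynolds (- b) = - reynolds b"
  using reynolds_mult[of "-1" b] by (simp add: invariants_def D_simps U_simps)

lemma reynolds_diff': "reynolds (a - b) = reynolds a - reynolds b"
  using reynolds_add[of a "- b"] by (simp add: reynolds_minus)

lemma reynolds_D [simp]: "reynolds (D b) = 0"
  and reynolds_U [simp]: "reynolds (U b) = 0"
  and reynolds_E [simp]: "reynolds (E b) = 0"
  by (simp_all add: reynolds_coboundary coboundaries_E)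

lemma reynolds_wt: "b \<in> wt d \<Longrightarrow> d \<noteq> 0 \<Longrightarrow> reynolds b = 0"
  by (simp add: reynolds_coboundary coboundaries_wt)

text \<open>Integration by parts: the Reynolds operator acts as an invariant integral.\<close>

lemma reynolds_parts_D: "reynolds (x * D y) = - reynolds (D x * y)"
  using reynolds_D[of "x * y"] by (simp add: D_mult reynolds_add eq_neg_iff_add_eq_0)

lemma reynolds_parts_U: "reynolds (x * U y) = - reynolds (U x * y)"
  using reynolds_U[of "x * y"] by (simp add: U_mult reynolds_add eq_neg_iff_add_eq_0)

lemma reynolds_parts_E: "reynolds (x * E y) = - reynolds (E x * y)"
  using reynolds_E[of "x * y"] by (simp add: E_mult reynolds_add eq_neg_iff_add_eq_0)

lemma reynolds_commute:
  assumes "derivation T" "\<And>b. T (D b) = D (T b)" "\<And>b. T (U b) = U (T b)"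
  shows "reynolds (T b) = T (reynolds b)"
proof (rule reynolds_eqI)
  show "T (reynolds b) \<in> invariants" using reynolds_in[of b] derivation_0[OF assms(1)]
    by (simp add: invariants_def flip: assms(2,3))
  obtain x y where "b - reynolds b = D x + U y" using reynolds_diff unfolding coboundaries_def by blast
  then have "T b - T (reynolds b) = D (T x) + U (T y)"
    by (metis assms derivation_add derivation_diff)
  then show "T b - T (reynolds b) \<in> coboundaries" unfolding coboundaries_def by blast
qed

text \<open>By induction \<open>b - U (D b) / \<kappa>\<close> is in the range of \<open>D\<close>.
  Since \<open>U (D b) = D (U b) - d b\<close>, this puts \<open>(1 + d / \<kappa>) b\<close> in the
  range, and \<open>\<kappa> + d\<close> is positive.\<close>

lemma positive_weight_in_range_D:
  assumes "b \<in> wt d" "d > 0" "(D ^^ n) b = 0"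
  shows "\<exists>x\<in>wt (d - 2). b = D x"
  using assms
proof (induction n arbitrary: b)
  case 0
  then show ?case by (intro bexI[of _ 0]) (auto simp: D_simps)
next
  case (Suc n)
  show ?case
  proof (cases n)
    case 0
    then have "D b = 0" using Suc.prems by simp
    obtain u where u: "of_int d * u = 1" "D u = 0" "U u = 0" "E u = 0"
      using int_inverse[of d] Suc.prems(2) by auto
    have "D (u * U b) = (of_int d * u) * b" using Suc.prems(1) u \<open>D b = 0\<close>
      by (simp add: D_mult D_U U_simps wt_iff ac_simps)
    then have "b = D (u * U b)" using u(1) by simp
    moreover have "u * U b \<in> wt (d - 2)" using wt_U[OF Suc.prems(1)] u by (simp add: wt_iff E_mult)
    ultimately show ?thesis by blast
  next
    case (Suc m)
    define \<kappa> where "\<kappa> = (int m + 1) * (d + int m + 2)"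
    have "\<kappa> > 0" unfolding \<kappa>_def using Suc.prems(2) by simp
    obtain u where u: "of_int \<kappa> * u = 1" "D u = 0" "U u = 0" "E u = 0" "u * U (D b) \<in> wt d"
      "(D ^^ Suc m) (b - u * U (D b)) = 0"
      using lower_nilpotency_index[OF Suc.prems(1), of m] Suc.prems(2,3) \<open>n = Suc m\<close>
      unfolding \<kappa>_def by force
    obtain v where v: "of_int (\<kappa> + d) * v = 1" "D v = 0" "U v = 0" "E v = 0"
      using int_inverse[of "\<kappa> + d"] \<open>\<kappa> > 0\<close> Suc.prems(2) by auto
    define b' where "b' = b - u * U (D b)"
    have "b' \<in> wt d" unfolding b'_def using Suc.prems(1) u(5) by (rule wt_diff)
    moreover have "(D ^^ n) b' = 0" unfolding b'_def \<open>n = Suc m\<close> by (rule u(6))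
    ultimately obtain x where x: "x \<in> wt (d - 2)" "b' = D x" using Suc.IH Suc.prems(2) by blast
    have "U (D b) = D (U b) - of_int d * b" using Suc.prems(1) by (simp add: D_U wt_iff)
    then have "b + u * of_int d * b = b' + u * D (U b)" unfolding b'_def by (simp add: right_diff_distrib)
    then have "b + u * of_int d * b = D (x + u * U b)"
      unfolding x(2) using u(2) by (simp add: D_simps D_mult)
    then have "of_int \<kappa> * (b + u * of_int d * b) = of_int \<kappa> * D (x + u * U b)" by simp
    moreover have "of_int \<kappa> * (b + u * of_int d * b) = of_int \<kappa> * b + (of_int \<kappa> * u) * (of_int d * b)"
      by (simp add: algebra_simps)
    ultimately have "of_int (\<kappa> + d) * b = of_int \<kappa> * D (x + u * U b)"
      unfolding u(1) by (simp add: distrib_right)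
    then have "v * (of_int (\<kappa> + d) * b) = D (v * of_int \<kappa> * (x + u * U b))"
      using v(2) by (simp add: D_mult D_simps ac_simps)
    moreover have "v * (of_int (\<kappa> + d) * b) = b" using v(1) by (metis mult.assoc mult.commute mult_1)
    moreover have "v * of_int \<kappa> * (x + u * U b) \<in> wt (d - 2)"
      using x(1) wt_U[OF Suc.prems(1)] u(4) v(4)
      by (intro wt_const_mult wt_add) (simp_all add: E_mult E_simps)
    ultimately show ?thesis by metis
  qed
qed

lemma negative_weight_in_range_U:
  assumes "b \<in> wt d" "d < 0"
  shows "\<exists>x\<in>wt (d + 2). b = U x"
proof -
  interpret swap: sl2_pair U D "\<lambda>b. - E b" by (rule swapped)
  have swap_wt: "swap.wt (- d) = wt d" for d
    by (auto simp: eigenspace_def)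
  obtain n where "(U ^^ n) b = 0" using LND_nilpotent[OF U_LND] by blast
  then show ?thesis using swap.positive_weight_in_range_D[of b "- d" n] assms
      swap_wt[of d] swap_wt[of "d + 2"] by simp
qed

text \<open>\<open>B\<close> is spanned by the \<open>U\<close>-iterates of \<open>ker D\<close>. In
  nonnegative weight, \<open>b\<close> minus a multiple of \<open>U (D b)\<close> has smaller
  nilpotency index, and so has \<open>D b\<close>; in negative weight everything is in the range of
  \<open>U\<close>.\<close>

theorem U_closed_induct [case_names kernel add U]:
  assumes kernel: "\<And>a. D a = 0 \<Longrightarrow> P a"
    and add: "\<And>a b. P a \<Longrightarrow> P b \<Longrightarrow> P (a + b)"
    and U: "\<And>a. P a \<Longrightarrow> P (U a)"
  shows "P b"
proof -
  have pos: "P b" if "b \<in> wt d" "d \<ge> 0" "(D ^^ n) b = 0" for b d n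
    using that
  proof (induction n arbitrary: b d)
    case 0
    then show ?case by (intro kernel) (simp add: D_simps)
  next
    case (Suc n)
    show ?case
    proof (cases n)
      case 0
      then show ?thesis using Suc.prems by (intro kernel) simp
    next
      case (Suc m)
      obtain u where u: "D u = 0" "U u = 0" "E u = 0" "u * U (D b) \<in> wt d"
        "(D ^^ Suc m) (b - u * U (D b)) = 0"
        using lower_nilpotency_index[OF Suc.prems(1), of m] Suc.prems(2,3) \<open>n = Suc m\<close> by force
      define c where "c = D (u * b)"
      have c: "c = u * D b" "U c = u * U (D b)" using u unfolding c_def
        by (simp_all add: derivation_const_mult[OF D_der] derivation_const_mult[OF U_der])
      have wt_c: "c \<in> wt (d + 2)" unfolding c using u(3) wt_D[OF Suc.prems(1)] by (rule wt_const_mult)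
      have "(D ^^ n) c = u * (D ^^ n) (D b)" unfolding c
        using u(1) by (rule derivation_funpow_const_mult[OF D_der])
      then have "(D ^^ n) c = 0" using Suc.prems(3) by (simp add: funpow_swap1)
      then have "P c" using Suc.IH[OF wt_c] Suc.prems(2) by simp
      have "b - U c \<in> wt d" unfolding c(2) using Suc.prems(1) u(4) by (rule wt_diff)
      moreover have "(D ^^ n) (b - U c) = 0" unfolding c(2) \<open>n = Suc m\<close> by (rule u(5))
      ultimately have "P (b - U c)" using Suc.IH Suc.prems(2) by blast
      then have "P ((b - U c) + U c)" using add U \<open>P c\<close> by blast
      then show ?thesis by simp
    qed
  qed
  have hom: "P b" if "b \<in> wt d" for b d
    using that
  proof (induction "nat (- d)" arbitrary: b d rule: less_induct)
    case less
    show ?case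
    proof (cases "d \<ge> 0")
      case True
      obtain n where "(D ^^ n) b = 0" using LND_nilpotent[OF D_LND] by blast
      then show ?thesis using pos less.prems True by blast
    next
      case False
      then obtain x where x: "x \<in> wt (d + 2)" "b = U x"
        using negative_weight_in_range_U[OF less.prems] by auto
      have "nat (- (d + 2)) < nat (- d)" using False by auto
      then have "P x" using less.hyps x(1) by blast
      then show ?thesis using x(2) U by blast
    qed
  qed
  have "P (\<Sum>d\<in>S. wt_comp d b)" if "finite S" for S
    using that by (induction S rule: finite_induct)
      (auto intro: add hom[OF wt_comp_in] kernel simp: D_simps)
  then have "P (\<Sum>d | wt_comp d b \<noteq> 0. wt_comp d b)" using finite_wt_comp by blast
  then show ?thesis using sum_wt_comp[of b] by simp
qed

lemma kernel_induct [consumes 1, case_names hom add]: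
  assumes "D a = 0"
    and hom: "\<And>a d. a \<in> wt d \<Longrightarrow> D a = 0 \<Longrightarrow> P a"
    and add: "\<And>a b. P a \<Longrightarrow> P b \<Longrightarrow> P (a + b)"
  shows "P a"
proof -
  have "P (\<Sum>d\<in>T. wt_comp d a)" if "finite T" for T
    using that
  proof (induction T rule: finite_induct)
    case empty
    then show ?case using hom[of 0 0] by (simp add: D_simps)
  next
    case (insert d T)
    have "D (wt_comp d a) = 0" using wt_comp_D[of "d + 2" a] assms(1) by simp
    then show ?case using insert by (simp add: add hom[OF wt_comp_in])
  qed
  then show ?thesis using sum_wt_comp[of a] finite_wt_comp by metis
qed

text \<open>The invariant is the discriminant of the quadratic polynomial
  \<open>exp (t U) g = g + t U g + t^2 U (U g) / 2\<close> in \<open>t\<close>.\<close>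

lemma weight_2_triple:
  assumes "g \<in> wt 2" "D g = 0" "U (U (U g)) = 0"
  shows "D (U g) = 2 * g" "D (U (U g)) = 2 * U g" "U g * U g - 2 * g * U (U g) \<in> invariants"
proof -
  show 1: "D (U g) = 2 * g" using assms by (simp add: D_U wt_iff U_simps)
  show 2: "D (U (U g)) = 2 * U g"
    using D_U[of "U g"] 1 wt_U[OF assms(1)] by (simp add: wt_iff U_mult U_simps)
  show "U g * U g - 2 * g * U (U g) \<in> invariants"
    using 1 2 assms(2,3) by (simp add: invariants_def D_simps D_mult U_simps U_mult)
qed

text \<open>Take the last nonzero \<open>D\<close>-iterate of a component not killed by
  \<open>D\<close>. Its weight is nonnegative, and weight 0 would make it an invariant in the image
  of \<open>D\<close>, hence 0.\<close>

lemma exists_positive_highest_weight: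
  assumes "D b \<noteq> 0"
  shows "\<exists>a d. d > 0 \<and> a \<in> wt d \<and> D a = 0 \<and> a \<noteq> 0"
proof -
  have "\<exists>d. D (wt_comp d b) \<noteq> 0"
  proof (rule ccontr)
    assume "\<not> ?thesis"
    then have "D (\<Sum>d | wt_comp d b \<noteq> 0. wt_comp d b) = 0" by (simp add: derivation_sum[OF D_der])
    then show False using assms sum_wt_comp[of b] by simp
  qed
  then obtain e where e: "D (wt_comp e b) \<noteq> 0" by blast
  define c where "c = wt_comp e b"
  have wt_c: "c \<in> wt e" unfolding c_def by (rule wt_comp_in)
  have "c \<noteq> 0" using e unfolding c_def by (auto simp: D_simps)
  obtain i where i: "(D ^^ i) c \<noteq> 0" "(D ^^ Suc i) c = 0" using LND_top[OF D_LND \<open>c \<noteq> 0\<close>] by blast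
  then obtain j where j: "i = Suc j" using e unfolding c_def by (cases i) auto
  define z where "z = (D ^^ j) c"
  have "z \<in> wt (e + 2 * int j)" unfolding z_def using wt_c by (rule wt_D_funpow)
  have Dz: "D z \<noteq> 0" "D (D z) = 0" using i j unfolding z_def by simp_all
  have wt_Dz: "D z \<in> wt (e + 2 * int j + 2)" using \<open>z \<in> wt (e + 2 * int j)\<close> by (rule wt_D)
  then have nonneg: "e + 2 * int j + 2 \<ge> 0" using highest_weight_nonneg Dz by blast
  moreover have "e + 2 * int j + 2 \<noteq> 0"
  proof
    assume zero: "e + 2 * int j + 2 = 0"
    then have "D z \<in> wt 0" using wt_Dz by simp
    then have "D z \<in> invariants" using highest_weight_0_invariant Dz by blast
    then show False using invariant_coboundary_eq_0 Dz coboundaries_D by blast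
  qed
  ultimately show ?thesis using wt_Dz Dz by (intro exI[of _ "D z"] exI[of _ "e + 2 * int j + 2"]) auto
qed

end

section \<open>Vector fields in three variables\<close>

lemma derivation_map_poly:
  fixes f :: "'a::idom \<Rightarrow> 'a"
  assumes f: "derivation f"
  shows "derivation (map_poly f)"
proof -
  have coeff: "coeff (map_poly f p) n = f (coeff p n)" for p n
    by (simp add: coeff_map_poly derivation_0[OF f])
  show ?thesis
    unfolding derivation_def
    by (auto simp: poly_eq_iff coeff coeff_mult derivation_add[OF f] derivation_mult[OF f]
        derivation_sum[OF f] sum.distrib)
qed

lemma derivation_pderiv: "derivation (pderiv :: 'a::idom poly \<Rightarrow> 'a poly)"
  unfolding derivation_def by (simp add: pderiv_add pderiv_mult algebra_simps)

lemma derivation_d0: "derivation (d0 :: 'r::idom poly3 \<Rightarrow> _)"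
  unfolding d0_def by (intro derivation_map_poly derivation_pderiv)

lemma derivation_d1: "derivation (d1 :: 'r::idom poly3 \<Rightarrow> _)"
  unfolding d1_def by (intro derivation_map_poly derivation_pderiv)

lemma derivation_d2: "derivation (d2 :: 'r::idom poly3 \<Rightarrow> _)"
  unfolding d2_def by (rule derivation_pderiv)

lemma poly_subring_induct [case_names const X add mult]:
  fixes p :: "'a::comm_ring_1 poly"
  assumes "\<And>c. P [:c:]" "P [:0, 1:]" "\<And>p q. P p \<Longrightarrow> P q \<Longrightarrow> P (p + q)"
    "\<And>p q. P p \<Longrightarrow> P q \<Longrightarrow> P (p * q)"
  shows "P p"
proof (induction p)
  case 0
  then show ?case using assms(1)[of 0] by simp
next
  case (pCons a p)
  have "pCons a p = [:a:] + [:0, 1:] * p" by simp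
  then show ?case using assms pCons.IH by metis
qed

lemma poly3_induct [case_names const x0 x1 x2 add mult]:
  fixes h :: "'r::comm_ring_1 poly3"
  assumes const: "\<And>r. P (const3 r)" and x: "P x0" "P x1" "P x2"
    and add: "\<And>p q. P p \<Longrightarrow> P q \<Longrightarrow> P (p + q)"
    and mult: "\<And>p q. P p \<Longrightarrow> P q \<Longrightarrow> P (p * q)"
  shows "P h"
proof (induction h rule: poly_subring_induct)
  case (const c)
  show ?case
  proof (induction c rule: poly_subring_induct)
    case (const c)
    show ?case
    proof (induction c rule: poly_subring_induct)
      case (const c)
      then show ?case using assms(1)[of c] by (simp add: const3_def)
    next
      case X
      then show ?case using x(1) by (simp add: x0_def)
    next
      case (add p q)
      then show ?case using assms(5) by fastforce
    next
      case (mult p q)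
      then show ?case using assms(6) by fastforce
    qed
  next
    case X
    then show ?case using x(2) by (simp add: x1_def)
  next
    case (add p q)
    then show ?case using assms(5) by fastforce
  next
    case (mult p q)
    then show ?case using assms(6) by fastforce
  qed
next
  case X
  then show ?case using x(3) by (simp add: x2_def)
qed (use add mult in auto)

lemma const3_add: "const3 (a + b) = const3 a + const3 b"
  and const3_mult: "const3 (a * b) = const3 a * const3 b"
  and const3_0 [simp]: "const3 0 = 0"
  and const3_1 [simp]: "const3 1 = 1"
  and const3_minus: "const3 (- a) = - const3 a"
  and const3_eq_iff [simp]: "const3 a = const3 b \<longleftrightarrow> a = b"
  by (simp_all add: const3_def one_pCons mult.commute)

lemma const3_eq_0_iff [simp]: "const3 a = 0 \<longleftrightarrow> a = 0"
  by (simp add: const3_def)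

lemma partials [simp]:
  "d0 (const3 r) = 0" "d1 (const3 r) = 0" "d2 (const3 r) = (0 :: 'r::idom poly3)"
  "d0 x0 = (1 :: 'r poly3)" "d1 x0 = (0 :: 'r poly3)" "d2 x0 = (0 :: 'r poly3)"
  "d0 x1 = (0 :: 'r poly3)" "d1 x1 = (1 :: 'r poly3)" "d2 x1 = (0 :: 'r poly3)"
  "d0 x2 = (0 :: 'r poly3)" "d1 x2 = (0 :: 'r poly3)" "d2 x2 = (1 :: 'r poly3)"
  by (simp_all add: d0_def d1_def d2_def const3_def x0_def x1_def x2_def map_poly_pCons pderiv_pCons
      one_pCons)

lemma coeff_partials:
  "coeff (d0 h) n = map_poly pderiv (coeff h n)"
  "coeff (d1 h) n = pderiv (coeff h n)"
  "coeff (d2 h) n = of_nat (Suc n) * coeff h (Suc n)"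
  by (simp_all add: d0_def d1_def d2_def coeff_map_poly coeff_pderiv)

definition poly3_derivation :: "('r::idom poly3 \<Rightarrow> 'r poly3) \<Rightarrow> bool" where
  "poly3_derivation D \<longleftrightarrow> derivation D \<and> (\<forall>r. D (const3 r) = 0)"

lemma poly3_derivation_partials [simp]:
  "poly3_derivation d0" "poly3_derivation d1" "poly3_derivation d2"
  by (simp_all add: poly3_derivation_def derivation_d0 derivation_d1 derivation_d2)

lemma poly3_derivation_zero: "poly3_derivation (\<lambda>h. 0)"
  by (simp add: poly3_derivation_def derivation_def)

lemma poly3_derivation_add:
  "poly3_derivation X \<Longrightarrow> poly3_derivation Y \<Longrightarrow> poly3_derivation (\<lambda>h. X h + Y h)"
  by (simp add: poly3_derivation_def derivation_def algebra_simps)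

lemma poly3_derivation_scale:
  "poly3_derivation X \<Longrightarrow> poly3_derivation (\<lambda>h. a * X h)"
  by (simp add: poly3_derivation_def derivation_def algebra_simps)

lemma poly3_derivation_commutator:
  "poly3_derivation X \<Longrightarrow> poly3_derivation Y \<Longrightarrow> poly3_derivation (\<lambda>h. X (Y h) - Y (X h))"
proof -
  assume "poly3_derivation X" "poly3_derivation Y"
  then have X: "derivation X" "\<And>r. X (const3 r) = 0" and Y: "derivation Y" "\<And>r. Y (const3 r) = 0"
    by (auto simp: poly3_derivation_def)
  have "derivation (\<lambda>h. X (Y h) - Y (X h))"
    unfolding derivation_def
    by (simp add: derivation_add[OF X(1)] derivation_mult[OF X(1)] derivation_add[OF Y(1)]
        derivation_mult[OF Y(1)] algebra_simps)
  then show ?thesis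
    by (simp add: poly3_derivation_def X(2) Y(2) derivation_0[OF X(1)] derivation_0[OF Y(1)])
qed

lemma poly3_derivation_ext:
  assumes "poly3_derivation X" "poly3_derivation Y" "X x0 = Y x0" "X x1 = Y x1" "X x2 = Y x2"
  shows "X h = Y h"
proof (induction h rule: poly3_induct)
  case (add p q)
  then show ?case using assms(1,2) by (simp add: poly3_derivation_def derivation_add)
next
  case (mult p q)
  then show ?case using assms(1,2) by (simp add: poly3_derivation_def derivation_mult)
qed (use assms in \<open>simp_all add: poly3_derivation_def\<close>)

lemma poly3_derivation_eq:
  assumes "poly3_derivation X"
  shows "X h = X x0 * d0 h + X x1 * d1 h + X x2 * d2 h"
  by (rule poly3_derivation_ext[OF assms])
    (simp_all add: poly3_derivation_add poly3_derivation_scale)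

lemma partials_commute: "d1 (d0 h) = d0 (d1 h)" "d2 (d0 h) = d0 (d2 h)" "d2 (d1 h) = d1 (d2 h)"
proof -
  have zero: "X (Y h) - Y (X h) = 0" if "poly3_derivation X" "poly3_derivation Y"
    "X (Y x0) - Y (X x0) = 0" "X (Y x1) - Y (X x1) = 0" "X (Y x2) - Y (X x2) = 0" for X Y :: "'a poly3 \<Rightarrow> _"
    by (rule poly3_derivation_ext[OF poly3_derivation_commutator[OF that(1,2)] poly3_derivation_zero])
      (use that in auto)
  have 0: "d0 (0::'a poly3) = 0" "d1 (0::'a poly3) = 0" "d2 (0::'a poly3) = 0"
    "d0 (1::'a poly3) = 0" "d1 (1::'a poly3) = 0" "d2 (1::'a poly3) = 0"
    using derivation_0 derivation_1 derivation_d0 derivation_d1 derivation_d2 by blast+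
  show "d1 (d0 h) = d0 (d1 h)" using zero[of d1 d0] by (simp add: 0)
  show "d2 (d0 h) = d0 (d2 h)" using zero[of d2 d0] by (simp add: 0)
  show "d2 (d1 h) = d1 (d2 h)" using zero[of d2 d1] by (simp add: 0)
qed

lemmas partials_add = derivation_add[OF derivation_d0] derivation_add[OF derivation_d1]
  derivation_add[OF derivation_d2]
lemmas partials_diff = derivation_diff[OF derivation_d0] derivation_diff[OF derivation_d1]
  derivation_diff[OF derivation_d2]
lemmas partials_minus = derivation_minus[OF derivation_d0] derivation_minus[OF derivation_d1]
  derivation_minus[OF derivation_d2]
lemmas partials_mult = derivation_mult[OF derivation_d0] derivation_mult[OF derivation_d1]
  derivation_mult[OF derivation_d2]
lemmas partials_consts [simp] = derivation_0[OF derivation_d0] derivation_0[OF derivation_d1]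
  derivation_0[OF derivation_d2] derivation_1[OF derivation_d0] derivation_1[OF derivation_d1]
  derivation_1[OF derivation_d2]

lemma partial_of_derivation:
  assumes "poly3_derivation X"
  shows "X (d0 h) = d0 (X h) - (d0 (X x0) * d0 h + d0 (X x1) * d1 h + d0 (X x2) * d2 h)"
    and "X (d1 h) = d1 (X h) - (d1 (X x0) * d0 h + d1 (X x1) * d1 h + d1 (X x2) * d2 h)"
    and "X (d2 h) = d2 (X h) - (d2 (X x0) * d0 h + d2 (X x1) * d1 h + d2 (X x2) * d2 h)"
  unfolding poly3_derivation_eq[OF assms, of h] poly3_derivation_eq[OF assms, of "d0 h"]
    poly3_derivation_eq[OF assms, of "d1 h"] poly3_derivation_eq[OF assms, of "d2 h"]
  by (simp_all add: partials_add partials_mult partials_commute algebra_simps)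

section \<open>Divergence and Jacobian determinants\<close>

definition divergence :: "('r::idom poly3 \<Rightarrow> 'r poly3) \<Rightarrow> 'r poly3" where
  "divergence X = d0 (X x0) + d1 (X x1) + d2 (X x2)"

definition det3 :: "'a::comm_ring_1 \<Rightarrow> 'a \<Rightarrow> 'a \<Rightarrow> 'a \<Rightarrow> 'a \<Rightarrow> 'a \<Rightarrow> 'a \<Rightarrow> 'a \<Rightarrow> 'a \<Rightarrow> 'a" where
  "det3 a0 a1 a2 b0 b1 b2 c0 c1 c2 =
    a0 * (b1 * c2 - b2 * c1) - a1 * (b0 * c2 - b2 * c0) + a2 * (b0 * c1 - b1 * c0)"

definition jac :: "'r::idom poly3 \<Rightarrow> 'r poly3 \<Rightarrow> 'r poly3 \<Rightarrow> 'r poly3" where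
  "jac a b c = det3 (d0 a) (d1 a) (d2 a) (d0 b) (d1 b) (d2 b) (d0 c) (d1 c) (d2 c)"

lemma jac_x [simp]: "jac x0 x1 x2 = 1"
  by (simp add: jac_def det3_def)

lemma jac_same [simp]: "jac a a b = 0" "jac a b a = 0" "jac b a a = 0"
  by (simp_all add: jac_def det3_def algebra_simps)

lemma jac_swap: "jac b a c = - jac a b c" "jac a c b = - jac a b c" "jac c b a = - jac a b c"
  by (simp_all add: jac_def det3_def algebra_simps)

lemma jac_rotate: "jac b c a = jac a b c"
  by (simp add: jac_def det3_def algebra_simps)

lemma poly3_derivation_jac: "poly3_derivation (jac a b)"
  unfolding poly3_derivation_def derivation_def
  by (simp add: jac_def det3_def partials_add partials_mult algebra_simps)

lemma jac_const [simp]: "jac (const3 r) b c = 0" "jac b (const3 r) c = 0" "jac b c (const3 r) = 0"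
  by (simp_all add: jac_def det3_def)

lemma jac_add: "jac (a + a') b c = jac a b c + jac a' b c"
  "jac a (b + b') c = jac a b c + jac a b' c"
  "jac a b (c + c') = jac a b c + jac a b c'"
  by (simp_all add: jac_def det3_def partials_add algebra_simps)

lemma jac_mult: "jac (a * a') b c = a * jac a' b c + a' * jac a b c"
  "jac a (b * b') c = b * jac a b' c + b' * jac a b c"
  "jac a b (c * c') = c * jac a b c' + c' * jac a b c"
  by (simp_all add: jac_def det3_def partials_mult algebra_simps)

lemma divergence_jac: "divergence (jac a b) = 0"
  unfolding divergence_def jac_def det3_def
  by (simp add: partials_add partials_mult partials_diff partials_minus partials_commute algebra_simps)

lemma divergence_scale:
  assumes "poly3_derivation X"
  shows "divergence (\<lambda>h. a * X h) = a * divergence X + X a"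
  unfolding divergence_def poly3_derivation_eq[OF assms, of a]
  by (simp add: partials_mult algebra_simps)

lemma divergence_add: "divergence (\<lambda>h. X h + Y h) = divergence X + divergence Y"
  by (simp add: divergence_def partials_add algebra_simps)

lemma divergence_commutator:
  assumes "poly3_derivation X" "poly3_derivation Y"
  shows "divergence (\<lambda>h. X (Y h) - Y (X h)) = X (divergence Y) - Y (divergence X)"
  unfolding divergence_def
    derivation_add[OF conjunct1[OF assms(1)[unfolded poly3_derivation_def]]]
    derivation_add[OF conjunct1[OF assms(2)[unfolded poly3_derivation_def]]]
    partial_of_derivation[OF assms(1)] partial_of_derivation[OF assms(2)]
  by (simp add: partials_diff algebra_simps)

text \<open>Cartan calculus: both sides are the Lie derivative along \<open>X\<close> of the 3-form
  \<open>da db dc\<close>, because that of the volume form is \<open>divergence X\<close> times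
  it.\<close>

lemma lie_derivative_jac:
  assumes "poly3_derivation X"
  shows "X (jac a b c) + divergence X * jac a b c = jac (X a) b c + jac a (X b) c + jac a b (X c)"
proof -
  have X: "derivation X" using assms by (simp add: poly3_derivation_def)
  show ?thesis
    unfolding divergence_def jac_def det3_def derivation_add[OF X] derivation_diff[OF X]
      derivation_mult[OF X] partial_of_derivation[OF assms]
    by (simp add: algebra_simps)
qed

text \<open>\<open>T\<close> is the Lie derivative on 3-forms, locally nilpotent by the Leibniz
  rule. The last nonzero iterate \<open>y\<close> of the volume form satisfies
  \<open>X y = - divergence X * y\<close>; so \<open>y\<close> divides \<open>X y\<close>, which
  forces \<open>X y = 0\<close>.\<close>

lemma divergence_LND:
  fixes X :: "'r::idom poly3 \<Rightarrow> 'r poly3"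
  assumes rat: "rational_algebra TYPE('r poly3)" and X: "poly3_derivation X" "X \<in> LND"
  shows "divergence X = 0"
proof -
  define T where "T y = X y + divergence X * y" for y
  have der: "derivation X" using X(1) by (simp add: poly3_derivation_def)
  have T_add: "(T ^^ n) (y + z) = (T ^^ n) y + (T ^^ n) z" for n y z
    by (induction n) (auto simp: T_def derivation_add[OF der] algebra_simps)
  have T_0: "(T ^^ n) 0 = 0" for n
    by (induction n) (auto simp: T_def derivation_0[OF der])
  have T_jac: "T (jac a b c) = jac (X a) b c + jac a (X b) c + jac a b (X c)" for a b c
    unfolding T_def by (rule lie_derivative_jac[OF X(1)])
  have jac_0: "jac 0 b c = 0" "jac b 0 c = 0" "jac b c 0 = 0" for b c :: "'r poly3"
    by (simp_all add: jac_def det3_def)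
  have nilpotent: "(T ^^ (i + j + k)) (jac a b c) = 0"
    if "(X ^^ i) a = 0" "(X ^^ j) b = 0" "(X ^^ k) c = 0" for i j k a b c
    using that
  proof (induction "i + j + k" arbitrary: i j k a b c)
    case 0
    then show ?case by (simp add: jac_0)
  next
    case (Suc n)
    show ?case
    proof (cases "i = 0 \<or> j = 0 \<or> k = 0")
      case True
      then have "jac a b c = 0" using Suc.prems by (auto simp: jac_0)
      then show ?thesis by (simp add: T_0)
    next
      case False
      then obtain i' j' k' where ijk: "i = Suc i'" "j = Suc j'" "k = Suc k'"
        by (metis not0_implies_Suc)
      have n: "n = i' + j + k" "n = i + j' + k" "n = i + j + k'" using Suc.hyps(2) ijk by auto
      have X: "(X ^^ i') (X a) = 0" "(X ^^ j') (X b) = 0" "(X ^^ k') (X c) = 0"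
        using Suc.prems ijk by (simp_all add: funpow_swap1)
      have "(T ^^ n) (jac (X a) b c) = 0"
        using Suc.hyps(1)[OF n(1) X(1) Suc.prems(2,3)] n(1) by simp
      moreover have "(T ^^ n) (jac a (X b) c) = 0"
        using Suc.hyps(1)[OF n(2) Suc.prems(1) X(2) Suc.prems(3)] n(2) by simp
      moreover have "(T ^^ n) (jac a b (X c)) = 0"
        using Suc.hyps(1)[OF n(3) Suc.prems(1,2) X(3)] n(3) by simp
      ultimately have "(T ^^ n) (T (jac a b c)) = 0" unfolding T_jac T_add by simp
      then show ?thesis unfolding Suc.hyps(2)[symmetric] by (simp add: funpow_swap1)
    qed
  qed
  obtain i where i: "(X ^^ i) x0 = 0" using LND_nilpotent[OF X(2)] .
  obtain j where j: "(X ^^ j) x1 = 0" using LND_nilpotent[OF X(2)] .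
  obtain k where k: "(X ^^ k) x2 = 0" using LND_nilpotent[OF X(2)] .
  have "\<exists>n. (T ^^ n) 1 = 0" using nilpotent[OF i j k] by (auto simp: jac_x)
  then obtain n where n: "(T ^^ n) 1 = 0" "\<And>m. m < n \<Longrightarrow> (T ^^ m) 1 \<noteq> 0"
    using exists_least_iff[of "\<lambda>n. (T ^^ n) 1 = 0"] by blast
  obtain m where m: "n = Suc m" using n(1) by (cases n) auto
  define y where "y = (T ^^ m) 1"
  have y: "y \<noteq> 0" "X y + divergence X * y = 0" using n m unfolding y_def by (auto simp: T_def)
  then have "X y = y * (- divergence X)" by (simp add: eq_neg_iff_add_eq_0 mult.commute)
  then have "X y = 0" using LND_dvd_imp_0[OF rat X(2)] by (metis dvd_triv_left)
  then show ?thesis using y by simp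
qed

section \<open>Units, degrees and values at the origin\<close>

lemma unit_poly3:
  fixes p :: "'r::idom poly3"
  assumes "p dvd 1"
  obtains u v where "p = const3 u" "u * v = 1"
proof -
  obtain u where u: "p = const3 u" "u dvd 1"
    using assms unfolding const3_def by (auto simp: is_unit_poly_iff)
  then obtain v where "u * v = 1" by (metis dvdE)
  then show ?thesis using that u by blast
qed

text \<open>Exponent sum of the lexicographically leading monomial, additive on products over a
  domain.\<close>

definition degree3 :: "'r::idom poly3 \<Rightarrow> nat" where
  "degree3 p = degree p + degree (lead_coeff p) + degree (lead_coeff (lead_coeff p))"

lemma degree3_mult: "p \<noteq> 0 \<Longrightarrow> q \<noteq> 0 \<Longrightarrow> degree3 (p * q) = degree3 p + degree3 q"
  unfolding degree3_def lead_coeff_mult by (simp add: degree_mult_eq)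

lemma degree3_eq_0: "degree3 p = 0 \<Longrightarrow> p \<in> range const3"
proof -
  assume deg: "degree3 p = 0"
  then obtain q where q: "p = [:q:]" by (auto simp: degree3_def elim: degree_eq_zeroE)
  then obtain r where r: "q = [:r:]" using deg by (auto simp: degree3_def elim: degree_eq_zeroE)
  then obtain s where "r = [:s:]" using deg q by (auto simp: degree3_def elim: degree_eq_zeroE)
  then show "p \<in> range const3" using q r by (auto simp: const3_def)
qed

text \<open>The value at the origin, a retraction onto \<open>R\<close> by which invariants are
  normalised.\<close>

definition eval0 :: "'r::idom poly3 \<Rightarrow> 'r" where
  "eval0 p = coeff (coeff (coeff p 0) 0) 0"

lemma eval0_simps [simp]:
  "eval0 (const3 r) = r" "eval0 (p + q) = eval0 p + eval0 q" "eval0 (p - q) = eval0 p - eval0 q"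
  "eval0 (p * q) = eval0 p * eval0 q"
  by (simp_all add: eval0_def const3_def coeff_mult)

lemma exists_constant_pderiv_iterate:
  fixes p :: "'a::idom poly"
  assumes rat: "rational_algebra TYPE('a)" and p: "p \<noteq> 0" "p \<in> Q" "\<And>p. p \<in> Q \<Longrightarrow> pderiv p \<in> Q"
  shows "\<exists>c. c \<noteq> 0 \<and> [:c:] \<in> Q"
  using p(1,2)
proof (induction "degree p" arbitrary: p)
  case 0
  then show ?case by (auto elim!: degree_eq_zeroE)
next
  case (Suc n)
  have nz: "coeff (pderiv p) n \<noteq> 0"
    using Suc.hyps(2) Suc.prems(1) rational_algebra_of_nat_eq_0[OF rat, of "Suc n"]
    by (simp add: coeff_pderiv del: of_nat_Suc)
  have "coeff (pderiv p) i = 0" if "i > n" for i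
    using that Suc.hyps(2) by (simp add: coeff_pderiv coeff_eq_0)
  then have "degree (pderiv p) = n"
    using nz by (intro antisym degree_le le_degree) auto
  then show ?case using Suc.hyps(1) Suc.prems p(3) nz by (metis coeff_0)
qed

lemma exists_constant_iterated_derivative:
  fixes F :: "'r::idom poly3"
  assumes rat: "rational_algebra TYPE('r)" and F: "F \<noteq> 0"
    and closed: "F \<in> Z" "\<And>h. h \<in> Z \<Longrightarrow> d0 h \<in> Z" "\<And>h. h \<in> Z \<Longrightarrow> d1 h \<in> Z" "\<And>h. h \<in> Z \<Longrightarrow> d2 h \<in> Z"
  shows "\<exists>r. r \<noteq> 0 \<and> const3 r \<in> Z"
proof -
  note rats = rational_algebra_poly[OF rat] rational_algebra_poly[OF rational_algebra_poly[OF rat]]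
  obtain c where c: "c \<noteq> 0" "[:c:] \<in> Z"
    using exists_constant_pderiv_iterate[of F Z] rats F closed unfolding d2_def by blast
  obtain b where b: "b \<noteq> 0" "[:[:b:]:] \<in> Z"
  proof -
    have "[:pderiv p:] \<in> Z" if "[:p:] \<in> Z" for p
      using closed(3)[OF that] by (simp add: d1_def map_poly_pCons)
    then show ?thesis using exists_constant_pderiv_iterate[of c "{p. [:p:] \<in> Z}"] rats c that by blast
  qed
  obtain a where "a \<noteq> 0" "[:[:[:a:]:]:] \<in> Z"
  proof -
    have "[:[:pderiv p:]:] \<in> Z" if "[:[:p:]:] \<in> Z" for p
      using closed(2)[OF that] by (simp add: d0_def map_poly_pCons)
    then show ?thesis using exists_constant_pderiv_iterate[of b "{p. [:[:p:]:] \<in> Z}"] rat b that by blast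
  qed
  then show ?thesis by (auto simp: const3_def)
qed

section \<open>Antiderivatives and the Poincare lemma\<close>

lemma exists_antiderivative:
  fixes p :: "'a::idom poly"
  assumes rat: "rational_algebra TYPE('a)"
  shows "\<exists>q. pderiv q = p"
proof -
  have "\<exists>u::'a. of_nat (Suc n) * u = 1" for n
    using rational_algebra_of_int_inverse[OF rat, of "int (Suc n)"] by (metis of_int_of_nat_eq of_nat_eq_0_iff nat.distinct(1))
  then obtain u :: "nat \<Rightarrow> 'a" where u: "\<And>n. of_nat (Suc n) * u n = 1" by metis
  have "pderiv (\<Sum>i\<le>degree p. monom (u i * coeff p i) (Suc i)) = (\<Sum>i\<le>degree p. monom (coeff p i) i)"
  proof -
    have "pderiv (monom (u i * coeff p i) (Suc i)) = monom ((of_nat (Suc i) * u i) * coeff p i) i" for i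
      by (simp add: pderiv_monom mult.assoc)
    then show ?thesis unfolding derivation_sum[OF derivation_pderiv] u by simp
  qed
  also have "\<dots> = p" by (rule poly_as_sum_of_monoms)
  finally show ?thesis by blast
qed

text \<open>The field is the curl of \<open>(y0, y1, 0)\<close>; the third component of a potential
  can be gauged away. Integrating \<open>w0\<close> and \<open>w1\<close> in \<open>x2\<close>
  leaves an error \<open>h\<close> in the third equation that does not depend on \<open>x2\<close>,
  so integrating it in \<open>x1\<close> does not disturb the other two.\<close>

lemma poincare_divergence_free:
  fixes w0 w1 w2 :: "'r::idom poly3"
  assumes rat: "rational_algebra TYPE('r)" and div: "d0 w0 + d1 w1 + d2 w2 = 0"
  obtains y0 y1 where "w0 = - d2 y1" "w1 = d2 y0" "w2 = d0 y1 - d1 y0"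
proof -
  note rats = rational_algebra_poly[OF rat] rational_algebra_poly[OF rational_algebra_poly[OF rat]]
  obtain y1 where y1: "d2 y1 = - w0" using exists_antiderivative[OF rats(2)] unfolding d2_def by blast
  obtain z where z: "d2 z = w1" using exists_antiderivative[OF rats(2)] unfolding d2_def by blast
  define h where "h = w2 - (d0 y1 - d1 z)"
  have "d2 h = 0" unfolding h_def using div y1 z
    by (simp add: partials_diff partials_add partials_commute partials_minus algebra_simps)
  then have "coeff h (Suc n) = 0" for n
    using coeff_partials(3)[of h n] rational_algebra_of_nat_eq_0[OF rats(2), of "Suc n"]
    by (simp del: of_nat_Suc)
  then have "h = [:coeff h 0:]" by (simp add: poly_eq_iff coeff_pCons split: nat.split)
  then obtain h1 where h1: "h = [:h1:]" by blast
  obtain k where k: "pderiv k = h1" using exists_antiderivative[OF rats(1)] by blast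
  have "d1 [:k:] = h" "d2 [:k:] = 0" using k h1 by (simp_all add: d1_def d2_def map_poly_pCons)
  then have "w2 = d0 y1 - d1 (z - [:k:])" "w1 = d2 (z - [:k:])" using z
    by (simp_all add: partials_diff h_def)
  with y1 show ?thesis by (intro that[of y1 "z - [:k:]"]) simp_all
qed

section \<open>Substitutions and algebraic dependence\<close>

lemma ring_morphism_0: "ring_morphism f \<Longrightarrow> f 0 = 0"
  unfolding ring_morphism_def by (metis add_0 add_cancel_right_left)

lemma ring_morphism_eval:
  fixes f :: "'a::comm_ring_1 \<Rightarrow> 'b::comm_ring_1"
  assumes f: "ring_morphism f"
  shows "ring_morphism (\<lambda>p. poly (map_poly f p) y)"
proof -
  note f0 = ring_morphism_0[OF f]
  have f_add: "f (a + b) = f a + f b" and f_mult: "f (a * b) = f a * f b" and f1: "f 1 = 1" for a b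
    using f unfolding ring_morphism_def by auto
  have add: "map_poly f (p + q) = map_poly f p + map_poly f q" for p q
    by (simp add: poly_eq_iff coeff_map_poly f0 f_add)
  have smult: "map_poly f (smult a p) = smult (f a) (map_poly f p)" for a p
    by (simp add: poly_eq_iff coeff_map_poly f0 f_mult)
  have "poly (map_poly f (p * q)) y = poly (map_poly f p) y * poly (map_poly f q) y" for p q
  proof (induction p)
    case (pCons a p)
    then show ?case by (simp add: add smult map_poly_pCons f0 algebra_simps)
  qed simp
  then show ?thesis by (simp add: ring_morphism_def add f1)
qed

definition subst3 :: "'r::idom poly3 \<Rightarrow> 'r poly3 \<Rightarrow> 'r poly3 \<Rightarrow> 'r poly3 \<Rightarrow> 'r poly3" where
  "subst3 y0 y1 y2 h =
    poly (map_poly (\<lambda>p. poly (map_poly (\<lambda>q. poly (map_poly const3 q) y0) p) y1) h) y2"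

lemma ring_morphism_const3: "ring_morphism const3"
  by (simp add: ring_morphism_def const3_add const3_mult)

lemma ring_morphism_subst3: "ring_morphism (subst3 y0 y1 y2)"
  unfolding subst3_def by (intro ring_morphism_eval ring_morphism_const3)

lemma subst3_simps [simp]:
  "subst3 y0 y1 y2 (const3 r) = const3 r"
  "subst3 y0 y1 y2 x0 = y0" "subst3 y0 y1 y2 x1 = y1" "subst3 y0 y1 y2 x2 = y2"
  by (simp_all add: subst3_def const3_def[of r] x0_def x1_def x2_def map_poly_pCons one_pCons)
    (simp_all add: const3_def flip: one_pCons)

lemma subst3_add: "subst3 y0 y1 y2 (p + q) = subst3 y0 y1 y2 p + subst3 y0 y1 y2 q"
  and subst3_mult: "subst3 y0 y1 y2 (p * q) = subst3 y0 y1 y2 p * subst3 y0 y1 y2 q"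
  and subst3_0: "subst3 y0 y1 y2 0 = 0"
  using ring_morphism_subst3[of y0 y1 y2] ring_morphism_0 by (auto simp: ring_morphism_def)

lemma derivation_subst3:
  assumes "poly3_derivation X"
  shows "X (subst3 y0 y1 y2 h) = subst3 y0 y1 y2 (d0 h) * X y0 + subst3 y0 y1 y2 (d1 h) * X y1
    + subst3 y0 y1 y2 (d2 h) * X y2"
proof -
  have X: "derivation X" "\<And>r. X (const3 r) = 0" using assms by (auto simp: poly3_derivation_def)
  show ?thesis
  proof (induction h rule: poly3_induct)
    case (add p q)
    then show ?case by (simp add: subst3_add partials_add derivation_add[OF X(1)] algebra_simps)
  next
    case (mult p q)
    then show ?case
      by (simp add: subst3_add subst3_mult partials_mult derivation_mult[OF X(1)] algebra_simps)
  qed (use X ring_morphism_subst3[of y0 y1 y2] in \<open>simp_all add: subst3_0 ring_morphism_def\<close>)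
qed

lemma cramer3:
  fixes a0 :: "'a::idom"
  assumes "det3 a0 a1 a2 b0 b1 b2 c0 c1 c2 \<noteq> 0"
    and "s * a0 + t * b0 + u * c0 = 0" "s * a1 + t * b1 + u * c1 = 0" "s * a2 + t * b2 + u * c2 = 0"
  shows "s = 0 \<and> t = 0 \<and> u = 0"
proof -
  let ?d = "det3 a0 a1 a2 b0 b1 b2 c0 c1 c2"
  have "s * ?d = (s * a0 + t * b0 + u * c0) * (b1 * c2 - b2 * c1)
      - (s * a1 + t * b1 + u * c1) * (b0 * c2 - b2 * c0)
      + (s * a2 + t * b2 + u * c2) * (b0 * c1 - b1 * c0)"
    by (simp add: det3_def algebra_simps)
  moreover have "t * ?d = (s * a0 + t * b0 + u * c0) * (a2 * c1 - a1 * c2)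
      + (s * a1 + t * b1 + u * c1) * (a0 * c2 - a2 * c0)
      - (s * a2 + t * b2 + u * c2) * (a0 * c1 - a1 * c0)"
    by (simp add: det3_def algebra_simps)
  moreover have "u * ?d = (s * a0 + t * b0 + u * c0) * (a1 * b2 - a2 * b1)
      - (s * a1 + t * b1 + u * c1) * (a0 * b2 - a2 * b0)
      + (s * a2 + t * b2 + u * c2) * (a0 * b1 - a1 * b0)"
    by (simp add: det3_def algebra_simps)
  ultimately have "s * ?d = 0" "t * ?d = 0" "u * ?d = 0" using assms(2-4) by simp_all
  then show ?thesis using assms(1) by simp
qed

text \<open>By the chain rule the kernel is closed under the partial derivatives, so it would contain a
  nonzero constant.\<close>

lemma inj_subst3:
  fixes y0 y1 y2 :: "'r::idom poly3"
  assumes rat: "rational_algebra TYPE('r)" and "jac y0 y1 y2 \<noteq> 0"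
  shows "inj (subst3 y0 y1 y2)"
proof -
  let ?Z = "{h. subst3 y0 y1 y2 h = 0}"
  have closed: "d0 h \<in> ?Z" "d1 h \<in> ?Z" "d2 h \<in> ?Z" if "h \<in> ?Z" for h
  proof -
    let ?s = "\<lambda>h. subst3 y0 y1 y2 h"
    have "?s (d0 h) * d0 y0 + ?s (d1 h) * d0 y1 + ?s (d2 h) * d0 y2 = 0"
      "?s (d0 h) * d1 y0 + ?s (d1 h) * d1 y1 + ?s (d2 h) * d1 y2 = 0"
      "?s (d0 h) * d2 y0 + ?s (d1 h) * d2 y1 + ?s (d2 h) * d2 y2 = 0"
      using that derivation_subst3[of d0 y0 y1 y2 h] derivation_subst3[of d1 y0 y1 y2 h]
        derivation_subst3[of d2 y0 y1 y2 h] by simp_all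
    then show "d0 h \<in> ?Z" "d1 h \<in> ?Z" "d2 h \<in> ?Z"
      using cramer3[OF assms(2)[unfolded jac_def]] by blast+
  qed
  have kernel: "h = 0" if h: "subst3 y0 y1 y2 h = 0" for h
  proof (rule ccontr)
    assume "h \<noteq> 0"
    then obtain r where "r \<noteq> 0" "const3 r \<in> ?Z"
      using exists_constant_iterated_derivative[OF rat, of h ?Z] closed h by blast
    then show False by simp
  qed
  have "x = y" if "subst3 y0 y1 y2 x = subst3 y0 y1 y2 y" for x y
  proof -
    have "subst3 y0 y1 y2 (x + const3 (-1) * y) = subst3 y0 y1 y2 x + const3 (-1) * subst3 y0 y1 y2 y"
      by (simp only: subst3_add subst3_mult subst3_simps)
    also have "\<dots> = 0" using that by (simp add: const3_minus)
    finally have "subst3 y0 y1 y2 (x + const3 (-1) * y) = 0" .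
    then have "x + const3 (-1) * y = 0" by (rule kernel)
    then show ?thesis by (simp add: const3_minus)
  qed
  then show ?thesis by (rule injI)
qed

text \<open>Neither 0, 1 nor negatives are built in; they come from the constants or the invariants
  among the generators.\<close>

inductive_set subring_generated :: "'a::comm_ring_1 set \<Rightarrow> 'a set" for Y where
  base: "y \<in> Y \<Longrightarrow> y \<in> subring_generated Y"
| add: "p \<in> subring_generated Y \<Longrightarrow> q \<in> subring_generated Y \<Longrightarrow> p + q \<in> subring_generated Y"
| mult: "p \<in> subring_generated Y \<Longrightarrow> q \<in> subring_generated Y \<Longrightarrow> p * q \<in> subring_generated Y"

lemma subring_generated_UNIV_trans:
  assumes "subring_generated X = UNIV" "X \<subseteq> subring_generated Y"
  shows "subring_generated Y = UNIV"
proof -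
  have "h \<in> subring_generated Y" for h
  proof -
    have "h \<in> subring_generated X" using assms(1) by simp
    then show ?thesis
      by induction (use assms(2) in \<open>auto intro: subring_generated.add subring_generated.mult\<close>)
  qed
  then show ?thesis by blast
qed

text \<open>For fixed values of the other two arguments, \<open>jac\<close> is a derivation, so it suffices to test it
  on generators.\<close>

lemma jac_in_ideal_if_generators:
  assumes I: "0 \<in> I" "\<And>a b. a \<in> I \<Longrightarrow> b \<in> I \<Longrightarrow> a + b \<in> I" "\<And>a b. b \<in> I \<Longrightarrow> a * b \<in> I"
    and Y: "subring_generated (range const3 \<union> Y) = UNIV"
    and jac: "\<And>a b c. a \<in> Y \<Longrightarrow> b \<in> Y \<Longrightarrow> c \<in> Y \<Longrightarrow> jac a b c \<in> I"
  shows "1 \<in> I"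
proof -
  have gen: "P h" if "\<And>r. P (const3 r)" "\<And>y. y \<in> Y \<Longrightarrow> P y" "\<And>p q. P p \<Longrightarrow> P q \<Longrightarrow> P (p + q)"
    "\<And>p q. P p \<Longrightarrow> P q \<Longrightarrow> P (p * q)" for P h
  proof -
    have "h \<in> subring_generated (range const3 \<union> Y)" using Y by simp
    then show ?thesis by induction (use that in auto)
  qed
  have 1: "jac a b c \<in> I" if "b \<in> Y" "c \<in> Y" for a b c
    by (rule gen[of "\<lambda>a. jac a b c \<in> I"])
      (use that I jac in \<open>auto simp: jac_add jac_mult\<close>)
  have 2: "jac a b c \<in> I" if "c \<in> Y" for a b c
    by (rule gen[of "\<lambda>b. jac a b c \<in> I"])
      (use that I 1 in \<open>auto simp: jac_add jac_mult\<close>)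
  have 3: "jac a b c \<in> I" for a b c
    by (rule gen[of "\<lambda>c. jac a b c \<in> I"])
      (use I 2 in \<open>auto simp: jac_add jac_mult\<close>)
  from 3[of x0 x1 x2] show ?thesis by simp
qed

text \<open>Fraction-free Gaussian elimination: \<open>A'\<close> combines each equation with
  equation \<open>i\<close> to remove the unknown \<open>k\<close>, and \<open>c'\<close> restores
  that unknown while scaling the others by the pivot \<open>A i k\<close>.\<close>

lemma homogeneous_system_nontrivial:
  fixes A :: "'i \<Rightarrow> 'j \<Rightarrow> 'a::idom"
  assumes "finite I" "finite J" "card I < card J"
  shows "\<exists>c. (\<exists>j\<in>J. c j \<noteq> 0) \<and> (\<forall>i\<in>I. (\<Sum>j\<in>J. A i j * c j) = 0)"
  using assms
proof (induction I arbitrary: J A rule: finite_induct)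
  case empty
  then obtain j where "j \<in> J" by fastforce
  then show ?case by (intro exI[of _ "\<lambda>_. 1"]) auto
next
  case (insert i I)
  show ?case
  proof (cases "\<forall>j\<in>J. A i j = 0")
    case True
    then show ?thesis using insert.IH[of J A] insert.prems insert.hyps by auto
  next
    case False
    then obtain k where k: "k \<in> J" "A i k \<noteq> 0" by blast
    define A' where "A' l j = A i k * A l j - A l k * A i j" for l j
    have "card I < card (J - {k})" using insert k by simp
    then obtain c where c: "\<exists>j\<in>J - {k}. c j \<noteq> 0" "\<forall>l\<in>I. (\<Sum>j\<in>J - {k}. A' l j * c j) = 0"
      using insert.IH[of "J - {k}" A'] insert.prems by auto
    define c' where "c' j = (if j = k then - (\<Sum>j\<in>J - {k}. A i j * c j) else A i k * c j)" for j
    have sum: "(\<Sum>j\<in>J. A l j * c' j) = (\<Sum>j\<in>J - {k}. A' l j * c j)" for l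
    proof -
      have "(\<Sum>j\<in>J. A l j * c' j) = A l k * c' k + (\<Sum>j\<in>J - {k}. A l j * c' j)"
        using insert.prems(1) k(1) by (rule sum.remove)
      also have "(\<Sum>j\<in>J - {k}. A l j * c' j) = (\<Sum>j\<in>J - {k}. A i k * A l j * c j)"
        by (rule sum.cong) (auto simp: c'_def ac_simps)
      also have "A l k * c' k = - (\<Sum>j\<in>J - {k}. A l k * A i j * c j)"
        by (simp add: c'_def sum_distrib_left mult.assoc)
      finally show ?thesis by (simp add: A'_def left_diff_distrib sum_subtractf)
    qed
    have "\<exists>j\<in>J. c' j \<noteq> 0" using c(1) k(2) by (auto simp: c'_def)
    moreover have "(\<Sum>j\<in>J. A l j * c' j) = 0" if "l \<in> insert i I" for l
      using that c(2) unfolding sum by (auto simp: A'_def)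
    ultimately show ?thesis by blast
  qed
qed

definition box :: "nat \<Rightarrow> 'r::idom poly3 \<Rightarrow> bool" where
  "box N p \<longleftrightarrow> (\<forall>i j k. i > N \<or> j > N \<or> k > N \<longrightarrow> coeff (coeff (coeff p i) j) k = 0)"

lemma box_mono: "box M p \<Longrightarrow> M \<le> N \<Longrightarrow> box N p"
  by (auto simp: box_def)

lemma box_mult:
  assumes "box M p" "box N q"
  shows "box (M + N) (p * q)"
  unfolding box_def
proof (intro allI impI)
  fix i j k assume big: "i > M + N \<or> j > M + N \<or> k > M + N"
  have zero: "coeff (coeff (coeff p a) b) c * coeff (coeff (coeff q (i - a)) (j - b)) (k - c) = 0" for a b c
  proof -
    have "a > M \<or> b > M \<or> c > M \<or> i - a > N \<or> j - b > N \<or> k - c > N" using big by linarith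
    then show ?thesis using assms unfolding box_def by (metis mult_zero_left mult_zero_right)
  qed
  show "coeff (coeff (coeff (p * q) i) j) k = 0"
    by (simp only: coeff_mult coeff_sum zero sum.neutral_const)
qed

lemma box_exists: "\<exists>N. box N p"
proof (induction p rule: poly3_induct)
  case (const r)
  then show ?case by (intro exI[of _ 0]) (auto simp: box_def const3_def coeff_pCons split: nat.splits)
next
  case x0
  then show ?case by (intro exI[of _ 1]) (auto simp: box_def x0_def coeff_pCons split: nat.splits)
next
  case x1
  then show ?case by (intro exI[of _ 1]) (auto simp: box_def x1_def coeff_pCons one_pCons split: nat.splits)
next
  case x2
  then show ?case by (intro exI[of _ 1]) (auto simp: box_def x2_def coeff_pCons one_pCons split: nat.splits)
next
  case (add p q)
  then obtain M N where "box M p" "box N q" by blast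
  then have "box (max M N) (p + q)" by (simp add: box_def)
  then show ?case by blast
next
  case (mult p q)
  then obtain M N where "box M p" "box N q" by blast
  then have "box (M + N) (p * q)" by (rule box_mult)
  then show ?case by blast
qed

lemma box_power: "box N p \<Longrightarrow> box (n * N) (p ^ n)"
proof (induction n)
  case 0
  then show ?case by (auto simp: box_def one_pCons coeff_pCons split: nat.splits)
next
  case (Suc n)
  then have "box (N + n * N) (p * p ^ n)" by (intro box_mult) auto
  then show ?case by simp
qed

text \<open>There are \<open>M^4\<close> monomials with exponents below \<open>M\<close>, and each
  has its coefficients in a cube of side \<open>4 M N + 1\<close>. For large \<open>M\<close> the
  linear system for a dependence has more unknowns than equations.\<close>

lemma four_algebraically_dependent:
  fixes y0 y1 y2 y3 :: "'r::idom poly3"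
  shows "\<exists>M c. (\<exists>a<M. \<exists>b<M. \<exists>d<M. \<exists>e<M. c a b d e \<noteq> 0) \<and>
    (\<Sum>e<M. \<Sum>d<M. \<Sum>b<M. \<Sum>a<M. const3 (c a b d e) * (y0 ^ a * y1 ^ b * y2 ^ d * y3 ^ e)) = 0"
proof -
  obtain N0 N1 N2 N3 where "box N0 y0" "box N1 y1" "box N2 y2" "box N3 y3" using box_exists by metis
  define N where "N = max (max N0 N1) (max N2 N3)"
  have box: "box N y0" "box N y1" "box N y2" "box N y3"
    by (rule box_mono[OF \<open>box N0 y0\<close>] box_mono[OF \<open>box N1 y1\<close>] box_mono[OF \<open>box N2 y2\<close>]
        box_mono[OF \<open>box N3 y3\<close>], simp add: N_def)+
  \<comment> \<open>Chosen so that \<open>(K + 1)^3 \<le> M^3 (4 N + 1)^3 < M^4\<close>.\<close>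
  define M where "M = Suc ((4 * N + 1) ^ 3)"
  define K where "K = 4 * M * N"
  define m where "m = (\<lambda>(e, d, b, a). y0 ^ a * y1 ^ b * y2 ^ d * y3 ^ e)"
  define A where "A = (\<lambda>(i, j, k) t. coeff (coeff (coeff (m t) i) j) k)"
  define I where "I = {..K} \<times> {..K} \<times> {..K}"
  define J where "J = {..<M} \<times> {..<M} \<times> {..<M} \<times> {..<M}"
  have fin: "finite I" "finite J" by (simp_all add: I_def J_def)
  have "card I = (K + 1) ^ 3" by (simp add: I_def card_cartesian_product power3_eq_cube)
  also have "K + 1 \<le> M * (4 * N + 1)" by (simp add: K_def M_def algebra_simps)
  then have "(K + 1) ^ 3 \<le> (M * (4 * N + 1)) ^ 3" by (rule power_mono) simp
  also have "\<dots> = M ^ 3 * (4 * N + 1) ^ 3" by (rule power_mult_distrib)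
  also have "\<dots> < M ^ 3 * M" by (simp add: M_def)
  also have "\<dots> = card J" by (simp add: J_def card_cartesian_product power3_eq_cube)
  finally have "card I < card J" .
  then obtain c where c: "\<exists>t\<in>J. c t \<noteq> 0" "\<forall>i\<in>I. (\<Sum>t\<in>J. A i t * c t) = 0"
    using homogeneous_system_nontrivial[OF fin, of A] by blast
  have m_box: "box K (m t)" if "t \<in> J" for t
  proof -
    obtain a b d e where t: "t = (e, d, b, a)" by (cases t)
    then have lt: "a < M" "b < M" "d < M" "e < M" using that by (auto simp: J_def)
    have "box (a * N + b * N + d * N + e * N) (m t)" unfolding m_def t prod.case
      by (intro box_mult box_power box)
    moreover have "a * N + b * N + d * N + e * N \<le> M * N + M * N + M * N + M * N"
      using lt by (intro add_mono mult_le_mono1) auto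
    then have "a * N + b * N + d * N + e * N \<le> K" by (simp add: K_def)
    ultimately show ?thesis by (rule box_mono)
  qed
  let ?s = "\<Sum>t\<in>J. const3 (c t) * m t"
  have coeff_s: "coeff (coeff (coeff ?s i) j) k = (\<Sum>t\<in>J. A (i, j, k) t * c t)" for i j k
    by (simp add: coeff_sum const3_def A_def mult.commute)
  have "coeff (coeff (coeff ?s i) j) k = 0" for i j k
  proof (cases "(i, j, k) \<in> I")
    case True
    then show ?thesis using c(2) unfolding coeff_s by blast
  next
    case False
    then have "A (i, j, k) t = 0" if "t \<in> J" for t
      using m_box[OF that] by (auto simp: A_def box_def I_def)
    then show ?thesis unfolding coeff_s by simp
  qed
  then have zero: "?s = 0" by (simp add: poly_eq_iff)
  have "?s = (\<Sum>e<M. \<Sum>d<M. \<Sum>b<M. \<Sum>a<M. const3 (c (e, d, b, a)) * (y0 ^ a * y1 ^ b * y2 ^ d * y3 ^ e))"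
    by (simp add: J_def m_def sum.cartesian_product case_prod_beta')
  moreover have "\<exists>a<M. \<exists>b<M. \<exists>d<M. \<exists>e<M. c (e, d, b, a) \<noteq> 0" using c(1) by (auto simp: J_def)
  ultimately show ?thesis using zero by (intro exI[of _ M] exI[of _ "\<lambda>a b d e. c (e, d, b, a)"]) simp
qed

section \<open>Coordinate systems and equivalence\<close>

lemma surj_subst3:
  assumes "subring_generated (range const3 \<union> {y0, y1, y2}) = UNIV"
  shows "surj (subst3 y0 y1 y2)"
proof -
  have "h \<in> range (subst3 y0 y1 y2)" for h
  proof -
    have "h \<in> subring_generated (range const3 \<union> {y0, y1, y2})" using assms by simp
    then show ?thesis
    proof induction
      case (base y)
      then consider r where "y = const3 r" | "y = y0" | "y = y1" | "y = y2" by blast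
      then show ?case
        using rangeI[of "subst3 y0 y1 y2" x0] rangeI[of "subst3 y0 y1 y2" x1]
          rangeI[of "subst3 y0 y1 y2" x2] rangeI[of "subst3 y0 y1 y2" "const3 r" for r] by cases simp_all
    next
      case (add p q)
      then show ?case by (auto simp flip: subst3_add)
    next
      case (mult p q)
      then show ?case by (auto simp flip: subst3_mult)
    qed
  qed
  then show ?thesis by blast
qed

text \<open>Jacobian determinants of the generators are 0 or \<open>jac y0 y1 y2\<close> up to sign,
  so this determinant divides 1 by \<open>jac_in_ideal_if_generators\<close>. It is therefore
  nonzero, which gives injectivity.\<close>

lemma bij_subst3:
  fixes y0 y1 y2 :: "'r::idom poly3"
  assumes rat: "rational_algebra TYPE('r)"
    and gen: "subring_generated (range const3 \<union> {y0, y1, y2}) = UNIV"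
  shows "bij (subst3 y0 y1 y2)"
proof -
  have "1 \<in> {jac y0 y1 y2 * x |x. True}"
  proof (rule jac_in_ideal_if_generators[OF _ _ _ gen])
    show "0 \<in> {jac y0 y1 y2 * x |x. True}" by (rule CollectI, rule exI[of _ 0]) simp
    show "a + b \<in> {jac y0 y1 y2 * x |x. True}"
      if "a \<in> {jac y0 y1 y2 * x |x. True}" "b \<in> {jac y0 y1 y2 * x |x. True}" for a b
      using that by (auto simp flip: distrib_left)
    show "a * b \<in> {jac y0 y1 y2 * x |x. True}" if "b \<in> {jac y0 y1 y2 * x |x. True}" for a b
      using that by (auto simp: mult.left_commute)
    show "jac a b c \<in> {jac y0 y1 y2 * x |x. True}"
      if "a \<in> {y0, y1, y2}" "b \<in> {y0, y1, y2}" "c \<in> {y0, y1, y2}" for a b c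
    proof -
      have "jac a b c \<in> {jac y0 y1 y2 * 0, jac y0 y1 y2 * 1, jac y0 y1 y2 * (- 1)}"
        using that jac_swap[of y0 y1 y2] jac_swap[of y1 y2 y0] jac_rotate[of y0 y1 y2]
          jac_rotate[of y1 y2 y0] jac_swap[of y1 y0 y2] jac_swap[of y2 y0 y1]
        by (elim insertE emptyE) (simp_all add: jac_swap(2)[of _ y1] jac_rotate)
      then show ?thesis by blast
    qed
  qed
  then have "jac y0 y1 y2 \<noteq> 0" by auto
  then show ?thesis using inj_subst3[OF rat] surj_subst3[OF gen] by (simp add: bij_def)
qed

text \<open>A single conjugation, by the inverse of the substitution, suffices.\<close>

lemma equivalent_over_subst3:
  assumes bij: "bij (subst3 y0 y1 y2)"
    and D: "\<And>h. D (subst3 y0 y1 y2 h) = subst3 y0 y1 y2 (D' h)"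
    and U: "\<And>h. U (subst3 y0 y1 y2 h) = subst3 y0 y1 y2 (U' h)"
  shows "equivalent_over (range const3) (D, U) (D', U')"
proof -
  define s where "s = subst3 y0 y1 y2"
  define t where "t = inv s"
  have bij_s: "bij s" using bij by (simp add: s_def)
  have st: "s (t h) = h" "t (s h) = h" for h
    using bij_s by (simp_all add: t_def bij_def surj_f_inv_f)
  have s: "s 1 = 1" "s (a + b) = s a + s b" "s (a * b) = s a * s b" "s (const3 r) = const3 r" for a b r
    using ring_morphism_subst3[of y0 y1 y2] unfolding s_def ring_morphism_def by auto
  have "algebra_automorphism (range const3) t"
    unfolding algebra_automorphism_def ring_morphism_def
  proof (intro conjI allI ballI)
    show "t 1 = 1" by (metis s(1) st(2))
    show "t (a + b) = t a + t b" for a b by (metis s(2) st)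
    show "t (a * b) = t a * t b" for a b by (metis s(3) st)
    show "bij t" unfolding t_def using bij_s by (rule bij_imp_bij_inv)
    show "t r = r" if "r \<in> range const3" for r using that by (metis rangeE s(4) st(2))
  qed
  then have "pair_step_over (range const3) (D, U) (t \<circ> D \<circ> inv t, t \<circ> U \<circ> inv t)"
    by (rule pair_step_over.conjugate)
  moreover have "inv t = s" unfolding t_def using bij_s by (simp add: inv_inv_eq)
  then have "t \<circ> D \<circ> inv t = D'" "t \<circ> U \<circ> inv t = U'"
    using D U st by (auto simp: fun_eq_iff s_def[symmetric])
  ultimately show ?thesis unfolding equivalent_over_def by auto
qed

lemma degree_add_const:
  fixes p :: "'a::comm_ring_1 poly"
  shows "degree (p + [:k:]) = degree p"
    and "lead_coeff (p + [:k:]) = (if degree p = 0 then lead_coeff p + k else lead_coeff p)"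
proof -
  show "degree (p + [:k:]) = degree p" by (cases p) simp
  then show "lead_coeff (p + [:k:]) = (if degree p = 0 then lead_coeff p + k else lead_coeff p)"
    by (cases p) (auto simp: coeff_pCons split: nat.split)
qed

lemma degree3_add_const: "degree3 (p + const3 c) = degree3 p"
proof -
  define p' where "p' = p + const3 c"
  have p': "degree p' = degree p" "lead_coeff p' = lead_coeff p \<or> lead_coeff p' = lead_coeff p + [:[:c:]:]"
    using degree_add_const[of p "[:[:c:]:]"]
    by (auto simp: p'_def const3_def simp del: coeff_add split: if_splits)
  define q where "q = lead_coeff p"
  define q' where "q' = lead_coeff p'"
  have q': "degree q' = degree q" "lead_coeff q' = lead_coeff q \<or> lead_coeff q' = lead_coeff q + [:c:]"
    using p'(2) degree_add_const[of q "[:c:]"] by (auto simp flip: q_def q'_def split: if_splits)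
  have "degree (lead_coeff q') = degree (lead_coeff q)"
    using q'(2) degree_add_const(1)[of "lead_coeff q" c] by auto
  then show ?thesis using p'(1) q'(1) unfolding degree3_def p'_def q_def q'_def by simp
qed

text \<open>On polynomials in \<open>y\<close> over its kernel, \<open>X\<close> is
  \<open>X y\<close> times the formal derivative, so applying it shortens the relation. Thus
  \<open>y\<close> is transcendental over the kernel.\<close>

lemma power_independent:
  fixes X :: "'b::idom \<Rightarrow> 'b"
  assumes rat: "rational_algebra TYPE('b)" and X: "derivation X" "X y \<noteq> 0"
    and "\<And>i. X (\<alpha> i) = 0" "(\<Sum>i<n. \<alpha> i * y ^ i) = 0" "i < n"
  shows "\<alpha> i = 0"
  using assms(4-)
proof (induction n arbitrary: \<alpha> i)
  case (Suc n)
  have "X (\<Sum>i<Suc n. \<alpha> i * y ^ i) = (\<Sum>i<Suc n. \<alpha> i * X (y ^ i))"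
    by (simp add: derivation_sum[OF X(1)] derivation_mult[OF X(1)] derivation_add[OF X(1)] Suc.prems(1))
  also have "\<dots> = (\<Sum>i<n. \<alpha> (Suc i) * X (y ^ Suc i))"
    by (subst sum.lessThan_Suc_shift) (simp add: derivation_1[OF X(1)])
  also have "\<dots> = (\<Sum>i<n. (of_nat (Suc i) * \<alpha> (Suc i)) * y ^ i) * X y"
    unfolding derivation_power[OF X(1)] sum_distrib_right by (intro sum.cong) (simp_all add: ac_simps)
  finally have "(\<Sum>i<n. (of_nat (Suc i) * \<alpha> (Suc i)) * y ^ i) = 0"
    using X(2) Suc.prems(2) by (simp add: derivation_0[OF X(1)])
  moreover have "X (of_nat (Suc i) * \<alpha> (Suc i)) = 0" for i
    using Suc.prems(1) derivation_of_nat[OF X(1), of "Suc i"] by (simp add: derivation_mult[OF X(1)] del: of_nat_Suc)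
  ultimately have "of_nat (Suc i) * \<alpha> (Suc i) = 0" if "i < n" for i
    using Suc.IH[of "\<lambda>i. of_nat (Suc i) * \<alpha> (Suc i)"] that by blast
  then have higher: "\<alpha> (Suc i) = 0" if "i < n" for i
    using that rational_algebra_of_nat_eq_0[OF rat, of "Suc i"] by (metis mult_eq_0_iff nat.distinct(1))
  have "\<alpha> 0 = 0" using Suc.prems(2) higher by (simp add: sum.lessThan_Suc_shift del: sum.lessThan_Suc)
  then show ?case using higher Suc.prems(3) by (cases i) auto
qed simp

section \<open>Invariants and highest weight vectors\<close>

definition vdet :: "('r::idom poly3 \<Rightarrow> 'r poly3) \<Rightarrow> ('r poly3 \<Rightarrow> 'r poly3) \<Rightarrow> ('r poly3 \<Rightarrow> 'r poly3) \<Rightarrow> 'r poly3" where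
  "vdet X Y Z = det3 (X x0) (X x1) (X x2) (Y x0) (Y x1) (Y x2) (Z x0) (Z x1) (Z x2)"

text \<open>The Lie derivative of the volume of \<open>X\<close>, \<open>Y\<close>, \<open>Z\<close>
  is \<open>divergence X\<close> times it plus volumes with one field replaced by its bracket with
  \<open>X\<close>. Here the brackets are multiples of \<open>Z\<close> and \<open>X\<close>, so
  each of these has a repeated field.\<close>

lemma vdet_lie_derivative:
  assumes X: "poly3_derivation X" and Y: "poly3_derivation Y" and Z: "poly3_derivation Z"
    and XY: "\<And>h. X (Y h) = Y (X h) + s * Z h" and XZ: "\<And>h. X (Z h) = Z (X h) + t * X h"
  shows "X (vdet X Y Z) = divergence X * vdet X Y Z"
proof -
  have der: "derivation X" using X by (simp add: poly3_derivation_def)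
  have XX: "X (X h) = X x0 * d0 (X h) + X x1 * d1 (X h) + X x2 * d2 (X h)" for h
    by (rule poly3_derivation_eq[OF X])
  have XY': "X (Y h) = Y x0 * d0 (X h) + Y x1 * d1 (X h) + Y x2 * d2 (X h) + s * Z h" for h
    using XY[of h] poly3_derivation_eq[OF Y, of "X h"] by simp
  have XZ': "X (Z h) = Z x0 * d0 (X h) + Z x1 * d1 (X h) + Z x2 * d2 (X h) + t * X h" for h
    using XZ[of h] poly3_derivation_eq[OF Z, of "X h"] by simp
  show ?thesis
    unfolding vdet_def det3_def derivation_add[OF der] derivation_diff[OF der] derivation_mult[OF der]
      XX[of x0] XX[of x1] XX[of x2] XY' XZ' divergence_def
    by (simp add: algebra_simps)
qed

lemma vdet_cramer:
  assumes "poly3_derivation X" "poly3_derivation Y" "poly3_derivation Z" "poly3_derivation W"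
  shows "vdet X Y Z * W h = vdet W Y Z * X h + vdet X W Z * Y h + vdet X Y W * Z h"
proof (rule poly3_derivation_ext[where X = "\<lambda>h. vdet X Y Z * W h"
      and Y = "\<lambda>h. vdet W Y Z * X h + vdet X W Z * Y h + vdet X Y W * Z h"])
  show "poly3_derivation (\<lambda>h. vdet X Y Z * W h)"
    by (intro poly3_derivation_scale assms)
  show "poly3_derivation (\<lambda>h. vdet W Y Z * X h + vdet X W Z * Y h + vdet X Y W * Z h)"
    by (intro poly3_derivation_add poly3_derivation_scale assms)
qed (simp_all add: vdet_def det3_def algebra_simps)

lemma coprime_triple_exists:
  fixes r :: "'a::idom"
  assumes "prime_product n r"
  shows "\<exists>c p' q' r'. p = c * p' \<and> q = c * q' \<and> r = c * r' \<and> c \<noteq> 0 \<and>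
    (\<forall>\<pi>. prime_elem \<pi> \<longrightarrow> \<pi> dvd r' \<longrightarrow> \<pi> dvd p' \<longrightarrow> \<not> \<pi> dvd q')"
  using assms
proof (induction n arbitrary: p q r)
  case 0
  then have "r dvd 1" by cases
  then have "\<not> \<pi> dvd r" if "prime_elem \<pi>" for \<pi>
    using that by (metis dvd_trans prime_elem_not_unit)
  then show ?case by (intro exI[of _ 1] exI[of _ p] exI[of _ q] exI[of _ r]) auto
next
  case (Suc n)
  show ?case
  proof (cases "\<exists>\<pi>. prime_elem \<pi> \<and> \<pi> dvd r \<and> \<pi> dvd p \<and> \<pi> dvd q")
    case True
    then obtain \<pi> p1 q1 r1 where \<pi>: "prime_elem \<pi>" and eq: "p = \<pi> * p1" "q = \<pi> * q1" "r = \<pi> * r1"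
      unfolding dvd_def by blast
    have "prime_product n r1" using prime_product_cancel_prime[OF _ \<pi>] Suc.prems eq(3) by blast
    from Suc.IH[OF this, of p1 q1] obtain c p' q' r'
      where c: "p1 = c * p'" "q1 = c * q'" "r1 = c * r'" "c \<noteq> 0"
        "\<forall>\<pi>. prime_elem \<pi> \<longrightarrow> \<pi> dvd r' \<longrightarrow> \<pi> dvd p' \<longrightarrow> \<not> \<pi> dvd q'" by blast
    show ?thesis
      using c \<pi> eq by (intro exI[of _ "\<pi> * c"] exI[of _ p'] exI[of _ q'] exI[of _ r'])
        (auto simp: prime_elem_def)
  next
    case False
    then have "\<forall>\<pi>. prime_elem \<pi> \<longrightarrow> \<pi> dvd r \<longrightarrow> \<pi> dvd p \<longrightarrow> \<not> \<pi> dvd q" by blast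
    then show ?thesis by (intro exI[of _ 1] exI[of _ p] exI[of _ q] exI[of _ r]) simp
  qed
qed

locale fundamental3 = sl2_pair D U E
  for D U E :: "'r::idom poly3 \<Rightarrow> 'r poly3" +
  assumes ufd_R: "ufd TYPE('r)" and rat_R: "rational_algebra TYPE('r)"
    and D_const: "\<And>r. D (const3 r) = 0" and U_const: "\<And>r. U (const3 r) = 0"
    and nontrivial: "\<exists>b. D b \<noteq> 0"
begin

lemma ufd: "ufd TYPE('r poly3)"
  by (intro ufd_poly ufd_R)

lemma poly3_D: "poly3_derivation D" and poly3_U: "poly3_derivation U"
  by (simp_all add: poly3_derivation_def D_der U_der D_const U_const)

lemma E_const: "E (const3 r) = 0"
  by (simp add: E_eq D_const U_const D_simps U_simps)

lemma poly3_E: "poly3_derivation E"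
  by (simp add: poly3_derivation_def E_der E_const)

lemma const3_invariant: "const3 r \<in> invariants"
  by (simp add: invariants_def D_const U_const)

lemma divergence_D: "divergence D = 0" and divergence_U: "divergence U = 0"
  using divergence_LND[OF rat] poly3_D poly3_U D_LND U_LND by blast+

lemma divergence_E: "divergence E = 0"
proof -
  have "E = (\<lambda>h. D (U h) - U (D h))" by (simp add: fun_eq_iff E_eq)
  then show ?thesis using divergence_commutator[OF poly3_D poly3_U]
    by (simp add: divergence_D divergence_U D_simps U_simps)
qed

lemma divergence_tangent: "divergence (\<lambda>h. a * D h + b * U h + c * E h) \<in> coboundaries"
  by (simp add: divergence_add divergence_scale poly3_D poly3_U poly3_E divergence_D divergence_U
      divergence_E coboundaries_add coboundaries_E)

text \<open>If the determinant \<open>J\<close> of the three vector fields were nonzero, Cramer's rule would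
  make \<open>J X\<close> tangent to the orbits for every vector field \<open>X\<close>, and hence its divergence would
  be killed by the Reynolds operator.\<close>

lemma vdet_eq_0: "vdet D U E = 0"
proof -
  define J where "J = vdet D U E"
  have "D J = 0"
    unfolding J_def using vdet_lie_derivative[OF poly3_D poly3_U poly3_E, of 1 "-2"] D_E
    by (simp add: D_U divergence_D algebra_simps)
  moreover have "U J = 0"
  proof -
    have swap: "vdet U D E = - J" by (simp add: J_def vdet_def det3_def algebra_simps)
    have "U (vdet U D E) = 0"
      using vdet_lie_derivative[OF poly3_U poly3_D poly3_E, of "-1" 2] U_E
      by (simp add: D_U divergence_U algebra_simps)
    then show ?thesis unfolding swap by (simp add: U_simps)
  qed
  ultimately have J: "J \<in> invariants" by (simp add: invariants_def)
  define Y where "Y h = x0 * d0 h" for h :: "'r poly3"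
  have Y: "poly3_derivation Y" unfolding Y_def by (intro poly3_derivation_scale) simp
  have div_Y: "divergence Y = 1" by (simp add: divergence_def Y_def)
  \<comment> \<open>Taken at \<open>f = 1\<close> and \<open>f = J\<close>, this gives
    \<open>J + reynolds (Y J) = 0\<close> and \<open>J^2 + 2 J reynolds (Y J) = 0\<close>, which
    together force \<open>J^2 = 0\<close>.\<close>
  have key: "reynolds (J * f + (J * Y f + f * Y J)) = 0" for f
  proof -
    have "(J * f) * Y h = f * (vdet Y U E * D h + vdet D Y E * U h + vdet D U Y * E h)" for h
      using vdet_cramer[OF poly3_D poly3_U poly3_E Y, of h] by (simp add: J_def mult.assoc mult.left_commute)
    then have eq: "(\<lambda>h. (J * f) * Y h)
        = (\<lambda>h. (f * vdet Y U E) * D h + (f * vdet D Y E) * U h + (f * vdet D U Y) * E h)"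
      by (simp add: fun_eq_iff algebra_simps)
    have "divergence (\<lambda>h. (J * f) * Y h) \<in> coboundaries" unfolding eq by (rule divergence_tangent)
    moreover have "divergence (\<lambda>h. (J * f) * Y h) = J * f + (J * Y f + f * Y J)"
      using Y unfolding divergence_scale[OF Y] div_Y
      by (simp add: poly3_derivation_def derivation_mult mult.commute)
    ultimately show ?thesis by (simp add: reynolds_coboundary)
  qed
  have "Y 1 = 0" using Y by (simp add: poly3_derivation_def derivation_1)
  then have "J + reynolds (Y J) = 0" using key[of 1] reynolds_invariant[OF J] by (simp add: reynolds_add)
  then have "reynolds (Y J) = - J" by (simp add: eq_neg_iff_add_eq_0 add.commute)
  moreover have "J * J + (J * reynolds (Y J) + J * reynolds (Y J)) = 0"
    using key[of J] by (simp only: reynolds_add reynolds_mult[OF J] reynolds_invariant[OF J])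
  ultimately have "J * J = 0" by simp
  then show ?thesis by (simp add: J_def)
qed

text \<open>A highest weight vector of positive weight is killed by \<open>D\<close> but not by
  \<open>U\<close>.\<close>

lemma D_U_independent:
  assumes "\<And>h. a * D h + b * U h = 0"
  shows "a = 0 \<and> b = 0"
proof -
  obtain c d where c: "d > 0" "c \<in> wt d" "D c = 0" "c \<noteq> 0"
    using nontrivial exists_positive_highest_weight by blast
  have "b = 0"
  proof (rule ccontr)
    assume "b \<noteq> 0"
    then have "U c = 0" using assms[of c] c(3) by simp
    then have "c \<in> wt 0" using c(3) by (simp add: wt_zero_if_invariant)
    then show False using c of_int_eq_0[of d] by (simp add: wt_iff)
  qed
  then show ?thesis using assms nontrivial by auto
qed

text \<open>As the determinant of \<open>D\<close>, \<open>U\<close>, \<open>E\<close> vanishes, its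
  cofactors give relations. Their \<open>E\<close>-coefficients are the minors of \<open>D\<close>
  and \<open>U\<close>, not all zero by \<open>D_U_independent\<close>; common primes are cancelled
  at the end.\<close>

lemma tangent_relation:
  obtains p q r where "r \<noteq> 0" "\<And>h. p * D h + q * U h + r * E h = 0"
    "\<And>\<pi>. prime_elem \<pi> \<Longrightarrow> \<pi> dvd r \<Longrightarrow> \<pi> dvd p \<Longrightarrow> \<not> \<pi> dvd q"
proof -
  define rel where "rel p q r \<longleftrightarrow> (\<forall>h. p * D h + q * U h + r * E h = 0)" for p q r
  have relI: "rel p q r" if "p * D x0 + q * U x0 + r * E x0 = 0" "p * D x1 + q * U x1 + r * E x1 = 0"
    "p * D x2 + q * U x2 + r * E x2 = 0" for p q r
    unfolding rel_def
  proof
    fix h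
    have "poly3_derivation (\<lambda>h. p * D h + q * U h + r * E h)"
      by (intro poly3_derivation_add poly3_derivation_scale poly3_D poly3_U poly3_E)
    then show "p * D h + q * U h + r * E h = 0"
      using poly3_derivation_ext[OF _ poly3_derivation_zero] that by blast
  qed
  have J: "det3 (D x0) (D x1) (D x2) (U x0) (U x1) (U x2) (E x0) (E x1) (E x2) = 0"
    using vdet_eq_0 by (simp add: vdet_def)
  have rel1: "rel (U x1 * E x2 - U x2 * E x1) (E x1 * D x2 - E x2 * D x1) (D x1 * U x2 - D x2 * U x1)"
    by (rule relI; use J in \<open>simp add: det3_def algebra_simps\<close>)
  have rel2: "rel (U x2 * E x0 - U x0 * E x2) (E x2 * D x0 - E x0 * D x2) (D x2 * U x0 - D x0 * U x2)"
    by (rule relI; use J in \<open>simp add: det3_def algebra_simps\<close>)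
  have rel3: "rel (U x0 * E x1 - U x1 * E x0) (E x0 * D x1 - E x1 * D x0) (D x0 * U x1 - D x1 * U x0)"
    by (rule relI; use J in \<open>simp add: det3_def algebra_simps\<close>)
  have "\<exists>p q r. r \<noteq> 0 \<and> rel p q r"
  proof (rule ccontr)
    assume "\<not> ?thesis"
    then have cross: "D x1 * U x2 - D x2 * U x1 = 0" "D x2 * U x0 - D x0 * U x2 = 0" "D x0 * U x1 - D x1 * U x0 = 0"
      using rel1 rel2 rel3 by blast+
    \<comment> \<open>If all minors vanish, then \<open>U y * D h = D y * U h\<close> for each
      coordinate \<open>y\<close>, which independence allows only if \<open>D y = 0\<close>.\<close>
    have zero: "D y = 0" if "\<And>x. x \<in> {x0, x1, x2} \<Longrightarrow> U y * D x + - D y * U x = 0" for y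
    proof -
      have "rel (U y) (- D y) 0" using that by (intro relI) simp_all
      then show ?thesis using D_U_independent[of "U y" "- D y"] by (simp add: rel_def)
    qed
    have "D x0 = 0" by (rule zero) (use cross in \<open>auto simp: algebra_simps\<close>)
    moreover have "D x1 = 0" by (rule zero) (use cross in \<open>auto simp: algebra_simps\<close>)
    moreover have "D x2 = 0" by (rule zero) (use cross in \<open>auto simp: algebra_simps\<close>)
    ultimately have "D b = 0" for b by (subst poly3_derivation_eq[OF poly3_D]) simp
    then show False using nontrivial by blast
  qed
  then obtain p q r where pqr: "r \<noteq> 0" "rel p q r" by blast
  obtain n where "prime_product n r" using ufd pqr(1) unfolding ufd_def by blast
  from coprime_triple_exists[OF this, of p q] obtain c p' q' r'
    where c: "p = c * p'" "q = c * q'" "r = c * r'" "c \<noteq> 0"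
      "\<forall>\<pi>. prime_elem \<pi> \<longrightarrow> \<pi> dvd r' \<longrightarrow> \<pi> dvd p' \<longrightarrow> \<not> \<pi> dvd q'" by blast
  have "c * (p' * D h + q' * U h + r' * E h) = 0" for h
    using pqr(2) unfolding rel_def c by (simp add: algebra_simps)
  then have "p' * D h + q' * U h + r' * E h = 0" for h using c(4) by simp
  then show ?thesis using that[of r' p' q'] c(3,5) pqr(1) by auto
qed

text \<open>The coprime relation is unique up to a factor. Bracketing it with \<open>D\<close> and \<open>U\<close> therefore
  shows that its coefficients span a representation with highest weight vector \<open>q\<close> of weight 2.\<close>

lemma weight_2_relation:
  obtains q r where "q \<in> wt 2" "D q = 0" "q \<noteq> 0" "\<And>a d. a \<in> wt d \<Longrightarrow> D a = 0 \<Longrightarrow> q * U a = - r * (of_int d * a)"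
proof -
  obtain p q r where r: "r \<noteq> 0" and rel: "\<And>h. p * D h + q * U h + r * E h = 0"
    and coprime: "\<And>\<pi>. prime_elem \<pi> \<Longrightarrow> \<pi> dvd r \<Longrightarrow> \<pi> dvd p \<Longrightarrow> \<not> \<pi> dvd q"
    by (rule tangent_relation) blast
  have unique: "\<exists>l. p' = l * p \<and> q' = l * q \<and> r' = l * r"
    if rel': "\<And>h. p' * D h + q' * U h + r' * E h = 0" for p' q' r'
  proof -
    have "(r * p' - r' * p) * D h + (r * q' - r' * q) * U h = 0" for h
    proof -
      have "(r * p' - r' * p) * D h + (r * q' - r' * q) * U h
          = r * (p' * D h + q' * U h + r' * E h) - r' * (p * D h + q * U h + r * E h)"
        by (simp add: algebra_simps)
      then show ?thesis by (simp add: rel rel')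
    qed
    then have eq: "r * p' = r' * p" "r * q' = r' * q"
      using D_U_independent[of "r * p' - r' * p" "r * q' - r' * q"] by auto
    then have "r dvd r' * p" "r dvd r' * q" by (metis dvd_triv_left)+
    then have "r dvd r'" using ufd_cancel_coprime[OF ufd r coprime] by blast
    then obtain l where l: "r' = l * r" by (metis dvdE mult.commute)
    then have "r * p' = r * (l * p)" "r * q' = r * (l * q)" using eq by (simp_all add: ac_simps)
    then show ?thesis using l r by (metis mult_cancel_left)
  qed
  have "(D p - 2 * r) * D h + D q * U h + (D r + q) * E h = 0" for h
  proof -
    have "(D p - 2 * r) * D h + D q * U h + (D r + q) * E h
        = D (p * D h + q * U h + r * E h) - (p * D (D h) + q * U (D h) + r * E (D h))
          - r * (D (E h) - E (D h) + 2 * D h) - q * (D (U h) - U (D h) - E h)"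
      by (simp add: D_simps D_mult algebra_simps)
    moreover have "D (p * D h + q * U h + r * E h) = 0" unfolding rel by (simp add: D_simps)
    moreover have "D (E h) - E (D h) + 2 * D h = 0" using D_E[of h] by simp
    moreover have "D (U h) - U (D h) - E h = 0" by (simp add: E_eq)
    ultimately show ?thesis using rel[of "D h"] by simp
  qed
  then obtain l where l: "D p - 2 * r = l * p" "D q = l * q" "D r + q = l * r" using unique by blast
  have "(U p) * D h + (U q + 2 * r) * U h + (U r - p) * E h = 0" for h
  proof -
    have "(U p) * D h + (U q + 2 * r) * U h + (U r - p) * E h
        = U (p * D h + q * U h + r * E h) - (p * D (U h) + q * U (U h) + r * E (U h))
          - r * (U (E h) - E (U h) - 2 * U h) + p * (D (U h) - U (D h) - E h)"
      by (simp add: U_simps U_mult algebra_simps)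
    moreover have "U (p * D h + q * U h + r * E h) = 0" unfolding rel by (simp add: U_simps)
    moreover have "U (E h) - E (U h) - 2 * U h = 0" using U_E[of h] by simp
    moreover have "D (U h) - U (D h) - E h = 0" by (simp add: E_eq)
    ultimately show ?thesis using rel[of "U h"] by simp
  qed
  then obtain n where n: "U p = n * p" "U q + 2 * r = n * q" "U r - p = n * r" using unique by blast
  have two: "(2 :: 'r poly3) \<noteq> 0" using of_int_eq_0[of 2] by simp
  \<comment> \<open>Locally nilpotent derivations have no nonzero eigenvalues, so
    \<open>D q = l q\<close> and \<open>U p = n p\<close> force \<open>l = n = 0\<close>. Then
    \<open>p\<close>, \<open>r\<close>, \<open>q\<close> transform as the adjoint
    representation.\<close>
  have "D q = 0" using LND_dvd_imp_0[OF rat D_LND, of q] l(2) by simp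
  have "q \<noteq> 0"
  proof
    assume "q = 0"
    then have "2 * r = 0" using n(2) by (simp add: U_simps)
    then show False using r two by simp
  qed
  then have "l = 0" using l(2) \<open>D q = 0\<close> by simp
  then have Dp: "D p = 2 * r" "D r = - q" using l by (simp_all add: eq_neg_iff_add_eq_0)
  have "p \<noteq> 0" using Dp(1) r two by (auto simp: D_simps)
  have "U p = 0" using LND_dvd_imp_0[OF rat U_LND, of p] n(1) by simp
  then have "n = 0" using n(1) \<open>p \<noteq> 0\<close> by simp
  then have "U q = - (2 * r)" using n(2) by (simp add: eq_neg_iff_add_eq_0)
  then have "q \<in> wt 2" using \<open>D q = 0\<close> Dp(2)
    by (simp add: wt_iff E_eq D_simps U_simps D_mult)
  \<comment> \<open>A highest weight vector sees only the \<open>U\<close> and \<open>E\<close>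
    terms of the relation.\<close>
  moreover have "q * U a = - r * (of_int d * a)" if "a \<in> wt d" "D a = 0" for a d
    using rel[of a] that by (simp add: wt_iff eq_neg_iff_add_eq_0)
  ultimately show ?thesis using that \<open>D q = 0\<close> \<open>q \<noteq> 0\<close> by blast
qed

section \<open>Prime highest weight vectors\<close>

lemma wt_unique: "x \<in> wt d \<Longrightarrow> x \<in> wt e \<Longrightarrow> x \<noteq> 0 \<Longrightarrow> d = e"
  using of_int_eq_0[of "d - e"] by (simp add: wt_iff)

lemma D_unit: "x dvd 1 \<Longrightarrow> x \<in> invariants"
  using unit_poly3 const3_invariant by metis

lemma highest_weight_factor:
  assumes "x * y \<in> wt d" "D (x * y) = 0" "x * y \<noteq> 0"
  obtains e where "x \<in> wt e" "y \<in> wt (d - e)" "D x = 0" "D y = 0" "e \<ge> 0" "d - e \<ge> 0"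
proof -
  have yx: "y * x \<in> wt d" "D (y * x) = 0" "y * x \<noteq> 0" using assms by (simp_all add: mult.commute)
  obtain e where e: "x \<in> wt e" using homogeneous_if_product assms by blast
  obtain e' where e': "y \<in> wt e'" using homogeneous_if_product yx by blast
  have "e + e' = d" using wt_unique[OF wt_mult[OF e e']] assms by blast
  then have e'': "y \<in> wt (d - e)" using e' by auto
  have "D x = 0" using LND_kernel_factorially_closed[OF rat D_LND] assms by blast
  moreover have "D y = 0" using LND_kernel_factorially_closed[OF rat D_LND] yx by blast
  moreover have "x \<noteq> 0" "y \<noteq> 0" using assms by auto
  ultimately show ?thesis using that e e'' highest_weight_nonneg by blast
qed

lemma exists_prime_highest_weight:
  assumes "x \<noteq> 0" "x \<in> wt d" "D x = 0" "d > 0"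
  shows "\<exists>g m. prime_elem g \<and> g \<in> wt m \<and> D g = 0 \<and> m > 0"
  using ufd assms
proof (induction x arbitrary: d rule: ufd_induct)
  case (unit u)
  then have "u \<in> wt 0" using D_unit invariants_wt_0 by blast
  then show ?case using wt_unique unit by fastforce
next
  case (prime \<pi> x)
  have "\<pi> * x \<noteq> 0" using prime by (auto simp: prime_elem_def)
  then obtain e where e: "\<pi> \<in> wt e" "x \<in> wt (d - e)" "D \<pi> = 0" "D x = 0" "e \<ge> 0" "d - e \<ge> 0"
    using highest_weight_factor prime.prems by blast
  show ?case
  proof (cases "e > 0")
    case True
    then show ?thesis using prime.hyps e by blast
  next
    case False
    then show ?thesis using prime.IH[of d] e prime.prems by simp
  qed
qed

text \<open>Multiplying the equations of \<open>weight_2_relation\<close> for \<open>g\<close> and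
  \<open>h\<close> crosswise removes \<open>q\<close> and \<open>r\<close> and leaves
  \<open>n h U g = m g U h\<close>. The prime \<open>g\<close> cannot divide \<open>U g\<close>,
  since then \<open>U g\<close> would vanish and \<open>g\<close> would have weight 0.\<close>

lemma prime_highest_weight_dvd:
  assumes g: "prime_elem g" "g \<in> wt m" "D g = 0" "m > 0"
    and h: "h \<in> wt n" "D h = 0" "n > 0"
  shows "g dvd h"
proof -
  obtain q r where "q \<in> wt 2" "D q = 0"
    and q: "q \<noteq> 0" "\<And>a d. a \<in> wt d \<Longrightarrow> D a = 0 \<Longrightarrow> q * U a = - r * (of_int d * a)"
    by (rule weight_2_relation) blast
  have "q * (of_int n * h * U g) = (of_int n * h) * (q * U g)" by (simp add: ac_simps)
  also have "\<dots> = (of_int m * g) * (q * U h)" using q(2) g h by (simp add: ac_simps)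
  also have "\<dots> = q * (of_int m * g * U h)" by (simp add: ac_simps)
  finally have eq: "of_int n * h * U g = of_int m * g * U h" using q(1) by simp
  obtain u :: "'r poly3" where u: "of_int n * u = 1" using int_inverse[of n] h(3) by auto
  have "(of_int n * u) * (h * U g) = u * (of_int n * h * U g)" by (simp add: ac_simps)
  also have "\<dots> = g * (of_int m * u * U h)" unfolding eq by (simp add: ac_simps)
  finally have "h * U g = g * (of_int m * u * U h)" unfolding u by simp
  then have "g dvd h * U g" by simp
  moreover have "\<not> g dvd U g"
  proof
    assume "g dvd U g"
    then have "U g = 0" by (rule LND_dvd_imp_0[OF rat U_LND])
    then have "g \<in> wt 0" using g(3) by (simp add: wt_zero_if_invariant)
    then have "m = 0" using wt_unique g by (metis prime_elem_not_zeroI)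
    then show False using g(4) by simp
  qed
  ultimately show ?thesis using g(1) prime_elem_dvd_multD by blast
qed

text \<open>Every prime factor is itself a highest weight vector. In weight 0 it is invariant;
  otherwise it and \<open>g\<close> divide each other, so it is \<open>g\<close> times an invariant
  unit.\<close>

lemma prime_highest_weight_generator:
  assumes g: "prime_elem g" "g \<in> wt m" "D g = 0" "m > 0"
    and x: "x \<noteq> 0" "x \<in> wt d" "D x = 0"
  shows "\<exists>c j. c \<in> invariants \<and> x = c * g ^ j \<and> d = int j * m"
  using ufd x
proof (induction x arbitrary: d rule: ufd_induct)
  case (unit u)
  then have "u \<in> invariants" by (simp add: D_unit)
  moreover from this have "d = 0" using wt_unique[OF unit(2) invariants_wt_0] unit(1) by force
  ultimately show ?case by (intro exI[of _ u] exI[of _ 0]) simp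
next
  case (prime \<pi> x)
  have "\<pi> * x \<noteq> 0" using prime by (auto simp: prime_elem_def)
  then obtain e where e: "\<pi> \<in> wt e" "x \<in> wt (d - e)" "D \<pi> = 0" "D x = 0" "e \<ge> 0" "d - e \<ge> 0"
    using highest_weight_factor prime.prems by blast
  then obtain c j where c: "c \<in> invariants" "x = c * g ^ j" "d - e = int j * m"
    using prime.IH by blast
  show ?case
  proof (cases "e = 0")
    case True
    then have "\<pi> \<in> invariants" using e highest_weight_0_invariant by blast
    then show ?thesis using c True
      by (intro exI[of _ "\<pi> * c"] exI[of _ j]) (auto intro: invariants_mult)
  next
    case False
    then have "g dvd \<pi>" using prime_highest_weight_dvd[OF g e(1,3)] e(5) by simp
    then obtain s where s: "\<pi> = g * s" by (elim dvdE)
    have "\<pi> dvd g" using prime_highest_weight_dvd[OF prime.hyps(1) e(1,3) _ g(2-4)] e(5) False by simp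
    then obtain t where "g = \<pi> * t" by (elim dvdE)
    then have "g * 1 = g * (s * t)" using s by (metis mult.assoc mult.right_neutral)
    then have st: "1 = s * t" using g(1) by (metis mult_cancel_left prime_elem_not_zeroI)
    have "s dvd 1" unfolding st by (rule dvd_triv_left)
    then have "s \<in> invariants" by (rule D_unit)
    moreover have "e = m"
    proof -
      have "\<pi> \<in> wt m" using wt_zero_mult[OF invariants_wt_0[OF \<open>s \<in> invariants\<close>] g(2)] s
        by (simp add: mult.commute)
      then show ?thesis using wt_unique[OF e(1)] prime.hyps(1) by (metis prime_elem_not_zeroI)
    qed
    ultimately show ?thesis using c s
      by (intro exI[of _ "s * c"] exI[of _ "Suc j"]) (auto intro: invariants_mult simp: algebra_simps)
  qed
qed

text \<open>A subring closed under \<open>U\<close> that contains \<open>ker D\<close> is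
  everything, and \<open>ker D\<close> consists of polynomials in \<open>g\<close> over the
  invariants.\<close>

lemma subring_generated_UNIV_if_U_closed:
  assumes inv: "invariants \<subseteq> subring_generated Y"
    and g: "prime_elem g" "g \<in> wt m" "D g = 0" "m > 0" "g \<in> subring_generated Y"
    and U_gen: "\<And>y. y \<in> Y \<Longrightarrow> U y \<in> subring_generated Y"
  shows "subring_generated Y = UNIV"
proof -
  let ?S = "subring_generated Y"
  have zero: "0 \<in> ?S" using inv by (auto simp: invariants_def D_simps U_simps)
  have one: "1 \<in> ?S" using inv by (auto simp: invariants_def D_simps U_simps)
  have pow: "g ^ j \<in> ?S" for j
    by (induction j) (auto intro: one g(5) subring_generated.mult)
  have hom: "x \<in> ?S" if x: "x \<in> wt d" "D x = 0" for x d
  proof (cases "x = 0")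
    case False
    then obtain c j where "c \<in> invariants" "x = c * g ^ j"
      using prime_highest_weight_generator[OF g(1-4) _ x] by blast
    then show ?thesis using inv pow by (auto intro: subring_generated.mult)
  qed (simp add: zero)
  have "b \<in> ?S" for b
  proof (induction b rule: U_closed_induct)
    case (kernel a)
    then show ?case by (induction rule: kernel_induct) (auto intro: hom subring_generated.add)
  next
    case (U a)
    then show ?case
    proof induction
      case (add p q)
      then show ?case by (simp add: U_simps subring_generated.add)
    next
      case (mult p q)
      then show ?case by (simp add: U_mult subring_generated.add subring_generated.mult)
    qed (rule U_gen)
  qed (rule subring_generated.add)
  then show ?thesis by blast
qed

text \<open>The vector \<open>q\<close> of weight 2 from \<open>weight_2_relation\<close> is an
  invariant times a power of \<open>g\<close>, so the weight of \<open>g\<close> divides 2.\<close>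

lemma exists_generator:
  obtains g m where "prime_elem g" "g \<in> wt m" "D g = 0" "m = 1 \<or> m = 2"
    "subring_generated (invariants \<union> {g, U g, U (U g)}) = UNIV"
    "m = 1 \<Longrightarrow> U (U g) = 0" "U (U (U g)) = 0"
proof -
  obtain q r where q: "q \<in> wt 2" "D q = 0" "q \<noteq> 0"
    and "\<And>a d. a \<in> wt d \<Longrightarrow> D a = 0 \<Longrightarrow> q * U a = - r * (of_int d * a)"
    by (rule weight_2_relation) blast
  obtain g m where g: "prime_elem g" "g \<in> wt m" "D g = 0" "m > 0"
    using exists_prime_highest_weight[of q 2] q by auto
  obtain c j where "q = c * g ^ j" "2 = int j * m"
    using prime_highest_weight_generator[OF g q(3,1,2)] by blast
  then have "m dvd 2" by (metis dvd_triv_right)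
  then have "m \<le> 2" by (rule zdvd_imp_le) simp
  then have m: "m = 1 \<or> m = 2" using g(4) by linarith
  have top1: "U (U g) = 0" if "m = 1" using U_funpow_top[of g 1] g that by (simp add: numeral_2_eq_2)
  have top: "U (U (U g)) = 0"
    using m
  proof
    assume "m = 1"
    then show ?thesis using top1 by (simp add: U_simps)
  next
    assume "m = 2"
    then show ?thesis using U_funpow_top[of g 2] g by (simp add: numeral_eq_Suc)
  qed
  have "subring_generated (invariants \<union> {g, U g, U (U g)}) = UNIV"
  proof (rule subring_generated_UNIV_if_U_closed[OF _ g])
    show "invariants \<subseteq> subring_generated (invariants \<union> {g, U g, U (U g)})"
      "g \<in> subring_generated (invariants \<union> {g, U g, U (U g)})"
      by (auto intro: subring_generated.base)
    fix y assume y: "y \<in> invariants \<union> {g, U g, U (U g)}"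
    have "0 \<in> invariants" by (simp add: invariants_def D_simps U_simps)
    then have "U y \<in> invariants \<union> {g, U g, U (U g)}"
      using y top by (auto simp: invariants_def)
    then show "U y \<in> subring_generated (invariants \<union> {g, U g, U (U g)})"
      by (rule subring_generated.base)
  qed
  then show ?thesis using that g m top1 top by blast
qed

text \<open>Without nonconstant invariants the ring would be generated by two elements, or by three elements
  with an algebraic relation, and all Jacobian determinants would vanish.\<close>

lemma exists_nonconstant_invariant: "\<exists>y. y \<in> invariants \<and> y \<notin> range const3"
proof (rule ccontr)
  assume "\<not> ?thesis"
  then have inv: "invariants \<subseteq> range const3" by blast
  obtain g m where g: "prime_elem g" "g \<in> wt m" "D g = 0" and m: "m = 1 \<or> m = 2"
    and gen: "subring_generated (invariants \<union> {g, U g, U (U g)}) = UNIV"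
    and top: "m = 1 \<Longrightarrow> U (U g) = 0" "U (U (U g)) = 0"
    by (rule exists_generator) blast
  define v where "v = U g"
  define w where "w = U v"
  have gen': "subring_generated (range const3 \<union> {g, v, w}) = UNIV"
    by (rule subring_generated_UNIV_trans[OF gen])
      (use inv in \<open>auto simp: v_def w_def intro!: subring_generated.base\<close>)
  have jac0: "jac g v w = 0"
    using m
  proof
    assume "m = 1"
    then have "w = const3 0" using top(1) by (simp add: v_def w_def)
    then show ?thesis by (simp only: jac_const)
  next
    assume "m = 2"
    then have "v * v - 2 * g * w \<in> invariants"
      using weight_2_triple(3)[of g] g(2,3) top(2) by (simp add: v_def w_def)
    then obtain r where "v * v - 2 * g * w = const3 r" using inv by blast
    then have "jac g v (v * v) = jac g v (2 * g * w + const3 r)" by (simp add: algebra_simps)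
    then have "2 * g * jac g v w = 0"
      using derivation_numeral[of "jac g v"] poly3_derivation_jac[of g v]
      by (simp add: jac_mult jac_add poly3_derivation_def)
    then show ?thesis using g(1) of_int_eq_0[of 2] by (simp add: prime_elem_def)
  qed
  have "(1 :: 'r poly3) \<in> {0}"
  proof (rule jac_in_ideal_if_generators[OF _ _ _ gen'])
    show "jac a b c \<in> {0}" if "a \<in> {g, v, w}" "b \<in> {g, v, w}" "c \<in> {g, v, w}" for a b c
      using that jac0 jac_swap[of g v w] jac_rotate[of g v w] jac_rotate[of v w g]
        jac_swap[of v w g] jac_swap[of w g v] by auto
  qed auto
  then show False by simp
qed

section \<open>The ring of invariants\<close>

lemma invariant_factor:
  assumes "x * y \<in> invariants" "x * y \<noteq> 0"
  shows "x \<in> invariants" "y \<in> invariants"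
proof -
  have yx: "y * x \<in> invariants" "y * x \<noteq> 0" using assms by (simp_all add: mult.commute)
  show "x \<in> invariants" "y \<in> invariants"
    using LND_kernel_factorially_closed[OF rat D_LND] LND_kernel_factorially_closed[OF rat U_LND]
      assms yx unfolding invariants_def by blast+
qed

text \<open>The four elements \<open>p\<close>, \<open>f\<close>, \<open>g\<close>,
  \<open>U g\<close> are dependent. Since \<open>D\<close> kills all of them but \<open>U g\<close>,
  and \<open>U\<close> kills \<open>p\<close> and \<open>f\<close> but not \<open>g\<close>,
  \<open>power_independent\<close> splits off the powers of \<open>U g\<close> and then those of
  \<open>g\<close>; what remains relates \<open>p\<close> and \<open>f\<close>.\<close>

lemma invariants_algebraically_dependent:
  assumes "p \<in> invariants" "f \<in> invariants"
  shows "\<exists>n c. (\<exists>a<n. \<exists>b<n. c a b \<noteq> 0) \<and> (\<Sum>b<n. (\<Sum>a<n. const3 (c a b) * p ^ a) * f ^ b) = 0"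
proof -
  obtain g m where g: "prime_elem g" "g \<in> wt m" "D g = 0" and m: "m = 1 \<or> m = 2"
    and "subring_generated (invariants \<union> {g, U g, U (U g)}) = UNIV"
    and "m = 1 \<Longrightarrow> U (U g) = 0" "U (U (U g)) = 0"
    by (rule exists_generator) blast
  define v where "v = U g"
  have "g \<noteq> 0" using g by auto
  have Dv: "D v \<noteq> 0"
  proof -
    have "D v = of_int m * g" using g by (simp add: v_def D_U wt_iff U_simps)
    then show ?thesis using m \<open>g \<noteq> 0\<close> of_int_eq_0[of m] by auto
  qed
  then have Ug: "U g \<noteq> 0" by (auto simp: v_def D_simps)
  obtain n c where c: "\<exists>a<n. \<exists>b<n. \<exists>d<n. \<exists>e<n. c a b d e \<noteq> 0"
    and zero: "(\<Sum>e<n. \<Sum>d<n. \<Sum>b<n. \<Sum>a<n. const3 (c a b d e) * (p ^ a * f ^ b * g ^ d * v ^ e)) = 0"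
    using four_algebraically_dependent[of p f g v] by blast
  define \<beta> where "\<beta> d e = (\<Sum>b<n. (\<Sum>a<n. const3 (c a b d e) * p ^ a) * f ^ b)" for d e
  define \<alpha> where "\<alpha> e = (\<Sum>d<n. \<beta> d e * g ^ d)" for e
  have inv_pow: "x ^ k \<in> invariants" if "x \<in> invariants" for x k
    using that by (induction k) (auto simp: invariants_def D_simps U_simps D_mult U_mult)
  have inv_sum: "(\<Sum>i<k. h i) \<in> invariants" if "\<And>i. h i \<in> invariants" for k :: nat and h
    using that by (induction k) (auto simp: invariants_def D_simps U_simps)
  have \<beta>: "\<beta> d e \<in> invariants" for d e
    unfolding \<beta>_def by (intro inv_sum invariants_mult inv_pow const3_invariant assms)
  have D\<beta>: "D (\<beta> d e) = 0" "U (\<beta> d e) = 0" for d e using \<beta> by (simp_all add: invariants_def)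
  have Dg: "D (g ^ d) = 0" for d using g(3) by (induction d) (simp_all add: D_simps D_mult)
  have D\<alpha>: "D (\<alpha> e) = 0" for e
    unfolding \<alpha>_def by (simp add: derivation_sum[OF D_der] D_mult Dg D\<beta>)
  have "(\<Sum>e<n. \<alpha> e * v ^ e) = 0"
    unfolding zero[symmetric] \<alpha>_def \<beta>_def sum_distrib_right by (simp add: mult.assoc)
  then have \<alpha>0: "\<alpha> e = 0" if "e < n" for e
    using power_independent[OF rat D_der Dv, of \<alpha> n e] D\<alpha> that by blast
  have \<beta>0: "\<beta> d e = 0" if "d < n" "e < n" for d e
    using power_independent[OF rat U_der Ug, of "\<lambda>d. \<beta> d e" n d] D\<beta> \<alpha>0 that unfolding \<alpha>_def by blast
  obtain a b d e where "a < n" "b < n" "d < n" "e < n" "c a b d e \<noteq> 0" using c by blast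
  then show ?thesis using \<beta>0[of d e] unfolding \<beta>_def
    by (intro exI[of _ n] exI[of _ "\<lambda>a b. c a b d e"]) blast
qed

text \<open>In a relation between \<open>p\<close> and \<open>f\<close> take the lowest power of
  \<open>f\<close> with a formally nonzero coefficient: \<open>f\<close> divides this polynomial in
  \<open>p\<close> over \<open>R\<close>. Its constant term is read off at the origin and is 0. If
  \<open>f\<close> did not divide \<open>p\<close>, a factor \<open>p\<close> could be cancelled,
  and repeating this would kill all its coefficients.\<close>

lemma prime_invariant_dvd:
  assumes f: "prime_elem f" "f \<in> invariants" "eval0 f = 0"
    and p: "p \<in> invariants" "eval0 p = 0"
  shows "f dvd p"
proof -
  obtain n c where c: "\<exists>a<n. \<exists>b<n. c a b \<noteq> 0"
    and zero: "(\<Sum>b<n. (\<Sum>a<n. const3 (c a b) * p ^ a) * f ^ b) = 0"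
    using invariants_algebraically_dependent[OF p(1) f(2)] by blast
  have lowest: "x dvd \<gamma> i" if "(\<Sum>b<n. \<gamma> b * x ^ b) = 0" "x \<noteq> 0" "i < n" "\<And>j. j < i \<Longrightarrow> \<gamma> j = 0"
    for x :: "'r poly3" and \<gamma> and n i :: nat
    using that
  proof (induction i arbitrary: n \<gamma>)
    case 0
    then obtain k where k: "n = Suc k" by (cases n) auto
    have "\<gamma> 0 + (\<Sum>b<k. \<gamma> (Suc b) * x ^ Suc b) = 0"
      using 0(1) unfolding k by (subst (asm) sum.lessThan_Suc_shift) simp
    then have "\<gamma> 0 = x * (- (\<Sum>b<k. \<gamma> (Suc b) * x ^ b))"
      by (simp add: eq_neg_iff_add_eq_0 sum_distrib_left ac_simps)
    then show ?case by (metis dvd_triv_left)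
  next
    case (Suc i)
    then obtain k where k: "n = Suc k" by (cases n) auto
    have "\<gamma> 0 + (\<Sum>b<k. \<gamma> (Suc b) * x ^ Suc b) = 0"
      using Suc.prems(1) unfolding k by (subst (asm) sum.lessThan_Suc_shift) simp
    moreover have "\<gamma> 0 = 0" using Suc.prems(4) by simp
    moreover have "(\<Sum>b<k. \<gamma> (Suc b) * x ^ Suc b) = x * (\<Sum>b<k. \<gamma> (Suc b) * x ^ b)"
      by (simp add: sum_distrib_left ac_simps)
    ultimately have "(\<Sum>b<k. \<gamma> (Suc b) * x ^ b) = 0" using Suc.prems(2) by simp
    then show ?case using Suc.IH[of "\<lambda>b. \<gamma> (Suc b)" k] Suc.prems k by auto
  qed
  define \<gamma> where "\<gamma> b = (\<Sum>a<n. const3 (c a b) * p ^ a)" for b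
  define i where "i = (LEAST b. b < n \<and> (\<exists>a<n. c a b \<noteq> 0))"
  have "\<exists>b. b < n \<and> (\<exists>a<n. c a b \<noteq> 0)" using c by blast
  then have "i < n \<and> (\<exists>a<n. c a i \<noteq> 0)" unfolding i_def by (rule LeastI_ex)
  then have i: "i < n" "\<exists>a<n. c a i \<noteq> 0" by blast+
  have "\<gamma> j = 0" if "j < i" for j
  proof -
    have "c a j = 0" if "a < n" for a
      using not_less_Least[OF \<open>j < i\<close>[unfolded i_def]] \<open>j < i\<close> i(1) that by auto
    then show ?thesis by (simp add: \<gamma>_def)
  qed
  then have dvd: "f dvd \<gamma> i"
    using lowest[of \<gamma> f n i] zero f(1) i(1) by (auto simp: \<gamma>_def[symmetric])
  show ?thesis
  proof (rule ccontr)
    assume not_dvd: "\<not> f dvd p"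
    have "c a i = 0" if "a < n" for a
    proof -
      have "f dvd (\<Sum>a<n. const3 (c a i) * p ^ a) \<Longrightarrow> \<forall>a<n. c a i = 0" for n and c :: "nat \<Rightarrow> nat \<Rightarrow> 'r" and i :: nat
      proof (induction n arbitrary: c)
        case (Suc n)
        have split: "(\<Sum>a<Suc n. const3 (c a i) * p ^ a)
            = const3 (c 0 i) + p * (\<Sum>a<n. const3 (c (Suc a) i) * p ^ a)"
          by (subst sum.lessThan_Suc_shift) (simp add: sum_distrib_left ac_simps)
        obtain s where s: "const3 (c 0 i) + p * (\<Sum>a<n. const3 (c (Suc a) i) * p ^ a) = f * s"
          using Suc.prems unfolding split by (elim dvdE)
        have "eval0 (const3 (c 0 i) + p * (\<Sum>a<n. const3 (c (Suc a) i) * p ^ a)) = eval0 (f * s)"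
          unfolding s ..
        then have c0: "c 0 i = 0" using f(3) p(2) by simp
        then have "f dvd p * (\<Sum>a<n. const3 (c (Suc a) i) * p ^ a)" using s by simp
        then have "f dvd (\<Sum>a<n. const3 (c (Suc a) i) * p ^ a)"
          using f(1) not_dvd prime_elem_dvd_multD by blast
        then have "\<forall>a<n. c (Suc a) i = 0" using Suc.IH[of "\<lambda>a. c (Suc a)"] by blast
        then show ?case using c0 by (metis less_Suc_eq_0_disj)
      qed simp
      then show ?thesis using dvd that unfolding \<gamma>_def by blast
    qed
    then show False using i(2) by blast
  qed
qed

text \<open>Shift a nonconstant invariant to vanish at the origin and take for \<open>f\<close> a
  prime factor that vanishes there; factors of invariants are invariant. Any invariant minus its
  value at the origin is \<open>f\<close> times an invariant of smaller \<open>degree3\<close>,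
  which yields \<open>P\<close> recursively.\<close>

lemma exists_invariant_generator:
  obtains f where "f \<in> invariants" "prime_elem f" "eval0 f = 0"
    "\<And>p. p \<in> invariants \<Longrightarrow> \<exists>P. p = poly (map_poly const3 P) f"
proof -
  obtain y where y: "y \<in> invariants" "y \<notin> range const3" using exists_nonconstant_invariant by blast
  define y1 where "y1 = y - const3 (eval0 y)"
  have y1: "y1 \<in> invariants" "eval0 y1 = 0"
    using y by (simp_all add: y1_def invariants_diff const3_invariant)
  have "y1 \<noteq> 0" using y by (auto simp: y1_def)
  have "\<exists>f. prime_elem f \<and> f dvd x \<and> eval0 f = 0" if "x \<noteq> 0" "eval0 x = 0" for x :: "'r poly3"
    using ufd that
  proof (induction x rule: ufd_induct)
    case (unit u)
    then obtain r s where "u = const3 r" "r * s = 1" using unit_poly3 by metis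
    then show ?case using unit by simp
  next
    case (prime p x)
    then have "eval0 p = 0 \<or> eval0 x = 0" by simp
    then show ?case using prime by (metis dvd_mult dvd_triv_left)
  qed
  then obtain f where f: "prime_elem f" "f dvd y1" "eval0 f = 0" using \<open>y1 \<noteq> 0\<close> y1(2) by blast
  then obtain z where z: "y1 = f * z" by (elim dvdE)
  have f_inv: "f \<in> invariants" using invariant_factor(1)[of f z] y1 z \<open>y1 \<noteq> 0\<close> by simp
  have "f \<noteq> 0" using f by auto
  have deg_f: "degree3 f > 0"
  proof (rule ccontr)
    assume "\<not> ?thesis"
    then obtain r where "f = const3 r" using degree3_eq_0[of f] by auto
    then show False using f \<open>f \<noteq> 0\<close> by simp
  qed
  have "\<exists>P. p = poly (map_poly const3 P) f" if "p \<in> invariants" for p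
    using that
  proof (induction "degree3 p" arbitrary: p rule: less_induct)
    case less
    define p1 where "p1 = p + const3 (- eval0 p)"
    have p1: "p1 \<in> invariants" "eval0 p1 = 0"
      using less.prems by (simp_all add: p1_def invariants_add const3_invariant)
    have p: "p = const3 (eval0 p) + p1" by (simp add: p1_def const3_minus)
    show ?case
    proof (cases "p1 = 0")
      case True
      then show ?thesis using p by (intro exI[of _ "[:eval0 p:]"]) (simp add: map_poly_pCons)
    next
      case False
      have "f dvd p1" using prime_invariant_dvd f f_inv p1 by blast
      then obtain h where h: "p1 = f * h" by (elim dvdE)
      then have "h \<noteq> 0" using False by auto
      have "h \<in> invariants" using invariant_factor(2)[of f h] p1 h False by simp
      moreover have "degree3 h < degree3 p"
      proof -
        have "degree3 p = degree3 p1" unfolding p1_def by (rule degree3_add_const[symmetric])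
        also have "\<dots> = degree3 f + degree3 h" unfolding h using \<open>f \<noteq> 0\<close> \<open>h \<noteq> 0\<close> by (rule degree3_mult)
        finally show ?thesis using deg_f by simp
      qed
      ultimately obtain H where "h = poly (map_poly const3 H) f" using less.hyps by blast
      then have "p = poly (map_poly const3 (pCons (eval0 p) H)) f"
        using p h by (simp add: map_poly_pCons)
      then show ?thesis by blast
    qed
  qed
  then show ?thesis using that f_inv f by blast
qed

section \<open>Coordinates in the case of weight 1\<close>

lemma weight_1_equivalent:
  assumes g: "g \<in> wt 1" "D g = 0" "U (U g) = 0"
    and gen: "subring_generated (invariants \<union> {g, U g, U (U g)}) = UNIV"
  shows "equivalent_over (range const3) (D, U) ((\<lambda>f. x0 * d1 f), (\<lambda>f. x1 * d0 f))"
proof -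
  obtain f where f: "f \<in> invariants" "\<And>p. p \<in> invariants \<Longrightarrow> \<exists>P. p = poly (map_poly const3 P) f"
    by (rule exists_invariant_generator) blast
  define v where "v = U g"
  have Dv: "D v = g" using g by (simp add: v_def D_U wt_iff U_simps)
  have Df: "D f = 0" "U f = 0" using f(1) by (simp_all add: invariants_def)
  let ?S = "subring_generated (range const3 \<union> {g, v, f})"
  have "subring_generated (range const3 \<union> {g, v, f}) = UNIV"
  proof (rule subring_generated_UNIV_trans[OF gen])
    have "poly (map_poly const3 P) f \<in> ?S" for P
    proof (induction P)
      case 0
      have "const3 0 \<in> ?S" by (intro subring_generated.base) blast
      then show ?case by simp
    next
      case (pCons a P)
      have "const3 a + f * poly (map_poly const3 P) f \<in> ?S"
        using pCons.IH by (intro subring_generated.add subring_generated.mult) (auto intro: subring_generated.base)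
      then show ?case by (simp add: map_poly_pCons)
    qed
    then have "invariants \<subseteq> ?S" using f(2) by blast
    moreover have "U (U g) \<in> ?S"
      unfolding g(3) const3_0[symmetric] by (intro subring_generated.base) blast
    ultimately show "invariants \<union> {g, U g, U (U g)} \<subseteq> ?S"
      by (auto simp: v_def intro: subring_generated.base)
  qed
  then have bij: "bij (subst3 g v f)" by (rule bij_subst3[OF rat_R])
  show ?thesis
  proof (rule equivalent_over_subst3[OF bij])
    show "D (subst3 g v f h) = subst3 g v f (x0 * d1 h)" for h
      by (simp add: derivation_subst3[OF poly3_D] subst3_mult g Dv Df)
    show "U (subst3 g v f h) = subst3 g v f (x1 * d0 h)" for h
      using g(3) by (simp add: derivation_subst3[OF poly3_U] subst3_mult Df flip: v_def)
  qed
qed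

end

section \<open>Highest weight 2\<close>

lemma derivation_eval_poly:
  assumes "poly3_derivation X"
  shows "X (poly (map_poly const3 P) f) = poly (map_poly const3 (pderiv P)) f * X f"
proof -
  have X: "derivation X" "\<And>r. X (const3 r) = 0" using assms by (auto simp: poly3_derivation_def)
  have add: "map_poly const3 (p + q) = map_poly const3 p + map_poly const3 q" for p q :: "'a poly"
    by (simp add: poly_eq_iff coeff_map_poly const3_add)
  show ?thesis
    by (induction P)
      (simp_all add: map_poly_pCons derivation_0[OF X(1)] derivation_add[OF X(1)] derivation_mult[OF X(1)] X(2)
        pderiv_pCons add algebra_simps)
qed

text \<open>The matrix on the right is the product of the coefficient matrix of the fields and the
  Jacobian matrix.\<close>

lemma vdet_jac:
  assumes "poly3_derivation X" "poly3_derivation Y" "poly3_derivation Z"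
  shows "vdet X Y Z * jac a b c = det3 (X a) (X b) (X c) (Y a) (Y b) (Y c) (Z a) (Z b) (Z c)"
  unfolding poly3_derivation_eq[OF assms(1), of a] poly3_derivation_eq[OF assms(1), of b]
    poly3_derivation_eq[OF assms(1), of c] poly3_derivation_eq[OF assms(2), of a]
    poly3_derivation_eq[OF assms(2), of b] poly3_derivation_eq[OF assms(2), of c]
    poly3_derivation_eq[OF assms(3), of a] poly3_derivation_eq[OF assms(3), of b]
    poly3_derivation_eq[OF assms(3), of c]
  by (simp add: vdet_def jac_def det3_def algebra_simps)

lemma coeff_mult_top:
  assumes "degree p \<le> m" "degree q \<le> n"
  shows "coeff (p * q) (m + n) = coeff p m * coeff q n"
proof -
  have zero: "coeff p i * coeff q (m + n - i) = 0" if "i \<noteq> m" for i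
  proof (cases "i > m")
    case True
    then show ?thesis using assms(1) by (simp add: coeff_eq_0)
  next
    case False
    then have "m + n - i > n" using that by simp
    then show ?thesis using assms(2) by (simp add: coeff_eq_0)
  qed
  have "coeff (p * q) (m + n) = (\<Sum>i\<le>m + n. if i = m then coeff p m * coeff q n else 0)"
    unfolding coeff_mult by (rule sum.cong) (use zero in auto)
  then show ?thesis by simp
qed

text \<open>Let \<open>N\<close> and \<open>n\<close> be the degrees of \<open>P\<close> and
  \<open>\<beta>\<close>. The right side has coefficient \<open>N + 2 n\<close> times the two
  leading coefficients in degree \<open>N + n - 1\<close>, which forces \<open>n = 1\<close>. Then
  \<open>P' \<beta>\<close> is a constant times \<open>P\<close>, so \<open>P\<close> divides
  \<open>\<beta>\<close> by coprimality and \<open>N = 1\<close>. Comparing leading coefficients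
  makes that of \<open>P\<close> a divisor of 2.\<close>

lemma linear_if_differential_equation:
  fixes P :: "'a::idom poly"
  assumes rat: "rational_algebra TYPE('a)"
    and ode: "2 * P = pderiv P * \<beta> + 2 * P * pderiv \<beta>"
    and separable: "P * C + pderiv P * Q = 1"
    and deg: "degree P > 0"
  shows "degree P = 1 \<and> lead_coeff P dvd 1"
proof -
  have nat0: "of_nat n = (0::'a) \<longleftrightarrow> n = 0" for n using rational_algebra_of_nat_eq_0[OF rat] .
  have two: "(2::'a) \<noteq> 0" using nat0[of 2] by simp
  have "P \<noteq> 0" using deg by auto
  define N where "N = degree P"
  define n where "n = degree \<beta>"
  have top_pderiv: "coeff (pderiv p) (degree p - 1) = of_nat (degree p) * lead_coeff p" for p :: "'a poly"
    by (cases "degree p") (simp_all add: coeff_pderiv coeff_eq_0)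
  have deg_pderiv: "degree (pderiv p) \<le> degree p - 1" for p :: "'a poly"
    by (rule degree_le) (auto simp: coeff_pderiv intro: coeff_eq_0)
  have "(2 :: 'a poly) \<noteq> 0" using two by (simp add: numeral_poly)
  then have "\<beta> \<noteq> 0" using ode \<open>P \<noteq> 0\<close> by auto
  have "n \<noteq> 0"
  proof
    assume "n = 0"
    then obtain b where b: "\<beta> = [:b:]" by (auto simp: n_def elim: degree_eq_zeroE)
    have "coeff (2 * P) N = coeff (pderiv P * \<beta>) N" using ode b by simp
    also have "\<dots> = 0"
      using deg_pderiv[of P] deg unfolding N_def b by (simp add: coeff_eq_0)
    finally have "2 * lead_coeff P = 0"
      unfolding N_def by (simp add: numeral_poly)
    then show False using two \<open>P \<noteq> 0\<close> by simp
  qed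
  have lead: "coeff (pderiv P * \<beta> + 2 * P * pderiv \<beta>) (N + n - 1)
      = of_nat (N + 2 * n) * (lead_coeff P * lead_coeff \<beta>)"
  proof -
    have "coeff (pderiv P * \<beta>) (N - 1 + n) = coeff (pderiv P) (N - 1) * coeff \<beta> n"
      using deg_pderiv[of P] unfolding N_def n_def by (intro coeff_mult_top) simp_all
    moreover have "coeff (2 * P * pderiv \<beta>) (N + (n - 1)) = coeff (2 * P) N * coeff (pderiv \<beta>) (n - 1)"
      using deg_pderiv[of \<beta>] unfolding N_def n_def
      by (intro coeff_mult_top) (simp_all add: numeral_poly)
    moreover have "coeff (2 * P) N = 2 * lead_coeff P" by (simp add: N_def numeral_poly)
    moreover have "N - 1 + n = N + n - 1" "N + (n - 1) = N + n - 1"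
      using deg \<open>n \<noteq> 0\<close> by (auto simp: N_def)
    ultimately show ?thesis using top_pderiv[of P] top_pderiv[of \<beta>]
      by (simp add: N_def[symmetric] n_def[symmetric] algebra_simps)
  qed
  have "n = 1"
  proof (rule ccontr)
    assume "n \<noteq> 1"
    then have "N < N + n - 1" using \<open>n \<noteq> 0\<close> by simp
    then have "coeff (2 * P) (N + n - 1) = 0" by (simp add: N_def numeral_poly coeff_eq_0)
    then have "of_nat (N + 2 * n) * (lead_coeff P * lead_coeff \<beta>) = 0" using lead ode by simp
    then show False using nat0[of "N + 2 * n"] \<open>n \<noteq> 0\<close> \<open>P \<noteq> 0\<close> \<open>\<beta> \<noteq> 0\<close> by (simp del: of_nat_add of_nat_mult)
  qed
  define b where "b = lead_coeff \<beta>"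
  have beta': "pderiv \<beta> = [:b:]"
    using \<open>n = 1\<close> top_pderiv[of \<beta>] deg_pderiv[of \<beta>]
    by (intro poly_eqI) (auto simp: b_def n_def coeff_pCons coeff_eq_0 split: nat.split)
  have eq: "pderiv P * \<beta> = P * [:2 - 2 * b:]"
  proof -
    define B where "B = [:b:]"
    have "[:2 - 2 * b:] = 2 - 2 * B" by (simp add: B_def numeral_poly)
    moreover have "pderiv P * \<beta> = P * (2 - 2 * B)"
      using ode unfolding beta' B_def[symmetric] by (simp add: algebra_simps)
    ultimately show ?thesis by simp
  qed
  have "\<beta> = P * (C * \<beta>) + (pderiv P * \<beta>) * Q"
  proof -
    have "(P * C + pderiv P * Q) * \<beta> = P * (C * \<beta>) + (pderiv P * \<beta>) * Q" by (simp only: algebra_simps)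
    then show ?thesis unfolding separable by simp
  qed
  also have "\<dots> = P * (C * \<beta> + [:2 - 2 * b:] * Q)" unfolding eq by (simp only: algebra_simps)
  finally obtain K where K: "\<beta> = P * K" by blast
  then have "K \<noteq> 0" using \<open>\<beta> \<noteq> 0\<close> by auto
  then have "N + degree K = 1" using K \<open>n = 1\<close> \<open>P \<noteq> 0\<close> by (simp add: N_def n_def degree_mult_eq)
  then have "N = 1" "degree K = 0" using deg unfolding N_def by auto
  have "coeff (2 * P) 1 = of_nat (1 + 2 * 1) * (lead_coeff P * lead_coeff \<beta>)"
    using lead ode \<open>N = 1\<close> \<open>n = 1\<close> by simp
  then have "lead_coeff P * 2 = lead_coeff P * (3 * lead_coeff \<beta>)"
    using \<open>N = 1\<close> by (simp add: N_def numeral_poly algebra_simps)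
  then have "2 = 3 * lead_coeff \<beta>" using \<open>P \<noteq> 0\<close> by (metis mult_cancel_left leading_coeff_0_iff)
  then have "2 = lead_coeff P * (3 * lead_coeff K)" using K by (simp add: lead_coeff_mult ac_simps)
  then have "lead_coeff P dvd of_nat 2" by (metis dvd_triv_left of_nat_numeral)
  moreover have "(of_nat 2 :: 'a) dvd 1" using rat unfolding rational_algebra_def by (metis zero_less_numeral)
  ultimately show ?thesis using \<open>N = 1\<close> dvd_trans unfolding N_def by blast
qed

locale weight_2_pair = fundamental3 D U E
  for D U E :: "'r::idom poly3 \<Rightarrow> 'r poly3" +
  fixes f g v w :: "'r poly3" and P :: "'r poly"
  assumes g_prime: "prime_elem g" and wt_g: "g \<in> wt 2" and Dg: "D g = 0" and Ug: "U g = v"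
    and Uv: "U v = w" and Uw: "U w = 0"
    and gen: "subring_generated (invariants \<union> {g, U g, U (U g)}) = UNIV"
    and f_inv: "f \<in> invariants" and f_prime: "prime_elem f" and f_0: "eval0 f = 0"
    and f_gen: "\<And>p. p \<in> invariants \<Longrightarrow> \<exists>P. p = poly (map_poly const3 P) f"
    and P: "v * v - 2 * g * w = poly (map_poly const3 P) f"
begin

definition ev :: "'r poly \<Rightarrow> 'r poly3" where "ev p = poly (map_poly const3 p) f"

lemma ev_ring: "ev (p + q) = ev p + ev q" "ev (p * q) = ev p * ev q" "ev 1 = 1" "ev 0 = 0"
  using ring_morphism_eval[OF ring_morphism_const3, of f] ring_morphism_0
  unfolding ev_def ring_morphism_def by auto

lemma ev_pCons: "ev (pCons a p) = const3 a + f * ev p"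
  by (simp add: ev_def map_poly_pCons)

lemma ev_const: "ev [:a:] = const3 a"
  by (simp add: ev_pCons ev_ring)

text \<open>\<open>f\<close> is transcendental over \<open>R\<close>: it vanishes at the origin,
  which exposes the constant coefficient, and is then cancelled.\<close>

lemma ev_eq_0: "ev p = 0 \<Longrightarrow> p = 0"
proof (induction p)
  case (pCons a p)
  have "eval0 (const3 a + f * ev p) = eval0 0" using pCons.prems by (simp add: ev_pCons)
  then have "a = 0" using f_0 by (simp add: eval0_def[of 0])
  then have "f * ev p = 0" using pCons.prems by (simp add: ev_pCons)
  then have "ev p = 0" using f_prime by (simp add: prime_elem_def)
  then show ?case using pCons.IH \<open>a = 0\<close> by simp
qed simp

lemma ev_inject: "ev p = ev q \<longleftrightarrow> p = q"
proof
  assume "ev p = ev q"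
  then have "ev (p + [:-1:] * q) = 0"
    unfolding ev_ring ev_const const3_minus const3_1 by simp
  then have "p + [:-1:] * q = 0" by (rule ev_eq_0)
  then show "p = q" by simp
qed simp

lemma derivation_ev: "poly3_derivation X \<Longrightarrow> X (ev p) = ev (pderiv p) * X f"
  unfolding ev_def by (rule derivation_eval_poly)

lemma f_const: "D f = 0" "U f = 0" "E f = 0"
  using f_inv by (simp_all add: invariants_def E_eq D_simps U_simps)

lemma ev_inv: "ev p \<in> invariants"
  using derivation_ev[OF poly3_D] derivation_ev[OF poly3_U] f_const by (simp add: invariants_def)

lemma relation: "v * v - 2 * g * w = ev P"
  using P by (simp add: ev_def)

lemma wts: "v \<in> wt 0" "w \<in> wt (-2)"
  using wt_U[OF wt_g] wt_U[of v 0] Ug Uv by simp_all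

lemma E_gvw: "E g = 2 * g" "E v = 0" "E w = - (2 * w)"
  using wt_g wts by (simp_all add: wt_iff)

lemma Dv: "D v = 2 * g"
  using weight_2_triple(1)[OF wt_g Dg] by (simp add: Ug Uv Uw)

lemma Dw: "D w = 2 * v"
  using weight_2_triple(2)[OF wt_g Dg] by (simp add: Ug Uv Uw)

lemma two_nonzero: "(2 :: 'r poly3) \<noteq> 0"
  using of_int_eq_0[of 2] by simp

lemma generators: "subring_generated (range const3 \<union> {f, g, v, w}) = UNIV"
proof (rule subring_generated_UNIV_trans[OF gen])
  let ?S = "subring_generated (range const3 \<union> {f, g, v, w})"
  have "ev p \<in> ?S" for p
  proof (induction p)
    case 0
    have "const3 0 \<in> ?S" by (intro subring_generated.base) blast
    then show ?case by (simp add: ev_ring)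
  next
    case (pCons a p)
    then show ?case unfolding ev_pCons
      by (intro subring_generated.add subring_generated.mult) (auto intro: subring_generated.base)
  qed
  then have "invariants \<subseteq> ?S" using f_gen unfolding ev_def by blast
  then show "invariants \<union> {g, U g, U (U g)} \<subseteq> ?S"
    by (auto simp: Ug Uv intro: subring_generated.base)
qed

lemma derivation_eqI:
  assumes "poly3_derivation X" "poly3_derivation Y"
    and "X f = Y f" "X g = Y g" "X v = Y v" "X w = Y w"
  shows "X h = Y h"
proof -
  have "h \<in> subring_generated (range const3 \<union> {f, g, v, w})" using generators by simp
  then show ?thesis
  proof induction
    case (base y)
    then show ?case using assms by (auto simp: poly3_derivation_def)
  next
    case (add p q)
    then show ?case using assms(1,2) by (simp add: poly3_derivation_def derivation_add)
  next
    case (mult p q)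
    then show ?case using assms(1,2) by (simp add: poly3_derivation_def derivation_mult)
  qed
qed

section \<open>The equation \<open>v^2 - 2 g w = P(f)\<close> and its minors\<close>

lemma derivation_relation:
  assumes "poly3_derivation X"
  shows "ev (pderiv P) * X f = 2 * v * X v - 2 * g * X w - 2 * w * X g"
proof -
  have X: "derivation X" using assms by (simp add: poly3_derivation_def)
  have "ev (pderiv P) * X f = X (v * v - 2 * g * w)"
    unfolding relation by (simp add: derivation_ev[OF assms])
  also have "\<dots> = 2 * v * X v - 2 * g * X w - 2 * w * X g"
    by (simp add: derivation_diff[OF X] derivation_mult[OF X] derivation_numeral[OF X] algebra_simps)
  finally show ?thesis .
qed

lemma g_not_dvd_v: "\<not> g dvd v"
proof
  assume "g dvd v"
  then have "U g = 0" using LND_dvd_imp_0[OF rat U_LND, of g] Ug by simp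
  then have "g \<in> wt 0" using Dg by (simp add: wt_zero_if_invariant)
  then show False using wt_unique[OF wt_g] g_prime by force
qed

lemma v_nonzero: "v \<noteq> 0"
  using g_not_dvd_v by auto

lemma g_nonzero: "g \<noteq> 0"
  using g_prime by auto

lemma P_nonzero: "P \<noteq> 0"
proof
  assume "P = 0"
  then have "v * v = g * (2 * w)" using relation by (simp add: ev_ring ac_simps)
  then have "g dvd v * v" by simp
  then show False using g_prime g_not_dvd_v prime_elem_dvd_multD by blast
qed

definition half :: 'r where "half = (SOME h. 2 * h = 1)"

lemma half: "2 * half = 1"
proof -
  have "\<exists>h::'r. 2 * h = 1"
    using rational_algebra_of_int_inverse[OF rat_R, of 2] by (metis of_int_numeral zero_neq_numeral)
  then show ?thesis unfolding half_def by (rule someI_ex)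
qed

lemma two_const3: "2 = const3 2"
  using const3_add[of 1 1] by simp

lemma const3_half: "2 * const3 half = 1"
  unfolding two_const3 const3_mult[symmetric] half by simp

text \<open>Four functions with one relation: up to sign their 3x3 minors are proportional to the
  partial derivatives of \<open>v^2 - 2 g w - P(f)\<close>. The factor \<open>\<alpha>\<close>
  exists in \<open>B\<close> because \<open>g\<close> is prime and does not divide
  \<open>v\<close>.\<close>

lemma minors:
  obtains \<alpha> where "jac f g v = 2 * \<alpha> * g" "jac f g w = 2 * \<alpha> * v" "jac f v w = 2 * \<alpha> * w"
    "jac g v w = - \<alpha> * ev (pderiv P)"
proof -
  have "2 * (v * jac f g v) = 2 * (g * jac f g w)"
    using derivation_relation[OF poly3_derivation_jac[of f g]] by (simp add: ac_simps)
  then have eq: "v * jac f g v = g * jac f g w" using two_nonzero by simp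
  then have "g dvd v * jac f g v" by simp
  then have "g dvd jac f g v" using g_prime g_not_dvd_v prime_elem_dvd_multD by blast
  then obtain s where s: "jac f g v = g * s" by (elim dvdE)
  define \<alpha> where "\<alpha> = const3 half * s"
  have "2 * \<alpha> = (2 * const3 half) * s" by (simp only: \<alpha>_def mult.assoc)
  then have \<alpha>: "s = 2 * \<alpha>" unfolding const3_half by simp
  have 1: "jac f g v = 2 * \<alpha> * g" using s \<alpha> by (simp add: ac_simps)
  have "g * (2 * \<alpha> * v) = g * jac f g w" using eq 1 by (simp add: ac_simps)
  then have 2: "jac f g w = 2 * \<alpha> * v" using g_nonzero by (metis mult_cancel_left)
  have "2 * (v * jac f w v) = 2 * (w * jac f w g)"
    using derivation_relation[OF poly3_derivation_jac[of f w]] by (simp add: ac_simps)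
  then have "v * jac f w v = w * jac f w g" using two_nonzero by simp
  also have "\<dots> = v * (- (2 * \<alpha> * w))" using 2 jac_swap(2)[of f w g] by (simp add: ac_simps)
  finally have "jac f w v = - (2 * \<alpha> * w)" using v_nonzero by (metis mult_cancel_left)
  then have 3: "jac f v w = 2 * \<alpha> * w" using jac_swap(2)[of f v w] by simp
  have "ev (pderiv P) * jac g v f = - (2 * g * jac g v w)"
    using derivation_relation[OF poly3_derivation_jac[of g v]] by simp
  then have "ev (pderiv P) * (2 * \<alpha> * g) = - (2 * g * jac g v w)"
    unfolding jac_rotate[of g v f] 1 .
  then have "- (ev (pderiv P) * (2 * \<alpha> * g)) = 2 * g * jac g v w" by simp
  then have "(2 * g) * (- \<alpha> * ev (pderiv P)) = (2 * g) * jac g v w" by (simp add: ac_simps)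
  then have 4: "jac g v w = - \<alpha> * ev (pderiv P)" using g_nonzero two_nonzero by (metis mult_cancel_left mult_eq_0_iff)
  show ?thesis using that 1 2 3 4 by blast
qed

text \<open>Since \<open>f\<close>, \<open>g\<close>, \<open>v\<close>, \<open>w\<close> generate
  \<open>B\<close>, their minors generate the unit ideal, so their common factor
  \<open>\<alpha>\<close> is a unit. The last claim is the smoothness of the hypersurface.\<close>

lemma minors_unit:
  obtains \<alpha> \<alpha>' where "\<alpha> * \<alpha>' = 1" "jac f g v = 2 * const3 \<alpha> * g" "jac f g w = 2 * const3 \<alpha> * v"
    "jac f v w = 2 * const3 \<alpha> * w" "jac g v w = - const3 \<alpha> * ev (pderiv P)"
    "\<exists>a b c e. 1 = g * a + v * b + w * c + ev (pderiv P) * e"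
proof -
  obtain \<alpha> where \<alpha>: "jac f g v = 2 * \<alpha> * g" "jac f g w = 2 * \<alpha> * v" "jac f v w = 2 * \<alpha> * w"
    "jac g v w = - \<alpha> * ev (pderiv P)" by (rule minors)
  define I where "I = {\<alpha> * (g * a + v * b + w * c + ev (pderiv P) * e) |a b c e. True}"
  have I_I: "\<alpha> * (g * a + v * b + w * c + ev (pderiv P) * e) \<in> I" for a b c e
    unfolding I_def by blast
  have I0: "0 \<in> I" using I_I[of 0 0 0 0] by simp
  have I_mult: "a * b \<in> I" if b: "b \<in> I" for a b
  proof -
    obtain a1 b1 c1 e1 where "b = \<alpha> * (g * a1 + v * b1 + w * c1 + ev (pderiv P) * e1)"
      using b unfolding I_def by blast
    then have "a * b = \<alpha> * (g * (a * a1) + v * (a * b1) + w * (a * c1) + ev (pderiv P) * (a * e1))"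
      by (simp add: algebra_simps)
    then show ?thesis using I_I by metis
  qed
  have I_minus: "- b \<in> I" if "b \<in> I" for b using I_mult[OF that, of "-1"] by simp
  have j: "jac f g v \<in> I" "jac f g w \<in> I" "jac f v w \<in> I" "jac g v w \<in> I"
    using I_I[of 2 0 0 0] I_I[of 0 2 0 0] I_I[of 0 0 2 0] I_I[of 0 0 0 "-1"] \<alpha> by (simp_all add: ac_simps)
  have perm: "jac b c a \<in> I" "jac c a b \<in> I" "jac b a c \<in> I" "jac a c b \<in> I" "jac c b a \<in> I"
    if "jac a b c \<in> I" for a b c
    using that jac_rotate[of b c a] jac_rotate[of a b c] I_minus[OF that] jac_swap[of a b c]
    by (simp_all add: jac_swap(1)[of a b c] jac_swap(2)[of a b c])
  have "1 \<in> I"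
  proof (rule jac_in_ideal_if_generators[OF I0 _ I_mult generators])
    fix a b assume "a \<in> I" "b \<in> I"
    then obtain a1 b1 c1 e1 a2 b2 c2 e2 where "a = \<alpha> * (g * a1 + v * b1 + w * c1 + ev (pderiv P) * e1)"
      "b = \<alpha> * (g * a2 + v * b2 + w * c2 + ev (pderiv P) * e2)" unfolding I_def by blast
    then have "a + b = \<alpha> * (g * (a1 + a2) + v * (b1 + b2) + w * (c1 + c2) + ev (pderiv P) * (e1 + e2))"
      by (simp add: algebra_simps)
    then show "a + b \<in> I" using I_I by metis
  next
    fix a b c assume "a \<in> {f, g, v, w}" "b \<in> {f, g, v, w}" "c \<in> {f, g, v, w}"
    then show "jac a b c \<in> I"
      using j perm[OF j(1)] perm[OF j(2)] perm[OF j(3)] perm[OF j(4)] I0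
      by (elim insertE emptyE) simp_all
  qed
  then obtain a b c e where 1: "1 = \<alpha> * (g * a + v * b + w * c + ev (pderiv P) * e)" unfolding I_def by blast
  have "\<alpha> dvd 1" unfolding 1 by (rule dvd_triv_left)
  then obtain u u' where u: "\<alpha> = const3 u" "u * u' = 1" by (rule unit_poly3)
  have "1 = g * (\<alpha> * a) + v * (\<alpha> * b) + w * (\<alpha> * c) + ev (pderiv P) * (\<alpha> * e)"
    unfolding 1[symmetric, THEN sym] by (simp add: algebra_simps)
  then show ?thesis using that[OF u(2)] \<alpha> u(1) by blast
qed

text \<open>Integrating \<open>v * D w\<close> by parts shows that \<open>v^2\<close> and
  \<open>- g w\<close> have the same average; the relation between \<open>g\<close>,
  \<open>v\<close>, \<open>w\<close> then gives the factor 3.\<close>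

lemma reynolds_gw: "3 * reynolds (g * w) = - ev P"
proof -
  have "reynolds (v * v) = - reynolds (g * w)"
  proof -
    have "reynolds (v * D w) = - reynolds (D v * w)" by (rule reynolds_parts_D)
    then have "2 * reynolds (v * v) = 2 * (- reynolds (g * w))"
      using reynolds_mult[OF invariants_of_int[of 2], of "v * v"] reynolds_mult[OF invariants_of_int[of 2], of "g * w"]
      by (simp add: Dv Dw ac_simps)
    then show ?thesis using two_nonzero by (metis mult_cancel_left)
  qed
  moreover have "reynolds (v * v - 2 * g * w) = ev P"
    unfolding relation by (rule reynolds_invariant[OF ev_inv])
  moreover have "reynolds (v * v - 2 * g * w) = reynolds (v * v) - 2 * reynolds (g * w)"
    using reynolds_mult[OF invariants_of_int[of 2], of "g * w"] by (simp add: reynolds_diff' mult.assoc)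
  ultimately show ?thesis by (simp add: algebra_simps)
qed

text \<open>Averages of the ideal of \<open>g\<close>, \<open>v\<close>, \<open>w\<close> are
  multiples of \<open>P\<close>. Integration by parts moves \<open>U\<close> from \<open>x\<close>
  to these three, so by \<open>U_closed_induct\<close> highest weight vectors suffice. For weight
  reasons, and as \<open>v = U g\<close>, only \<open>w * a\<close> with \<open>a = c g\<close>
  contributes, which is \<open>reynolds_gw\<close>.\<close>

lemma reynolds_gvw: "\<exists>a b c. reynolds (g * x) = ev P * ev a \<and> reynolds (v * x) = ev P * ev b \<and> reynolds (w * x) = ev P * ev c"
proof -
  define I where "I = {ev P * c |c. c \<in> invariants}"
  have I: "ev P * c \<in> I" if "c \<in> invariants" for c using that unfolding I_def by blast
  have I_add: "a + b \<in> I" if "a \<in> I" "b \<in> I" for a b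
    using that unfolding I_def by (auto simp: invariants_add simp flip: distrib_left)
  have inv01: "0 \<in> invariants" "-1 \<in> invariants" by (simp_all add: invariants_def D_simps U_simps)
  have I0: "0 \<in> I" using I[OF inv01(1)] by simp
  have I_mult: "a * b \<in> I" if "a \<in> invariants" "b \<in> I" for a b
    using that unfolding I_def by (auto simp: mult.left_commute intro: invariants_mult)
  have I_minus: "- a \<in> I" if "a \<in> I" for a using I_mult[OF inv01(2) that] by simp
  have gw: "reynolds (g * w) \<in> I"
  proof -
    obtain u where u: "of_int 3 * u = 1" "D u = 0" "U u = 0" using int_inverse[of 3] by auto
    have "reynolds (g * w) = (3 * u) * reynolds (g * w)" using u(1) by simp
    also have "\<dots> = u * (3 * reynolds (g * w))" by (simp only: ac_simps)
    also have "\<dots> = ev P * (- u)" unfolding reynolds_gw by simp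
    finally have "reynolds (g * w) = ev P * (- u)" .
    moreover have "- u \<in> invariants" using u by (simp add: invariants_def D_simps U_simps)
    ultimately show ?thesis using I by metis
  qed
  define Q where "Q x \<longleftrightarrow> reynolds (g * x) \<in> I \<and> reynolds (v * x) \<in> I \<and> reynolds (w * x) \<in> I" for x
  have Q_add: "Q (x + y)" if "Q x" "Q y" for x y
    using that by (simp add: Q_def distrib_left reynolds_add I_add)
  have Q_hom: "Q a" if a: "a \<in> wt d" "D a = 0" for a d
  proof (cases "a = 0")
    case True
    then show ?thesis using I0 by (simp add: Q_def reynolds_coboundary)
  next
    case False
    then have "d \<ge> 0" using highest_weight_nonneg a by blast
    have "reynolds (g * a) = 0" using wt_mult[OF wt_g a(1)] \<open>d \<ge> 0\<close> reynolds_wt by force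
    moreover have "reynolds (v * a) = 0"
    proof (cases "d = 0")
      case True
      then have "a \<in> invariants" using highest_weight_0_invariant a by blast
      then have "reynolds (a * U g) = a * reynolds (U g)" by (rule reynolds_mult)
      then have "reynolds (a * U g) = 0" by simp
      then show ?thesis by (simp add: Ug mult.commute)
    next
      case False
      then show ?thesis using wt_mult[OF wts(1) a(1)] reynolds_wt by force
    qed
    moreover have "reynolds (w * a) \<in> I"
    proof (cases "d = 2")
      case True
      obtain c j where c: "c \<in> invariants" "a = c * g ^ j" "d = int j * 2"
        using prime_highest_weight_generator[OF g_prime wt_g Dg _ False a] by auto
      then have "a = c * g" using True by simp
      then have "reynolds (w * a) = reynolds (c * (g * w))" by (simp add: ac_simps)
      also have "\<dots> = c * reynolds (g * w)" using c(1) by (rule reynolds_mult)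
      finally show ?thesis using I_mult[OF c(1) gw] by simp
    next
      case False
      then have "reynolds (w * a) = 0" using wt_mult[OF wts(2) a(1)] reynolds_wt by force
      then show ?thesis using I0 by simp
    qed
    ultimately show ?thesis using I0 by (simp add: Q_def)
  qed
  have "Q x"
  proof (induction x rule: U_closed_induct)
    case (kernel a)
    then show ?case by (induction rule: kernel_induct) (auto intro: Q_hom Q_add)
  next
    case (add a b)
    then show ?case by (rule Q_add)
  next
    case (U a)
    then show ?case
      using I_minus I0 by (simp add: Q_def reynolds_parts_U Ug Uv Uw reynolds_coboundary)
  qed
  then show ?thesis using f_gen unfolding Q_def I_def ev_def by blast
qed

text \<open>Averaging \<open>1 = g a + v b + w c + P' e\<close> turns the first three terms into
  multiples of \<open>P\<close>.\<close>

lemma separable: "\<exists>C Q. P * C + pderiv P * Q = 1"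
proof -
  obtain \<alpha> \<alpha>' where "\<alpha> * \<alpha>' = 1" "jac f g v = 2 * const3 \<alpha> * g" "jac f g w = 2 * const3 \<alpha> * v"
    "jac f v w = 2 * const3 \<alpha> * w" "jac g v w = - const3 \<alpha> * ev (pderiv P)"
    and "\<exists>a b c e. 1 = g * a + v * b + w * c + ev (pderiv P) * e" by (rule minors_unit)
  then obtain a b c e where one: "1 = g * a + v * b + w * c + ev (pderiv P) * e" by blast
  have "1 = reynolds 1" using reynolds_invariant[OF invariants_of_int[of 1]] by simp
  also have "\<dots> = reynolds (g * a) + reynolds (v * b) + reynolds (w * c) + ev (pderiv P) * reynolds e"
    by (subst one) (simp add: reynolds_add reynolds_mult[OF ev_inv])
  finally have eq: "1 = reynolds (g * a) + reynolds (v * b) + reynolds (w * c) + ev (pderiv P) * reynolds e" .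
  obtain a' where a': "reynolds (g * a) = ev P * ev a'" using reynolds_gvw by blast
  obtain b' where b': "reynolds (v * b) = ev P * ev b'" using reynolds_gvw by blast
  obtain c' where c': "reynolds (w * c) = ev P * ev c'" using reynolds_gvw by blast
  obtain e' where e': "reynolds e = ev e'" using f_gen[OF reynolds_in] unfolding ev_def by blast
  have "ev (P * (a' + b' + c') + pderiv P * e') = ev 1"
    unfolding ev_ring using eq unfolding a' b' c' e' by (simp add: algebra_simps)
  then show ?thesis unfolding ev_inject by blast
qed

text \<open>In the ambient 4-space this is \<open>2 P \<partial>_f + P' (g \<partial>_g + v
  \<partial>_v + w \<partial>_w)\<close>, which is tangent to the hypersurface as both sides of its
  equation are multiplied by \<open>2 P'\<close> or sent to \<open>2 P P'\<close>. Writing it with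
  the divergence-free fields \<open>jac a b\<close> both shows that it lives on \<open>B\<close> and
  yields its divergence.\<close>

lemma transversal_field:
  obtains \<Theta> where "poly3_derivation \<Theta>" "\<Theta> f = 2 * ev P" "\<Theta> g = g * ev (pderiv P)"
    "\<Theta> v = v * ev (pderiv P)" "\<Theta> w = w * ev (pderiv P)" "divergence \<Theta> = 3 * ev (pderiv P)"
proof -
  obtain \<alpha> \<alpha>' where \<alpha>: "\<alpha> * \<alpha>' = 1" and j: "jac f g v = 2 * const3 \<alpha> * g" "jac f g w = 2 * const3 \<alpha> * v"
    "jac f v w = 2 * const3 \<alpha> * w" "jac g v w = - const3 \<alpha> * ev (pderiv P)"
    and "\<exists>a b c e. 1 = g * a + v * b + w * c + ev (pderiv P) * e" by (rule minors_unit)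
  define t where "t h = v * jac g w h + (- w) * jac g v h + (- g) * jac v w h" for h
  define \<Theta> where "\<Theta> h = const3 \<alpha>' * t h" for h
  have "\<alpha>' * \<alpha> = 1" using \<alpha> by (simp only: mult.commute)
  then have "const3 \<alpha>' * const3 \<alpha> = 1" by (simp flip: const3_mult)
  then have unit: "const3 \<alpha>' * (const3 \<alpha> * x) = x" for x by (simp flip: mult.assoc)
  have t: "poly3_derivation t" unfolding t_def
    by (intro poly3_derivation_add poly3_derivation_scale poly3_derivation_jac)
  have j': "jac g w f = const3 \<alpha> * (2 * v)" "jac g v f = const3 \<alpha> * (2 * g)" "jac v w f = const3 \<alpha> * (2 * w)"
    "jac g w v = const3 \<alpha> * ev (pderiv P)" "jac v w g = const3 \<alpha> * (- ev (pderiv P))"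
    using jac_rotate[of g w f] jac_rotate[of g v f] jac_rotate[of v w f] jac_rotate[of v w g]
      jac_swap(2)[of g v w] j by (simp_all add: ac_simps)
  have jac_der: "derivation (jac a b)" for a b :: "'r poly3"
    using poly3_derivation_jac[of a b] by (simp add: poly3_derivation_def)
  have "divergence t = jac g w v - jac g v w - jac v w g"
    unfolding t_def divergence_add divergence_scale[OF poly3_derivation_jac] divergence_jac
    by (simp add: derivation_minus[OF jac_der])
  also have "\<dots> = const3 \<alpha> * (3 * ev (pderiv P))" unfolding j' j by (simp add: algebra_simps)
  finally have div_t: "divergence t = const3 \<alpha> * (3 * ev (pderiv P))" .
  have "divergence \<Theta> = 3 * ev (pderiv P)"
    unfolding \<Theta>_def divergence_scale[OF t] div_t unit using t by (simp add: poly3_derivation_def)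
  moreover have "\<Theta> f = 2 * ev P"
  proof -
    have "t f = const3 \<alpha> * (2 * (v * v - 2 * g * w))" unfolding t_def j' by (simp add: algebra_simps)
    then show ?thesis unfolding \<Theta>_def relation by (simp add: unit)
  qed
  moreover have "\<Theta> g = g * ev (pderiv P)"
  proof -
    have "t g = const3 \<alpha> * (g * ev (pderiv P))" unfolding t_def j' by (simp add: algebra_simps)
    then show ?thesis unfolding \<Theta>_def by (simp add: unit)
  qed
  moreover have "\<Theta> v = v * ev (pderiv P)"
  proof -
    have "t v = const3 \<alpha> * (v * ev (pderiv P))" unfolding t_def j' by (simp add: algebra_simps)
    then show ?thesis unfolding \<Theta>_def by (simp add: unit)
  qed
  moreover have "\<Theta> w = w * ev (pderiv P)"
  proof -
    have "t w = const3 \<alpha> * (w * ev (pderiv P))" unfolding t_def j by (simp add: algebra_simps)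
    then show ?thesis unfolding \<Theta>_def by (simp add: unit)
  qed
  moreover have "poly3_derivation \<Theta>" unfolding \<Theta>_def using t by (rule poly3_derivation_scale)
  ultimately show ?thesis using that by blast
qed

lemma commute_if_generators:
  assumes "poly3_derivation X" "poly3_derivation Y"
    and "X (Y f) = Y (X f)" "X (Y g) = Y (X g)" "X (Y v) = Y (X v)" "X (Y w) = Y (X w)"
  shows "X (Y h) = Y (X h)"
  using derivation_eqI[OF poly3_derivation_commutator[OF assms(1,2)] poly3_derivation_zero, of h] assms
  by simp

text \<open>Decomposing a vector field of divergence 1 along \<open>\<Theta>\<close> and the orbits, and averaging its
  divergence.\<close>

lemma differential_equation: "\<exists>\<beta>. 2 * P = pderiv P * \<beta> + 2 * P * pderiv \<beta>"
proof -
  obtain \<Theta> where \<Theta>: "poly3_derivation \<Theta>" and \<Theta>_gen: "\<Theta> f = 2 * ev P" "\<Theta> g = g * ev (pderiv P)"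
    "\<Theta> v = v * ev (pderiv P)" "\<Theta> w = w * ev (pderiv P)" and div: "divergence \<Theta> = 3 * ev (pderiv P)"
    by (rule transversal_field)
  have der: "derivation \<Theta>" "derivation D" "derivation U" using \<Theta> D_der U_der by (auto simp: poly3_derivation_def)
  have D_ev: "D (ev p) = 0" "U (ev p) = 0" for p using ev_inv by (simp_all add: invariants_def)
  have D_\<Theta>: "\<Theta> (D h) = D (\<Theta> h)" for h
    by (rule commute_if_generators[OF \<Theta> poly3_D])
      (simp_all add: \<Theta>_gen f_const Dg Dv Dw D_ev D_mult D_simps derivation_0[OF der(1)]
        derivation_mult[OF der(1)] derivation_numeral[OF der(1)] ac_simps)
  have U_\<Theta>: "\<Theta> (U h) = U (\<Theta> h)" for h
    by (rule commute_if_generators[OF \<Theta> poly3_U])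
      (simp_all add: \<Theta>_gen f_const Ug Uv Uw D_ev U_mult U_simps derivation_0[OF der(1)]
        derivation_mult[OF der(1)] derivation_numeral[OF der(1)] ac_simps)
  define X where "X h = x0 * d0 h" for h :: "'r poly3"
  have X: "poly3_derivation X" unfolding X_def by (intro poly3_derivation_scale) simp
  have div_X: "divergence X = 1" by (simp add: divergence_def X_def)
  \<comment> \<open>The coefficients are, up to signs and factors 2, the minors of
    \<open>(g, v, w)\<close> against \<open>(X g, X v, X w)\<close>. As for rotations of a quadric,
    this cross product gives the tangential part of \<open>2 P X\<close>.\<close>
  define T where "T h = (v * X w - w * X v) * D h + (2 * v * X g - 2 * g * X v) * U h + (g * X w - w * X g) * E h" for h
  have T: "poly3_derivation T" unfolding T_def
    by (intro poly3_derivation_add poly3_derivation_scale poly3_D poly3_U poly3_E)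
  have div_T: "divergence T \<in> coboundaries" unfolding T_def by (rule divergence_tangent)
  have rel: "ev (pderiv P) * X f = 2 * v * X v - 2 * g * X w - 2 * w * X g"
    by (rule derivation_relation[OF X])
  have relP: "ev P = v * v - 2 * g * w" using relation by simp
  have decomposition: "(2 * ev P) * X h = X f * \<Theta> h + T h" for h
  proof (rule derivation_eqI[where X = "\<lambda>h. (2 * ev P) * X h" and Y = "\<lambda>h. X f * \<Theta> h + T h"])
    show "poly3_derivation (\<lambda>h. (2 * ev P) * X h)" by (intro poly3_derivation_scale X)
    show "poly3_derivation (\<lambda>h. X f * \<Theta> h + T h)" by (intro poly3_derivation_add poly3_derivation_scale \<Theta> T)
    show "2 * ev P * X f = X f * \<Theta> f + T f" by (simp add: \<Theta>_gen T_def f_const)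
    have "X f * \<Theta> g = g * (ev (pderiv P) * X f)" by (simp add: \<Theta>_gen ac_simps)
    then show "2 * ev P * X g = X f * \<Theta> g + T g"
      unfolding rel T_def Dg Ug E_gvw relP by (simp add: algebra_simps)
    have "X f * \<Theta> v = v * (ev (pderiv P) * X f)" by (simp add: \<Theta>_gen ac_simps)
    then show "2 * ev P * X v = X f * \<Theta> v + T v"
      unfolding rel T_def Dv Uv E_gvw relP by (simp add: algebra_simps)
    have "X f * \<Theta> w = w * (ev (pderiv P) * X f)" by (simp add: \<Theta>_gen ac_simps)
    then show "2 * ev P * X w = X f * \<Theta> w + T w"
      unfolding rel T_def Dw Uw E_gvw relP by (simp add: algebra_simps)
  qed
  have derX: "derivation X" using X by (simp add: poly3_derivation_def)
  have "divergence (\<lambda>h. (2 * ev P) * X h) = 2 * ev P + 2 * (ev (pderiv P) * X f)"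
    unfolding divergence_scale[OF X] div_X
    by (simp add: derivation_mult[OF derX] derivation_numeral[OF derX] derivation_ev[OF X])
  moreover have "divergence (\<lambda>h. (2 * ev P) * X h) = (X f * (3 * ev (pderiv P)) + \<Theta> (X f)) + divergence T"
    unfolding decomposition divergence_add divergence_scale[OF \<Theta>] div by simp
  ultimately have eq: "2 * ev P + 2 * (ev (pderiv P) * X f)
      = X f * (3 * ev (pderiv P)) + \<Theta> (X f) + divergence T" by simp
  obtain \<beta> where \<beta>: "reynolds (X f) = ev \<beta>" using f_gen[OF reynolds_in] unfolding ev_def by blast
  have two_ev: "2 = ev 2" using ev_ring(1)[of 1 1] ev_ring(3) by simp
  have "reynolds (2 * ev P + 2 * (ev (pderiv P) * X f)) = ev (2 * P) + ev (2 * pderiv P) * ev \<beta>"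
  proof -
    have "2 * ev P = ev (2 * P)" "2 * (ev (pderiv P) * X f) = ev (2 * pderiv P) * X f"
      unfolding ev_ring two_ev by (simp_all add: ac_simps)
    then show ?thesis
      by (simp only: reynolds_add reynolds_invariant[OF ev_inv] reynolds_mult[OF ev_inv] \<beta>)
  qed
  moreover have "reynolds (X f * (3 * ev (pderiv P)) + \<Theta> (X f) + divergence T)
      = ev (3 * pderiv P) * ev \<beta> + ev (pderiv \<beta>) * ev (2 * P)"
  proof -
    have "3 = ev 3" using ev_ring(1)[of 1 2] ev_ring(3) two_ev by simp
    then have "X f * (3 * ev (pderiv P)) = ev (3 * pderiv P) * X f"
      unfolding ev_ring by (simp add: ac_simps)
    moreover have "reynolds (\<Theta> (X f)) = \<Theta> (ev \<beta>)"
      using reynolds_commute[OF der(1) D_\<Theta> U_\<Theta>] \<beta> by simp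
    moreover have "\<Theta> (ev \<beta>) = ev (pderiv \<beta>) * ev (2 * P)"
      unfolding derivation_ev[OF \<Theta>] \<Theta>_gen ev_ring two_ev ..
    ultimately show ?thesis
      by (simp only: reynolds_add reynolds_mult[OF ev_inv] \<beta> reynolds_coboundary[OF div_T] add_0_right)
  qed
  ultimately have "ev (2 * P + 2 * pderiv P * \<beta>) = ev (3 * pderiv P * \<beta> + pderiv \<beta> * (2 * P))"
    using eq by (simp only: ev_ring(1,2))
  then have "2 * P + 2 * pderiv P * \<beta> = 3 * pderiv P * \<beta> + pderiv \<beta> * (2 * P)" unfolding ev_inject .
  then have "2 * P = 3 * pderiv P * \<beta> + pderiv \<beta> * (2 * P) - 2 * pderiv P * \<beta>"
    by (simp only: eq_diff_eq)
  also have "\<dots> = pderiv P * \<beta> + 2 * P * pderiv \<beta>" by (simp add: algebra_simps)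
  finally show ?thesis by blast
qed

text \<open>If \<open>P\<close> were constant, \<open>\<Theta>\<close> would be divergence free, so contracting the volume form with it
  gives an exact 2-form \<open>d \<eta>\<close>. It restricts to the invariant area form of the orbits, whose class
  is not zero.\<close>

lemma degree_P: "degree P > 0"
proof (rule ccontr)
  assume "\<not> degree P > 0"
  then obtain c where c: "P = [:c:]" by (auto elim: degree_eq_zeroE)
  then have "c \<noteq> 0" using P_nonzero by auto
  have P': "ev (pderiv P) = 0" "ev P = const3 c" using c by (simp_all add: ev_ring ev_const)
  obtain \<Theta> where \<Theta>: "poly3_derivation \<Theta>" and \<Theta>_gen: "\<Theta> f = 2 * const3 c" "\<Theta> g = 0"
    "\<Theta> v = 0" "\<Theta> w = 0" and div: "divergence \<Theta> = 0"
    using transversal_field unfolding P' by (metis mult_zero_right)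
  obtain \<alpha> \<alpha>' where \<alpha>: "\<alpha> * \<alpha>' = 1" and j: "jac f g v = 2 * const3 \<alpha> * g" "jac f g w = 2 * const3 \<alpha> * v"
    "jac f v w = 2 * const3 \<alpha> * w" "jac g v w = - const3 \<alpha> * ev (pderiv P)"
    and "\<exists>a b c e. 1 = g * a + v * b + w * c + ev (pderiv P) * e" by (rule minors_unit)
  have "d0 (\<Theta> x0) + d1 (\<Theta> x1) + d2 (\<Theta> x2) = 0" using div by (simp add: divergence_def)
  then obtain y0 y1 where y: "\<Theta> x0 = - d2 y1" "\<Theta> x1 = d2 y0" "\<Theta> x2 = d0 y1 - d1 y0"
    by (rule poincare_divergence_free[OF rat_R])
  \<comment> \<open>The 1-form \<open>y0 dx0 + y1 dx1\<close>, whose exterior derivative is the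
    volume form contracted with \<open>\<Theta>\<close>; \<open>exact\<close> is the formula for an
    exterior derivative evaluated on two fields.\<close>
  define \<eta> where "\<eta> X = y0 * X x0 + y1 * X x1" for X :: "'r poly3 \<Rightarrow> 'r poly3"
  have exact: "vdet \<Theta> X Y = X (\<eta> Y) - Y (\<eta> X) - (y0 * (X (Y x0) - Y (X x0)) + y1 * (X (Y x1) - Y (X x1)))"
    if "poly3_derivation X" "poly3_derivation Y" for X Y
  proof -
    have X: "derivation X" and Y: "derivation Y" using that by (auto simp: poly3_derivation_def)
    show ?thesis
      unfolding \<eta>_def derivation_add[OF X] derivation_mult[OF X] derivation_add[OF Y] derivation_mult[OF Y]
        poly3_derivation_eq[OF that(1), of y0] poly3_derivation_eq[OF that(1), of y1]
        poly3_derivation_eq[OF that(2), of y0] poly3_derivation_eq[OF that(2), of y1]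
      by (simp add: vdet_def det3_def y algebra_simps)
  qed
  have \<sigma>1: "vdet \<Theta> D U = D (\<eta> U) - U (\<eta> D) - \<eta> E"
    unfolding exact[OF poly3_D poly3_U] E_eq[symmetric] by (simp add: \<eta>_def)
  have \<sigma>2: "vdet \<Theta> E D = E (\<eta> D) - D (\<eta> E) - 2 * \<eta> D"
  proof -
    have "E (D h) - D (E h) = 2 * D h" for h using D_E[of h] by (simp add: algebra_simps)
    then show ?thesis unfolding exact[OF poly3_E poly3_D] by (simp add: \<eta>_def algebra_simps)
  qed
  have "w * D h + (- (2 * g)) * U h + v * E h = 0" for h
    by (rule derivation_eqI[where X = "\<lambda>h. w * D h + (- (2 * g)) * U h + v * E h" and Y = "\<lambda>h. 0"])
      (intro poly3_derivation_add poly3_derivation_scale poly3_derivation_zero poly3_D poly3_U poly3_E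
        | simp add: f_const Dg Dv Dw Ug Uv Uw E_gvw)+
  then have tangent: "w * D h = 2 * g * U h - v * E h" for h by (simp add: algebra_simps add_eq_0_iff)
  have rel: "w * \<eta> D = 2 * g * \<eta> U - v * \<eta> E"
  proof -
    have "w * \<eta> D = y0 * (w * D x0) + y1 * (w * D x1)" by (simp add: \<eta>_def algebra_simps)
    also have "\<dots> = 2 * g * \<eta> U - v * \<eta> E" unfolding tangent by (simp add: \<eta>_def algebra_simps)
    finally show ?thesis .
  qed
  have two: "reynolds (2 * x) = 2 * reynolds x" for x
    using reynolds_mult[OF invariants_of_int[of 2], of x] by simp
  \<comment> \<open>This combination of values of the area form averages to 0 by parts, once
    \<open>w * \<eta> D\<close> is rewritten by the orbit relation \<open>rel\<close>. Computed
    directly, it becomes \<open>- 2 c^2\<close> after multiplication with the unit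
    \<open>\<alpha>\<close>.\<close>
  have "reynolds (v * vdet \<Theta> D U + w * vdet \<Theta> E D) = 0"
  proof -
    have 1: "reynolds (v * D (\<eta> U)) = - (2 * reynolds (g * \<eta> U))"
      using reynolds_parts_D[of v "\<eta> U"] by (simp add: Dv mult.assoc two)
    have 2: "reynolds (v * U (\<eta> D)) = - reynolds (w * \<eta> D)"
      using reynolds_parts_U[of v "\<eta> D"] by (simp add: Uv)
    have 3: "reynolds (w * E (\<eta> D)) = 2 * reynolds (w * \<eta> D)"
      using reynolds_parts_E[of w "\<eta> D"] by (simp add: E_gvw mult.assoc two reynolds_minus)
    have 4: "reynolds (w * D (\<eta> E)) = - (2 * reynolds (v * \<eta> E))"
      using reynolds_parts_D[of w "\<eta> E"] by (simp add: Dw mult.assoc two)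
    have 5: "reynolds (w * (2 * \<eta> D)) = 2 * reynolds (w * \<eta> D)" using two[of "w * \<eta> D"] by (simp add: ac_simps)
    have 6: "reynolds (w * \<eta> D) = 2 * reynolds (g * \<eta> U) - reynolds (v * \<eta> E)"
      unfolding rel by (simp add: reynolds_diff' mult.assoc two)
    show ?thesis
      unfolding \<sigma>1 \<sigma>2 right_diff_distrib reynolds_add reynolds_diff' 1 2 3 4 5 6 by (simp add: algebra_simps)
  qed
  moreover have "const3 \<alpha> * (v * vdet \<Theta> D U + w * vdet \<Theta> E D) = - (2 * (const3 c * const3 c))"
  proof -
    \<comment> \<open>The area form is evaluated through the functions \<open>f\<close>,
      \<open>g\<close>, \<open>v\<close>, whose Jacobian determinant is
      \<open>2 \<alpha> g\<close>.\<close>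
    have "vdet \<Theta> D U * jac f g v = - ((2 * g) * (2 * const3 c * v))"
      unfolding vdet_jac[OF \<Theta> poly3_D poly3_U] by (simp add: det3_def \<Theta>_gen f_const Dg Dv Ug Uv ac_simps)
    then have "(2 * g) * (vdet \<Theta> D U * const3 \<alpha>) = (2 * g) * (- (2 * const3 c * v))"
      unfolding j by (simp add: ac_simps)
    then have 1: "vdet \<Theta> D U * const3 \<alpha> = - (2 * const3 c * v)"
      using g_nonzero two_nonzero by (metis mult_cancel_left mult_eq_0_iff)
    have "vdet \<Theta> E D * jac f g v = (2 * g) * (4 * const3 c * g)"
      unfolding vdet_jac[OF \<Theta> poly3_E poly3_D] by (simp add: det3_def \<Theta>_gen f_const Dg Dv E_gvw ac_simps)
    then have "(2 * g) * (vdet \<Theta> E D * const3 \<alpha>) = (2 * g) * (4 * const3 c * g)"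
      unfolding j by (simp add: ac_simps)
    then have 2: "vdet \<Theta> E D * const3 \<alpha> = 4 * const3 c * g"
      using g_nonzero two_nonzero by (metis mult_cancel_left mult_eq_0_iff)
    have "const3 \<alpha> * (v * vdet \<Theta> D U + w * vdet \<Theta> E D)
        = v * (vdet \<Theta> D U * const3 \<alpha>) + w * (vdet \<Theta> E D * const3 \<alpha>)" by (simp add: algebra_simps)
    also have "\<dots> = - (2 * (const3 c * (v * v - 2 * g * w)))" unfolding 1 2 by (simp add: algebra_simps)
    finally show ?thesis unfolding relation P' .
  qed
  ultimately have "reynolds (- (2 * (const3 c * const3 c))) = 0"
    using reynolds_mult[OF const3_invariant, of \<alpha> "v * vdet \<Theta> D U + w * vdet \<Theta> E D"] by simp
  moreover have "- (2 * (const3 c * const3 c)) \<in> invariants"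
    unfolding two_const3 by (intro invariants_minus invariants_mult const3_invariant)
  ultimately have "- (2 * (const3 c * const3 c)) = 0" using reynolds_invariant by metis
  then show False using two_nonzero \<open>c \<noteq> 0\<close> by simp
qed

theorem weight_2_equivalent:
  "equivalent_over (range const3) (D, U)
    ((\<lambda>f. x0 * d1 f + x1 * d2 f), (\<lambda>f. 2 * x1 * d0 f + 2 * x2 * d1 f))"
proof -
  obtain C Q where CQ: "P * C + pderiv P * Q = 1" using separable by blast
  obtain \<beta> where \<beta>: "2 * P = pderiv P * \<beta> + 2 * P * pderiv \<beta>" using differential_equation by blast
  have deg: "degree P = 1" "lead_coeff P dvd 1"
    using linear_if_differential_equation[OF rat_R \<beta> CQ degree_P] by blast+
  obtain k where k: "lead_coeff P * k = 1" using deg(2) by (metis dvdE)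
  define a where "a = coeff P 0"
  define b where "b = coeff P 1"
  have bk: "k * b = 1" using k deg(1) by (simp add: b_def mult.commute)
  have "P = [:a, b:]" using deg(1)
    by (intro poly_eqI) (auto simp: a_def b_def coeff_pCons coeff_eq_0 split: nat.split)
  then have "ev P = const3 a + f * const3 b" by (simp add: ev_pCons ev_ring)
  then have "const3 k * (v * v - 2 * g * w + const3 (- a)) = const3 (k * b) * f"
    unfolding relation by (simp add: const3_minus const3_mult ac_simps)
  then have f_eq: "f = const3 k * (v * v + const3 (-2) * g * w + const3 (- a))"
    unfolding bk const3_minus by (simp flip: two_const3)
  \<comment> \<open>Taking half of \<open>v\<close> and a quarter of \<open>w\<close> turns
    \<open>D v = 2 g\<close>, \<open>D w = 2 v\<close>, \<open>U g = v\<close>,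
    \<open>U v = w\<close> into the constants of the standard pair.\<close>
  define v' where "v' = const3 half * v"
  define w' where "w' = const3 half * (const3 half * w)"
  have double_half: "const3 2 * (const3 half * x) = x" for x
    using const3_half unfolding two_const3 by (simp flip: mult.assoc)
  have v: "v = const3 2 * v'" and w: "w = const3 2 * (const3 2 * w')"
    by (simp_all only: v'_def w'_def double_half)
  let ?S = "subring_generated (range const3 \<union> {g, v', w'})"
  have base: "const3 r \<in> ?S" "g \<in> ?S" "v' \<in> ?S" "w' \<in> ?S" for r
    by (auto intro: subring_generated.base)
  have vw: "v \<in> ?S" "w \<in> ?S" unfolding v w by (intro subring_generated.mult base)+
  have "f \<in> ?S" unfolding f_eq by (intro subring_generated.mult subring_generated.add base vw)
  then have "subring_generated (range const3 \<union> {g, v', w'}) = UNIV"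
    using base vw by (intro subring_generated_UNIV_trans[OF generators]) auto
  then have bij: "bij (subst3 g v' w')" by (rule bij_subst3[OF rat_R])
  have half_const: "D (const3 half) = 0" "U (const3 half) = 0" by (simp_all add: D_const U_const)
  have Dv': "D v' = g"
  proof -
    have "D v' = (2 * const3 half) * g" unfolding v'_def by (simp add: D_mult half_const Dv)
    then show ?thesis unfolding const3_half by simp
  qed
  have Dw': "D w' = v'"
  proof -
    have "D w' = (2 * const3 half) * (const3 half * v)" unfolding w'_def by (simp add: D_mult half_const Dw)
    then show ?thesis unfolding const3_half by (simp add: v'_def)
  qed
  have Ug': "U g = 2 * v'" unfolding Ug two_const3 by (rule v)
  have Uv': "U v' = 2 * w'"
  proof -
    have "2 * w' = (2 * const3 half) * (const3 half * w)" unfolding w'_def by (simp only: mult.assoc)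
    then show ?thesis unfolding const3_half v'_def by (simp add: U_mult half_const Uv)
  qed
  have Uw': "U w' = 0" unfolding w'_def by (simp add: U_mult half_const Uw)
  have subst2: "subst3 g v' w' 2 = 2" unfolding two_const3 by simp
  show ?thesis
  proof (rule equivalent_over_subst3[OF bij])
    show "D (subst3 g v' w' h) = subst3 g v' w' (x0 * d1 h + x1 * d2 h)" for h
      by (simp add: derivation_subst3[OF poly3_D] subst3_mult subst3_add Dg Dv' Dw' ac_simps)
    show "U (subst3 g v' w' h) = subst3 g v' w' (2 * x1 * d0 h + 2 * x2 * d1 h)" for h
      by (simp add: derivation_subst3[OF poly3_U] subst3_mult subst3_add subst2 Ug' Uv' Uw' ac_simps)
  qed
qed

end

section \<open>Both cases combined\<close>

lemma (in fundamental3) equivalent_standard_pair: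
  "equivalent_over (range const3) (D, U) ((\<lambda>f. x0 * d1 f), (\<lambda>f. x1 * d0 f))
    \<or> equivalent_over (range const3) (D, U)
        ((\<lambda>f. x0 * d1 f + x1 * d2 f), (\<lambda>f. 2 * x1 * d0 f + 2 * x2 * d1 f))"
proof -
  obtain g m where g: "prime_elem g" "g \<in> wt m" "D g = 0" and m: "m = 1 \<or> m = 2"
    and gen: "subring_generated (invariants \<union> {g, U g, U (U g)}) = UNIV"
    and top: "m = 1 \<Longrightarrow> U (U g) = 0" "U (U (U g)) = 0"
    by (rule exists_generator) blast
  show ?thesis
    using m
  proof
    assume "m = 1"
    then show ?thesis using weight_1_equivalent g top gen by blast
  next
    assume m: "m = 2"
    obtain f where f: "f \<in> invariants" "prime_elem f" "eval0 f = 0"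
      "\<And>p. p \<in> invariants \<Longrightarrow> \<exists>P. p = poly (map_poly const3 P) f"
      by (rule exists_invariant_generator) blast
    have wt: "g \<in> wt 2" using m g(2) by simp
    obtain P where "U g * U g - 2 * g * U (U g) = poly (map_poly const3 P) f"
      using f(4) weight_2_triple(3)[OF wt g(3) top(2)] by blast
    then interpret weight_2_pair D U E f g "U g" "U (U g)" P
      using g wt f gen top(2) by unfold_locales auto
    show ?thesis using weight_2_equivalent by blast
  qed
qed

theorem theorem6p4:
  fixes \<iota> :: "'k::field_char_0 \<Rightarrow> 'r::{factorial_semiring, idom_divide}"
    and D U :: "'r poly3 \<Rightarrow> 'r poly3"
  assumes "affine_algebra \<iota>"
    and "D \<in> LND_over (range const3)"
    and "U \<in> LND_over (range const3)"
    and "fundamental_pair (D, U)"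
    and "\<not> trivial_pair (D, U)"
  shows "equivalent_over (range const3) (D, U)
           ((\<lambda>f. x0 * d1 f), (\<lambda>f. x1 * d0 f))
       \<or> equivalent_over (range const3) (D, U)
           ((\<lambda>f. x0 * d1 f + x1 * d2 f), (\<lambda>f. 2 * x1 * d0 f + 2 * x2 * d1 f))"
proof -
  define E where "E = commutator D U"
  have morphism: "ring_morphism \<iota>" using assms(1) by (simp add: affine_algebra_def)
  have \<iota>_nat: "\<iota> (of_nat n) = of_nat n" for n
    using morphism ring_morphism_0[OF morphism] by (induction n) (auto simp: ring_morphism_def)
  have rat_r: "rational_algebra TYPE('r)"
    unfolding rational_algebra_def
  proof (intro allI impI)
    fix n :: nat assume "n > 0"
    then have "\<iota> (of_nat n * inverse (of_nat n)) = 1" using morphism by (simp add: ring_morphism_def)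
    then have "of_nat n * \<iota> (inverse (of_nat n)) = 1" using morphism \<iota>_nat by (simp add: ring_morphism_def)
    then show "(of_nat n :: 'r) dvd 1" by (metis dvd_triv_left)
  qed
  have const: "D (const3 r) = 0" "U (const3 r) = 0" for r using assms(2,3) by (auto simp: LND_over_def)
  have D: "D \<in> LND" and U: "U \<in> LND"
    and DE: "commutator D E = (\<lambda>b. - 2 * D b)" and UE: "commutator U E = (\<lambda>b. 2 * U b)"
    and decomp: "\<forall>b. \<exists>S c. finite S \<and> (\<forall>d\<in>S. c d \<in> eigenspace E d) \<and> b = (\<Sum>d\<in>S. c d)"
    using assms(4) by (auto simp: fundamental_pair_def E_def)
  have rat3: "rational_algebra TYPE('r poly3)" by (intro rational_algebra_poly rat_r)
  interpret sl2_pair D U E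
  proof
    fix b
    show "E b = D (U b) - U (D b)" by (simp add: E_def commutator_def)
    show "D (E b) - E (D b) = - 2 * D b" using fun_cong[OF DE, of b] by (simp add: commutator_def)
    show "U (E b) - E (U b) = 2 * U b" using fun_cong[OF UE, of b] by (simp add: commutator_def)
    show "\<exists>S c. finite S \<and> (\<forall>d\<in>S. c d \<in> eigenspace E d) \<and> b = (\<Sum>d\<in>S. c d)" using decomp by blast
  qed (fact rat3 D U)+
  \<comment> \<open>A nontrivial pair has \<open>D\<close> nonzero: otherwise \<open>E\<close>
    vanishes, and with it \<open>2 U\<close>, the bracket of \<open>U\<close> and
    \<open>E\<close>.\<close>
  have "\<exists>b. D b \<noteq> 0"
  proof (rule ccontr)
    assume "\<not> ?thesis"
    then have D0: "D b = 0" for b by blast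
    have "U b = 0" for b
    proof -
      have "E c = 0" for c by (simp add: E_eq D0 U_simps)
      then have "2 * U b = 0" using U_E[of b] by (simp add: U_simps)
      then show ?thesis using of_int_eq_0[of 2] by simp
    qed
    then show False using assms(5) D0 by (simp add: trivial_pair_def fun_eq_iff)
  qed
  then interpret fundamental3 D U E
    using ufd_factorial_semiring rat_r const by unfold_locales
  show ?thesis by (rule equivalent_standard_pair)
qed

end
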